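(* Let $k \ge 1$ be a fixed integer. For each $n \ge 1$ let $\mathsf{U}_n$ be chosen uniformly at random among all unlabelled $k$-trees with $n$ hedra, and let $\mathrm{D}(\mathsf{U}_n)$ denote its diameter with respect to the graph distance. There are constants $C, c > 0$ such that for all $n \ge 1$ and all real $x \ge 0$ $$\mathbb{P}(\mathrm{D}(\mathsf{U}_n) \ge x) \le C \exp(-c x^2/n).$$
   Context: A $k$-tree is defined recursively: it is either a complete graph on $k$ vertices, or a graph obtained from a smaller $k$-tree by adjoining a new vertex together with $k$ edges connecting it to the vertices of a $k$-clique of the smaller $k$-tree. An unlabelled $k$-tree is a $k$-tree considered up to graph isomorphism. The $(k+1)$-cliques of a $k$-tree are called hedra; a $k$-tree with $n$ hedra has $n+k$ vertices. *)

theory Defs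
  imports "HOL-Probability.Probability_Mass_Function" "Graph_Theory.Graph_Theory"
begin

text \<open>
  A graph is a symmetric loop-free digraph without parallel arcs, given by the set of its
  vertices and the set of its ordered pairs of adjacent vertices.
\<close>

definition clique :: "nat \<Rightarrow> 'a pair_pre_digraph \<Rightarrow> 'a set \<Rightarrow> bool" where
  "clique m G K \<longleftrightarrow> finite K \<and> card K = m \<and> K \<subseteq> pverts G \<and>
     (\<forall>u\<in>K. \<forall>v\<in>K. u \<noteq> v \<longrightarrow> (u, v) \<in> parcs G)"

definition adjoin_vertex :: "'a pair_pre_digraph \<Rightarrow> 'a \<Rightarrow> 'a set \<Rightarrow> 'a pair_pre_digraph" where
  "adjoin_vertex G v K =
     \<lparr> pverts = insert v (pverts G), parcs = parcs G \<union> {v} \<times> K \<union> K \<times> {v} \<rparr>"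

inductive k_tree :: "nat \<Rightarrow> 'a pair_pre_digraph \<Rightarrow> bool" for k :: nat where
  complete: "complete_digraph k (with_proj G) \<Longrightarrow> k_tree k G"
| adjoin: "k_tree k G \<Longrightarrow> clique k G K \<Longrightarrow> v \<notin> pverts G \<Longrightarrow> k_tree k (adjoin_vertex G v K)"

definition hedra :: "nat \<Rightarrow> 'a pair_pre_digraph \<Rightarrow> 'a set set" where
  "hedra k G = {K. clique (k + 1) G K}"

definition graph_distance :: "'a pair_pre_digraph \<Rightarrow> 'a \<Rightarrow> 'a \<Rightarrow> ereal" where
  "graph_distance G u v = wf_digraph.\<mu> (with_proj G) (\<lambda>_. 1) u v"

definition graph_diameter :: "'a pair_pre_digraph \<Rightarrow> ereal" where
  "graph_diameter G = (SUP u\<in>pverts G. SUP v\<in>pverts G. graph_distance G u v)"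

text \<open>
  Every finite graph is isomorphic to one whose vertices are natural numbers, so isomorphism
  classes are formed among these.
\<close>

definition k_trees :: "nat \<Rightarrow> nat \<Rightarrow> nat pair_pre_digraph set" where
  "k_trees k n = {G. k_tree k G \<and> card (hedra k G) = n}"

definition isomorphic_k_trees ::
    "nat \<Rightarrow> nat \<Rightarrow> (nat pair_pre_digraph \<times> nat pair_pre_digraph) set" where
  "isomorphic_k_trees k n =
     {(G, H). G \<in> k_trees k n \<and> H \<in> k_trees k n \<and> digraph_iso (with_proj G) (with_proj H)}"

definition unlabelled_k_trees :: "nat \<Rightarrow> nat \<Rightarrow> nat pair_pre_digraph set set" where
  "unlabelled_k_trees k n = k_trees k n // isomorphic_k_trees k n"

definition random_unlabelled_k_tree :: "nat \<Rightarrow> nat \<Rightarrow> nat pair_pre_digraph set pmf" where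
  "random_unlabelled_k_tree k n = pmf_of_set (unlabelled_k_trees k n)"

text \<open>
  The diameter is constant on an isomorphism class, see \<open>unlabelled_diameter_eq\<close> below.
\<close>

definition unlabelled_diameter :: "nat pair_pre_digraph set \<Rightarrow> ereal" where
  "unlabelled_diameter U = the_elem (graph_diameter ` U)"


text \<open>
  The remaining facts show that these notions are well defined: isomorphism is an equivalence
  relation, the set of unlabelled \<open>k\<close>-trees with \<open>n\<close> hedra is finite and nonempty (so that
  \<^const>\<open>pmf_of_set\<close> is the uniform distribution on it), and isomorphic graphs have the same diameter.
\<close>

lemma clique_adjoin:
  assumes G: "pair_graph G" and v: "v \<notin> pverts G" and K: "clique k G K"
  shows "clique m (adjoin_vertex G v K) L \<longleftrightarrow>
    clique m G L \<or> (\<exists>L'\<subseteq>K. L = insert v L' \<and> m = Suc (card L'))"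
proof -
  interpret pair_graph G by (rule G)
  have fK: "finite K" "K \<subseteq> pverts G" and vK: "v \<notin> K"
    using K v by (auto simp: clique_def)
  show ?thesis
  proof (cases "v \<in> L")
    case True
    then have L: "L = insert v (L - {v})" by auto
    show ?thesis
    proof
      assume *: "clique m (adjoin_vertex G v K) L"
      have sub: "L - {v} \<subseteq> K"
      proof
        fix u assume "u \<in> L - {v}"
        then have "(v, u) \<in> parcs G \<union> {v} \<times> K \<union> K \<times> {v}"
          using * True by (auto simp: clique_def adjoin_vertex_def)
        then show "u \<in> K" using v \<open>u \<in> L - {v}\<close> by (auto dest: in_arcsD1)
      qed
      have "finite L" "card L = m" using * by (simp_all add: clique_def)
      then have "m = Suc (card (L - {v}))"
        using True card_Suc_Diff1[of L v] by simp
      then show "clique m G L \<or> (\<exists>L'\<subseteq>K. L = insert v L' \<and> m = Suc (card L'))"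
        using sub L by (intro disjI2 exI[of _ "L - {v}"] conjI)
    next
      assume "clique m G L \<or> (\<exists>L'\<subseteq>K. L = insert v L' \<and> m = Suc (card L'))"
      moreover have "\<not> clique m G L" using True v by (auto simp: clique_def)
      ultimately obtain L' where L': "L' \<subseteq> K" "L = insert v L'" "m = Suc (card L')" by blast
      have "finite L'" "v \<notin> L'" using L' fK vK finite_subset by auto
      then show "clique m (adjoin_vertex G v K) L"
        using L' K unfolding clique_def adjoin_vertex_def by auto
    qed
  next
    case False
    then have "clique m (adjoin_vertex G v K) L \<longleftrightarrow> clique m G L"
      unfolding clique_def adjoin_vertex_def by auto
    then show ?thesis using False by auto
  qed
qed

lemma pair_graph_adjoin:
  assumes G: "pair_graph G" and v: "v \<notin> pverts G" and K: "clique k G K"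
  shows "pair_graph (adjoin_vertex G v K)"
proof -
  interpret pair_graph G by (rule G)
  have "sym (parcs G)" using pair_sym_arcs by (simp add: symmetric_def)
  then show ?thesis
    using v K pair_finite_verts pair_finite_arcs no_loops'
    by unfold_locales
       (auto simp: adjoin_vertex_def clique_def symmetric_def sym_def dest: in_arcsD1 in_arcsD2)
qed

lemma k_tree_graph: "k_tree k G \<Longrightarrow> pair_graph G"
  by (induction rule: k_tree.induct) (auto intro: pair_graphI_complete pair_graph_adjoin)

lemma finite_hedra:
  assumes "pair_graph G"
  shows "finite (hedra k G)"
proof -
  interpret pair_graph G by fact
  have "hedra k G \<subseteq> Pow (pverts G)" by (auto simp: hedra_def clique_def)
  then show ?thesis using pair_finite_verts by (meson finite_Pow_iff finite_subset)
qed

lemma hedra_adjoin: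
  assumes G: "pair_graph G" and v: "v \<notin> pverts G" and K: "clique k G K"
  shows "hedra k (adjoin_vertex G v K) = insert (insert v K) (hedra k G)"
    and "insert v K \<notin> hedra k G"
proof -
  have "finite K" "card K = k" using K by (auto simp: clique_def)
  then have "(\<exists>L'\<subseteq>K. L = insert v L' \<and> k + 1 = Suc (card L')) \<longleftrightarrow> L = insert v K" for L
    using card_subset_eq[of K] by (metis Suc_eq_plus1 Suc_inject order_refl)
  then have "clique (k + 1) (adjoin_vertex G v K) L \<longleftrightarrow> clique (k + 1) G L \<or> L = insert v K" for L
    unfolding clique_adjoin[OF assms] by simp
  then show "hedra k (adjoin_vertex G v K) = insert (insert v K) (hedra k G)"
    unfolding hedra_def by blast
  show "insert v K \<notin> hedra k G" using v by (auto simp: hedra_def clique_def)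
qed

lemma k_tree_card_verts: "k_tree k G \<Longrightarrow> card (pverts G) = card (hedra k G) + k"
proof (induction rule: k_tree.induct)
  case (complete G)
  then have "finite (pverts G)" "card (pverts G) = k" by (auto simp: complete_digraph_pair_def)
  then have "hedra k G = {}"
    using card_mono[of "pverts G"] by (fastforce simp: hedra_def clique_def)
  then show ?case using \<open>card (pverts G) = k\<close> by simp
next
  case (adjoin G K v)
  interpret pair_graph G using adjoin by (simp add: k_tree_graph)
  have "pair_graph G" by unfold_locales
  then show ?case
    using adjoin.IH adjoin.hyps(3) hedra_adjoin[OF _ adjoin.hyps(3,2)] pair_finite_verts
      finite_hedra[of G k]
    by (simp add: adjoin_vertex_def)
qed

definition relabel :: "('a \<Rightarrow> 'b) \<Rightarrow> 'a pair_pre_digraph \<Rightarrow> 'b pair_pre_digraph" where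
  "relabel f G = \<lparr> pverts = f ` pverts G, parcs = map_prod f f ` parcs G \<rparr>"

lemma clique_relabel:
  assumes "clique m G K" "inj_on f (pverts G)"
  shows "clique m (relabel f G) (f ` K)"
proof -
  have "card (f ` K) = card K"
    using assms by (intro card_image) (auto simp: clique_def intro: inj_on_subset)
  then show ?thesis using assms(1) by (auto simp: clique_def relabel_def intro!: rev_image_eqI)
qed

lemma k_tree_relabel: "k_tree k G \<Longrightarrow> inj_on f (pverts G) \<Longrightarrow> k_tree k (relabel f G)"
proof (induction rule: k_tree.induct)
  case (complete G)
  have "complete_digraph k (with_proj (relabel f G))"
    using complete by (force simp: complete_digraph_pair_def relabel_def card_image inj_on_def)
  then show ?case by (rule k_tree.complete)
next
  case (adjoin G K v)
  have inj: "inj_on f (pverts G)" "f v \<notin> f ` pverts G"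
    using adjoin.prems adjoin.hyps(3) by (auto simp: adjoin_vertex_def)
  have "relabel f (adjoin_vertex G v K) = adjoin_vertex (relabel f G) (f v) (f ` K)"
    by (auto simp: relabel_def adjoin_vertex_def)
  moreover have "k_tree k (adjoin_vertex (relabel f G) (f v) (f ` K))"
    using adjoin.IH inj adjoin.hyps(2)
    by (intro k_tree.adjoin clique_relabel) (auto simp: relabel_def)
  ultimately show ?case by simp
qed

lemma digraph_iso_relabel:
  assumes "pair_graph G" "inj_on f (pverts G)"
  shows "digraph_iso (with_proj G) (with_proj (relabel f G))"
proof -
  interpret pair_graph G by fact
  have "inj_on (map_prod f f) (parcs G)"
    using map_prod_inj_on[OF assms(2,2)] by (rule inj_on_subset) (auto dest: in_arcsD1 in_arcsD2)
  then have "pre_digraph.digraph_isomorphism (with_proj G)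
      \<lparr> iso_verts = f, iso_arcs = map_prod f f, iso_head = snd, iso_tail = fst \<rparr>"
    using assms(2) wf_digraph by (auto simp: pre_digraph.digraph_isomorphism_def)
  moreover have "with_proj (relabel f G) = app_iso
      \<lparr> iso_verts = f, iso_arcs = map_prod f f, iso_head = snd, iso_tail = fst \<rparr> (with_proj G)"
    by (simp add: app_iso_def with_proj_def relabel_def)
  ultimately show ?thesis unfolding digraph_iso_def by blast
qed

lemma equiv_isomorphic_k_trees: "equiv (k_trees k n) (isomorphic_k_trees k n)"
proof (rule equivI)
  show "isomorphic_k_trees k n \<subseteq> k_trees k n \<times> k_trees k n"
    by (auto simp: isomorphic_k_trees_def)
  have wf: "wf_digraph (with_proj G)" if "G \<in> k_trees k n" for G
  proof -
    interpret pair_graph G using that by (auto simp: k_trees_def intro: k_tree_graph)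
    show ?thesis by (rule wf_digraph)
  qed
  show "refl_on (k_trees k n) (isomorphic_k_trees k n)"
  proof (rule refl_onI)
    fix G assume G: "G \<in> k_trees k n"
    have "relabel id G = G" by (simp add: relabel_def prod.map_id0)
    moreover have "pair_graph G" using G by (auto simp: k_trees_def intro: k_tree_graph)
    ultimately have "digraph_iso (with_proj G) (with_proj G)"
      using digraph_iso_relabel[of G id] by simp
    then show "(G, G) \<in> isomorphic_k_trees k n" using G by (simp add: isomorphic_k_trees_def)
  qed
  show "sym (isomorphic_k_trees k n)"
    using wf by (auto simp: sym_def isomorphic_k_trees_def intro: digraph_iso_swap)
  show "trans (isomorphic_k_trees k n)"
    by (auto simp: trans_def isomorphic_k_trees_def intro: digraph_iso_trans)
qed

lemma finite_unlabelled_k_trees: "finite (unlabelled_k_trees k n)"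
proof -
  define V where "V = {..<n + k}"
  define B where "B = {G \<in> k_trees k n. pverts G = V}"
  have "B \<subseteq> (\<lambda>E. \<lparr> pverts = V, parcs = E \<rparr>) ` Pow (V \<times> V)"
  proof
    fix G assume "G \<in> B"
    then interpret pair_graph G by (auto simp: B_def k_trees_def intro: k_tree_graph)
    have "parcs G \<subseteq> V \<times> V"
      using \<open>G \<in> B\<close> by (auto simp: B_def dest: in_arcsD1 in_arcsD2)
    moreover have "G = \<lparr> pverts = V, parcs = parcs G \<rparr>" using \<open>G \<in> B\<close> by (simp add: B_def)
    ultimately show "G \<in> (\<lambda>E. \<lparr> pverts = V, parcs = E \<rparr>) ` Pow (V \<times> V)" by blast
  qed
  then have "finite B" by (rule finite_subset) (simp add: V_def)
  moreover have "unlabelled_k_trees k n \<subseteq> (\<lambda>G. isomorphic_k_trees k n `` {G}) ` B"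
  proof
    fix U assume "U \<in> unlabelled_k_trees k n"
    then obtain G where G: "G \<in> k_trees k n" "U = isomorphic_k_trees k n `` {G}"
      by (auto simp: unlabelled_k_trees_def elim: quotientE)
    have kt: "k_tree k G" using G by (simp add: k_trees_def)
    then have gr: "pair_graph G" by (rule k_tree_graph)
    have "card (pverts G) = card V" "finite (pverts G)" "finite V"
      using G kt k_tree_card_verts[OF kt] pair_fin_digraph.pair_finite_verts[of G] gr
      by (auto simp: V_def k_trees_def pair_graph_def pair_digraph_def)
    then obtain f where f: "bij_betw f (pverts G) V"
      using finite_same_card_bij by blast
    then have inj: "inj_on f (pverts G)" and im: "f ` pverts G = V" by (auto simp: bij_betw_def)
    have kt': "k_tree k (relabel f G)" by (rule k_tree_relabel[OF kt inj])
    have verts: "pverts (relabel f G) = V" by (simp add: relabel_def im)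
    have "relabel f G \<in> B"
      using kt' verts k_tree_card_verts[OF kt'] by (simp add: B_def k_trees_def V_def)
    moreover from this have "(G, relabel f G) \<in> isomorphic_k_trees k n"
      using G digraph_iso_relabel[OF gr inj] by (auto simp: isomorphic_k_trees_def B_def)
    then have "U = isomorphic_k_trees k n `` {relabel f G}"
      using G equiv_class_eq[OF equiv_isomorphic_k_trees] by blast
    ultimately show "U \<in> (\<lambda>G. isomorphic_k_trees k n `` {G}) ` B" by blast
  qed
  ultimately show ?thesis by (meson finite_imageI finite_subset)
qed

lemma unlabelled_k_trees_nonempty: "unlabelled_k_trees k n \<noteq> {}"
proof -
  have "\<exists>G :: nat pair_pre_digraph. k_tree k G \<and> card (hedra k G) = n \<and> (\<exists>K. clique k G K)"
  proof (induction n)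
    case 0
    define G where "G = \<lparr> pverts = {..<k}, parcs = {(u, v). u < k \<and> v < k \<and> u \<noteq> v} \<rparr>"
    have "complete_digraph k (with_proj G)" by (auto simp: complete_digraph_pair_def G_def)
    then have "k_tree k G" by (rule k_tree.complete)
    moreover have "clique k G {..<k}" by (auto simp: clique_def G_def)
    moreover have "card (hedra k G) = 0"
      using k_tree_card_verts[OF \<open>k_tree k G\<close>] by (simp add: G_def)
    ultimately show ?case by blast
  next
    case (Suc n)
    then obtain G :: "nat pair_pre_digraph" and K
      where G: "k_tree k G" "card (hedra k G) = n" "clique k G K" by blast
    have gr: "pair_graph G" using G(1) by (rule k_tree_graph)
    then have "finite (pverts G)"
      by (auto simp: pair_graph_def pair_digraph_def pair_fin_digraph.pair_finite_verts)
    then obtain v where v: "v \<notin> pverts G" using ex_new_if_finite infinite_UNIV_nat by blast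
    have "card (hedra k (adjoin_vertex G v K)) = Suc n"
      using hedra_adjoin[OF gr v G(3)] finite_hedra[OF gr, of k] G(2) by simp
    moreover have "clique k (adjoin_vertex G v K) K"
      using G(3) clique_adjoin[OF gr v G(3)] by blast
    ultimately show ?case using k_tree.adjoin[OF G(1,3) v] by blast
  qed
  then show ?thesis by (auto simp: unlabelled_k_trees_def k_trees_def quotient_def)
qed

lemma graph_diameter_mono_iso:
  assumes G: "pair_graph G" and iso: "digraph_iso (with_proj G) (with_proj H)"
  shows "graph_diameter H \<le> graph_diameter G"
proof -
  interpret pair_graph G by (rule G)
  obtain h where h: "digraph_isomorphism h" "with_proj H = app_iso h (with_proj G)"
    using iso by (auto simp: digraph_iso_def)
  interpret H: wf_digraph "with_proj H"
    using wf_digraphI_app_iso[OF h(1)] h(2) by simp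
  have verts: "pverts H = iso_verts h ` pverts G"
    using arg_cong[OF h(2), of verts] by simp
  have cost: "H.awalk_cost (\<lambda>_. 1) p = real (length p)"
    for p by (induction p) auto
  have cost': "awalk_cost (\<lambda>_. 1) p = real (length p)" for p
    by (induction p) auto
  have "graph_distance H (iso_verts h u) (iso_verts h v) \<le> graph_distance G u v" for u v
    unfolding graph_distance_def H.\<mu>_def \<mu>_def
  proof (rule INF_mono)
    fix p assume "p \<in> {p. awalk u p v}"
    then have "H.awalk (iso_verts h u) (map (iso_arcs h) p) (iso_verts h v)"
      using awalk_app_isoI[OF _ h(1)] h(2) by simp
    then show "\<exists>q\<in>{q. H.awalk (iso_verts h u) q (iso_verts h v)}.
        ereal (H.awalk_cost (\<lambda>_. 1) q) \<le> ereal (awalk_cost (\<lambda>_. 1) p)"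
      by (intro bexI[of _ "map (iso_arcs h) p"]) (auto simp: cost cost')
  qed
  then show ?thesis
    unfolding graph_diameter_def verts image_image by (auto intro!: SUP_subset_mono)
qed

lemma unlabelled_diameter_eq:
  assumes U: "U \<in> unlabelled_k_trees k n" and G: "G \<in> U"
  shows "unlabelled_diameter U = graph_diameter G"
proof -
  have "graph_diameter H \<le> graph_diameter H'" if "H \<in> U" "H' \<in> U" for H H'
  proof -
    have "(H', H) \<in> isomorphic_k_trees k n"
      using quotient_eq_iff[OF equiv_isomorphic_k_trees] U that
      by (fastforce simp: unlabelled_k_trees_def)
    then show ?thesis
      by (intro graph_diameter_mono_iso) (auto simp: isomorphic_k_trees_def k_trees_def intro: k_tree_graph)
  qed
  then have "graph_diameter ` U = {graph_diameter G}" using G by (auto intro: antisym)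
  then show ?thesis by (simp add: unlabelled_diameter_def)
qed

end

theory Submission
  imports Defs "HOL-Analysis.Analysis" "HOL-Computational_Algebra.Computational_Algebra" "HOL-Library.Multiset"
begin

text \<open>
  A \<open>k\<close>-tree with at least one hedron has \<open>(k + 1)!\<close> proper colourings with \<open>k + 1\<close> colours, so up to
  a constant factor one may count coloured \<open>k\<close>-trees. Rooted at a hedron, such an object is a rooted
  tree of hedra in which the children of a node form a multiset and never repeat the colour of their
  parent. The generating function of these trees satisfies \<open>H = z E(z) exp (k H)\<close>, where \<open>E\<close> is analytic
  beyond the radius of convergence \<open>\<rho>\<close> of \<open>H\<close>. By Lagrange inversion the coefficients of
  \<open>(k H)\<^sup>i\<close> are explicit weights mixed by a renewal process of finite mean. This shows that the number
  of trees is of order \<open>n powr (-3/2) * \<rho> powr (-n)\<close> and bounds the convolution powers by Gaussian terms,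
  without any singularity analysis.

  A tree of height \<open>H + 1\<close> has a branch of height \<open>H\<close>. Iterating this, and averaging over the number of
  iterations, bounds the number of trees with \<open>n\<close> nodes and height exactly \<open>H\<close> by a multiple of
  \<open>exp (- c H\<^sup>2 / n) / H ^ 4 * \<rho> powr (-n)\<close>. If an unlabelled \<open>k\<close>-tree is rooted at a hedron for which the
  height \<open>H\<close> is minimal, then the root has one branch of height \<open>H - 1\<close> and another one of height
  \<open>H - 1\<close> or \<open>H - 2\<close>, and the diameter is at most \<open>2 H + 1\<close>. Summing over the two branches leaves
  \<open>O(n powr (-5/2) * \<rho> powr (-n) * exp (- c x\<^sup>2 / n))\<close> unlabelled \<open>k\<close>-trees of diameter at least \<open>x\<close>. Since a
  \<open>k\<close>-tree with \<open>n\<close> hedra gives rise to \<open>O(n)\<close> rooted trees only, there are at least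
  \<open>c n powr (-5/2) * \<rho> powr (-n)\<close> unlabelled \<open>k\<close>-trees in total.
\<close>

unbundle no vec_syntax

section \<open>Lagrange inversion for the tree function\<close>

text \<open>The obstacle is a factor \<open>n\<close>. Rooting at a hedron multiplies the number of
  k-trees by \<open>n\<close> at most, so the total is only known to be at least of order
  \<open>n powr (-5/2)\<close> in units of \<open>\<rho> powr (-n)\<close>, whereas tall trees with
  an arbitrary root are of order \<open>n powr (-3/2)\<close>. Bounding the former by the latter
  would lose \<open>n\<close> in the probability. Choosing a single root of least height wins it
  back: two branches must then have nearly the full height, and prescribing the exact height of a
  branch costs \<open>1 / H ^ 4\<close>. Colours break the symmetry inside a hedron. One colour
  tells which vertex a child hedron replaces, so the branches form a plain multiset, and repeated
  branches enter only through a factor that is analytic at \<open>\<rho>\<close>. All estimates are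
  one-sided and up to constants. This suffices because numerator and denominator of the probability
  carry the same \<open>\<rho>\<close>, and because values of \<open>x\<close> with
  \<open>x\<^sup>2\<close> below a multiple of \<open>n\<close> are absorbed by the choice of
  \<open>C\<close>.\<close>

lemma alternating_binomial_power_sum:
  fixes a :: real
  assumes "d < N"
  shows "(\<Sum>l\<le>N. (-1) ^ l * real (N choose l) * (a + real l) ^ d) = 0"
proof -
  \<comment> \<open>The sum is \<open>fact d\<close> times the coefficient of \<open>X ^ d\<close>
    in \<open>(1 - exp X) ^ N * exp (a X)\<close>. As \<open>1 - exp X\<close> is divisible by
    \<open>X\<close>, this series starts at degree \<open>N > d\<close>.\<close>
  define q where "q = fps_shift 1 (1 - fps_exp (1::real))"
  have q: "1 - fps_exp (1::real) = fps_X * q"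
    by (rule fps_ext) (simp add: q_def)
  have "((1 - fps_exp 1) ^ N * fps_exp a) $ d = (fps_X ^ N * (q ^ N * fps_exp a)) $ d"
    by (simp add: q power_mult_distrib mult.assoc)
  also have "\<dots> = 0" using assms by (simp only: fps_X_power_mult_nth) simp
  finally have *: "((1 - fps_exp 1) ^ N * fps_exp a) $ d = 0" .
  have "(1 - fps_exp (1::real)) ^ N = (- fps_exp 1 + 1) ^ N" by simp
  also have "\<dots> = (\<Sum>l\<le>N. of_nat (N choose l) * (- fps_exp 1) ^ l * 1 ^ (N - l))"
    by (rule binomial_ring)
  also have "\<dots> = (\<Sum>l\<le>N. fps_const ((-1) ^ l * real (N choose l)) * fps_exp (real l))"
  proof (rule sum.cong)
    fix l
    have "(- fps_exp (1::real)) ^ l = fps_const ((-1) ^ l) * fps_exp (real l)"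
      by (subst power_minus) (simp add: fps_exp_power_mult fps_const_power [symmetric] fps_const_neg [symmetric]
          del: fps_const_neg fps_const_power)
    then show "of_nat (N choose l) * (- fps_exp 1) ^ l * 1 ^ (N - l)
        = fps_const ((-1) ^ l * real (N choose l)) * fps_exp (real l)"
      by (simp add: fps_of_nat [symmetric] mult.commute mult.left_commute flip: fps_const_mult)
  qed simp
  finally have "(1 - fps_exp (1::real)) ^ N * fps_exp a
      = (\<Sum>l\<le>N. fps_const ((-1) ^ l * real (N choose l)) * fps_exp (real l + a))"
    by (simp add: sum_distrib_right mult.assoc fps_exp_add_mult)
  then have "0 = (\<Sum>l\<le>N. fps_const ((-1) ^ l * real (N choose l)) * fps_exp (real l + a)) $ d"
    using * by simp
  also have "\<dots> = (\<Sum>l\<le>N. (-1) ^ l * real (N choose l) * (a + real l) ^ d) / fact d"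
    by (simp add: fps_sum_nth sum_divide_distrib add.commute)
  finally show ?thesis by simp
qed

text \<open>
  The coefficients of the powers \<open>W\<^sup>i\<close> of the tree function \<open>W = X exp W\<close>, as given by Lagrange inversion.
\<close>

definition tree_power :: "nat \<Rightarrow> real fps" where
  "tree_power i = Abs_fps (\<lambda>m. if m < i then 0 else real i / real m * real m ^ (m - i) / fact (m - i))"

text \<open>The compositional inverse of the tree function is \<open>X exp (-X)\<close>. Lagrange
  inversion is verified by substituting this inverse into the claimed coefficients.\<close>

lemma tree_power_compose:
  assumes i: "i \<ge> 1"
  shows "tree_power i oo (fps_X * fps_exp (-1)) = fps_X ^ i"
proof (rule fps_ext)
  fix n
  have pow: "((fps_X * fps_exp (-1)) ^ m) $ n = (if n < m then 0 else (- real m) ^ (n - m) / fact (n - m))"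
    for m
    by (simp add: power_mult_distrib fps_exp_power_mult fps_X_power_mult_nth)
  have "(tree_power i oo (fps_X * fps_exp (-1))) $ n
      = (\<Sum>m=0..n. (if m < i then 0 else real i / real m * real m ^ (m - i) / fact (m - i))
            * (if n < m then 0 else (- real m) ^ (n - m) / fact (n - m)))"
    unfolding fps_compose_nth pow by (simp add: tree_power_def)
  also have "\<dots> = (fps_X ^ i) $ n"
  proof (cases "n < i")
    case True
    then show ?thesis by (simp add: fps_X_power_nth)
  next
    case False
    then have le: "i \<le> n" by simp
    show ?thesis
    proof (cases "n = i")
      case True
      have "(\<Sum>m=0..n. (if m < i then 0 else real i / real m * real m ^ (m - i) / fact (m - i))
            * (if n < m then 0 else (- real m) ^ (n - m) / fact (n - m)))
          = (\<Sum>m\<in>{i}. (if m < i then 0 else real i / real m * real m ^ (m - i) / fact (m - i))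
            * (if n < m then 0 else (- real m) ^ (n - m) / fact (n - m)))"
        using True by (intro sum.mono_neutral_right) auto
      then show ?thesis using True i by simp
    next
      case False
      with le have lt: "i < n" by simp
      define N where "N = n - i"
      have n: "n = i + N" and N: "N \<ge> 1" using lt by (auto simp: N_def)
      have "(\<Sum>m=0..n. (if m < i then 0 else real i / real m * real m ^ (m - i) / fact (m - i))
            * (if n < m then 0 else (- real m) ^ (n - m) / fact (n - m)))
          = (\<Sum>m=i..n. real i / real m * real m ^ (m - i) / fact (m - i)
              * ((- real m) ^ (n - m) / fact (n - m)))"
        by (rule sum.mono_neutral_cong_right) auto
      also have "\<dots> = (\<Sum>l\<le>N. real i / real (i+l) * real (i+l) ^ l / fact l
              * ((- real (i+l)) ^ (N - l) / fact (N - l)))"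
        by (rule sum.reindex_bij_witness[of _ "\<lambda>l. i + l" "\<lambda>m. m - i"]) (auto simp: n add.commute)
      \<comment> \<open>All powers of \<open>i + l\<close> merge. The division by
        \<open>i + l\<close> lowers the exponent to \<open>N - 1\<close>, just below the threshold
        at which the alternating sum vanishes.\<close>
      also have "\<dots> = (\<Sum>l\<le>N. real i * (-1) ^ N / fact N *
           ((-1) ^ l * real (N choose l) * (real i + real l) ^ (N - 1)))"
      proof (rule sum.cong)
        fix l assume l: "l \<in> {..N}"
        define x where "x = real (i + l)"
        have x: "x > 0" using i by (simp add: x_def)
        have "x ^ l * x ^ (N - l) = x * x ^ (N - 1)"
          using l N by (metis add.commute atMost_iff le_add_diff_inverse2 power_add power_eq_if not_one_le_zero)
        moreover have "(-1::real) ^ (N - l) = (-1) ^ N * (-1) ^ l"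
          using l by (simp add: minus_one_power_iff)
        moreover have "real (N choose l) = fact N / (fact l * fact (N - l))"
          using l by (simp add: binomial_fact)
        moreover have "(- x) ^ (N - l) = (-1) ^ (N - l) * x ^ (N - l)" by (rule power_minus)
        ultimately show "real i / real (i+l) * real (i+l) ^ l / fact l
              * ((- real (i+l)) ^ (N - l) / fact (N - l))
            = real i * (-1) ^ N / fact N * ((-1) ^ l * real (N choose l) * (real i + real l) ^ (N - 1))"
          unfolding x_def[symmetric] of_nat_add[symmetric] using x
          by (simp add: field_simps)
      qed simp
      also have "\<dots> = 0"
        using alternating_binomial_power_sum[of "N - 1" N "real i"] N
        unfolding sum_distrib_left [symmetric] by simp
      finally show ?thesis using False by (simp add: fps_X_power_nth)
    qed
  qed
  finally show "(tree_power i oo (fps_X * fps_exp (-1))) $ n = (fps_X ^ i) $ n" .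
qed

lemma fps_exp_compose_inverse:
  fixes F :: "real fps"
  assumes "F $ 0 = 0"
  shows "(fps_exp 1 oo F) * (fps_exp (-1) oo F) = 1"
proof -
  have "(fps_exp 1 oo F) * (fps_exp (-1) oo F) = (fps_exp 1 * fps_exp (-1)) oo F"
    using assms by (simp add: fps_compose_mult_distrib)
  also have "fps_exp 1 * fps_exp (-1) = (1 :: real fps)"
    by (simp flip: fps_exp_add_mult)
  finally show ?thesis by simp
qed

lemma power_eq_tree_power_compose:
  fixes h :: "real fps"
  assumes h: "h $ 0 = 0" and i: "i \<ge> 1"
  shows "h ^ i = tree_power i oo (h * (fps_exp (-1) oo h))"
proof -
  have "h * (fps_exp (-1) oo h) = (fps_X * fps_exp (-1)) oo h"
    using h by (simp add: fps_compose_mult_distrib)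
  then have "tree_power i oo (h * (fps_exp (-1) oo h)) = (tree_power i oo (fps_X * fps_exp (-1))) oo h"
    using h by (simp add: fps_compose_assoc)
  also have "\<dots> = fps_X ^ i oo h" using tree_power_compose[OF i] by simp
  also have "\<dots> = h ^ i" using h by (simp flip: fps_compose_power)
  finally show ?thesis by simp
qed

text \<open>The hypothesis \<open>ode\<close> is the logarithmic derivative of the conclusion. To
  integrate it, \<open>Q = h exp (-h) exp (-F)\<close> is shown to satisfy \<open>X Q' = Q\<close>,
  so that only its coefficient at \<open>X\<close> survives. In this way a recurrence for the
  coefficients of \<open>h\<close> is enough as input.\<close>

lemma functional_equation_from_ode:
  fixes h F :: "real fps"
  assumes h0: "h $ 0 = 0" and F0: "F $ 0 = 0"
    and ode: "fps_X * fps_deriv h - h = h * (fps_X * fps_deriv h + fps_X * fps_deriv F)"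
  shows "h * (fps_exp (-1) oo h) = fps_const (h $ 1) * fps_X * (fps_exp 1 oo F)"
proof -
  define A where "A = (fps_exp (-1) oo h)"
  define B where "B = (fps_exp (-1) oo F)"
  define Q where "Q = h * A * B"
  have dA: "fps_deriv A = - (A * fps_deriv h)"
    unfolding A_def by (subst fps_compose_deriv[OF h0])
      (simp add: fps_compose_mult_distrib[OF h0] fps_const_neg [symmetric] fps_compose_uminus del: fps_const_neg)
  have dB: "fps_deriv B = - (B * fps_deriv F)"
    unfolding B_def by (subst fps_compose_deriv[OF F0])
      (simp add: fps_compose_mult_distrib[OF F0] fps_const_neg [symmetric] fps_compose_uminus del: fps_const_neg)
  have "fps_X * fps_deriv Q = A * B * (fps_X * fps_deriv h - h * (fps_X * fps_deriv h + fps_X * fps_deriv F))"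
    unfolding Q_def by (simp add: dA dB algebra_simps)
  also have "fps_X * fps_deriv h - h * (fps_X * fps_deriv h + fps_X * fps_deriv F) = h"
    unfolding ode [symmetric] by simp
  finally have Q: "fps_X * fps_deriv Q = Q" by (simp add: Q_def mult_ac)
  have Qn: "Q $ n = 0" if "n \<noteq> 1" for n
  proof (cases n)
    case 0
    then show ?thesis using h0 by (simp add: Q_def)
  next
    case (Suc m)
    have "(fps_X * fps_deriv Q) $ n = real n * Q $ n"
      using Suc by simp
    then have "(real n - 1) * Q $ n = 0" using Q by (simp add: algebra_simps)
    then show ?thesis using that by simp
  qed
  have "Q $ 1 = h $ 1"
    using h0 F0 by (simp add: Q_def A_def B_def fps_mult_nth_1)
  then have Q2: "Q = fps_const (h $ 1) * fps_X"
  proof (intro fps_ext)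
    fix n
    show "Q $ n = (fps_const (h $ 1) * fps_X) $ n"
      using Qn[of n] \<open>Q $ 1 = h $ 1\<close> by (cases "n = 1") auto
  qed
  have "h * A = Q * (fps_exp 1 oo F)"
    using fps_exp_compose_inverse[OF F0] by (simp add: Q_def B_def mult_ac)
  then show ?thesis using Q2 by (simp add: A_def)
qed

section \<open>Stirling bounds and nonnegative power series\<close>

lemma ln_le_half_diff_inverse:
  fixes t :: real
  assumes "t \<ge> 1"
  shows "ln t \<le> (t - 1 / t) / 2"
proof -
  have "(\<lambda>t. (t - 1 / t) / 2 - ln t) 1 \<le> (\<lambda>t. (t - 1 / t) / 2 - ln t) t"
  proof (rule DERIV_nonneg_imp_nondecreasing[OF assms])
    fix x :: real assume x: "1 \<le> x" "x \<le> t"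
    have "((\<lambda>t. (t - 1 / t) / 2 - ln t) has_real_derivative (1 - 1 / x)^2 / 2) (at x)"
      by (rule DERIV_cong, (rule derivative_intros | use x in force)+)
        (use x in \<open>simp add: power2_eq_square divide_simps, simp add: algebra_simps\<close>)
    then show "\<exists>y. ((\<lambda>t. (t - 1 / t) / 2 - ln t) has_real_derivative y) (at x) \<and> 0 \<le> y"
      by (intro exI[of _ "(1 - 1 / x)^2 / 2"]) auto
  qed
  then show ?thesis by simp
qed

lemma ln_ge_pade:
  fixes t :: real
  assumes "t \<ge> 1"
  shows "2 * (t - 1) / (t + 1) \<le> ln t"
proof -
  have "(\<lambda>t. ln t - 2 * (t - 1) / (t + 1)) 1 \<le> (\<lambda>t. ln t - 2 * (t - 1) / (t + 1)) t"
  proof (rule DERIV_nonneg_imp_nondecreasing[OF assms])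
    fix x :: real assume x: "1 \<le> x" "x \<le> t"
    have "((\<lambda>t. ln t - 2 * (t - 1) / (t + 1)) has_real_derivative (x - 1)^2 / (x * (x + 1)^2)) (at x)"
      by (rule DERIV_cong, (rule derivative_intros | use x in force)+)
        (use x in \<open>simp add: power2_eq_square divide_simps, simp add: algebra_simps\<close>)
    then show "\<exists>y. ((\<lambda>t. ln t - 2 * (t - 1) / (t + 1)) has_real_derivative y) (at x) \<and> 0 \<le> y"
      using x by (intro exI[of _ "(x - 1)^2 / (x * (x + 1)^2)"]) auto
  qed
  then show ?thesis by simp
qed

text \<open>These are the increments of the Stirling approximation. Their excess over 1 is a
  telescoping difference, so it can be summed exactly.\<close>

lemma ln_Suc_quotient:
  fixes m :: nat
  assumes "m \<ge> 1"
  shows "1 \<le> (real m + 1/2) * ln ((real m + 1) / real m)"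
    and "(real m + 1/2) * ln ((real m + 1) / real m) \<le> 1 + 1 / (4 * real m) - 1 / (4 * (real m + 1))"
proof -
  define x where "x = real m"
  have x: "x \<ge> 1" using assms by (simp add: x_def)
  have "2 * ((x + 1) / x - 1) / ((x + 1) / x + 1) = 1 / (x + 1/2)"
    using x by (simp add: divide_simps)
  then have "1 / (x + 1/2) \<le> ln ((x + 1) / x)"
    using ln_ge_pade[of "(x + 1) / x"] x by simp
  then have "(x + 1/2) * (1 / (x + 1/2)) \<le> (x + 1/2) * ln ((x + 1) / x)"
    using x by (intro mult_left_mono) auto
  then show "1 \<le> (real m + 1/2) * ln ((real m + 1) / real m)"
    using x by (simp add: x_def)
  have "ln ((x + 1) / x) \<le> ((x + 1) / x - 1 / ((x + 1) / x)) / 2"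
    using x by (intro ln_le_half_diff_inverse) auto
  then have "(x + 1/2) * ln ((x + 1) / x) \<le> (x + 1/2) * (((x + 1) / x - 1 / ((x + 1) / x)) / 2)"
    using x by (intro mult_left_mono) auto
  also have "\<dots> = 1 + 1 / (4 * x) - 1 / (4 * (x + 1))"
    using x by (simp add: divide_simps) (simp add: algebra_simps)
  finally show "(real m + 1/2) * ln ((real m + 1) / real m) \<le> 1 + 1 / (4 * real m) - 1 / (4 * (real m + 1))"
    by (simp add: x_def)
qed

text \<open>Both bounds are equalities at \<open>m = 1\<close>. The summand
  \<open>1 / (4 * real m)\<close> in the second one absorbs the telescoping error of
  \<open>ln_Suc_quotient\<close> and makes the induction close.\<close>

lemma ln_fact_bounds:
  assumes "m \<ge> (1::nat)"
  shows "ln (fact m) \<le> 1 + (real m + 1/2) * ln (real m) - real m"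
    and "3/4 + 1 / (4 * real m) + (real m + 1/2) * ln (real m) - real m \<le> ln (fact m)"
proof -
  have "ln (fact m) \<le> 1 + (real m + 1/2) * ln (real m) - real m
    \<and> 3/4 + 1 / (4 * real m) + (real m + 1/2) * ln (real m) - real m \<le> ln (fact m)"
    using assms
  proof (induction m rule: dec_induct)
    case base
    then show ?case by simp
  next
    case (step m)
    have m: "m \<ge> 1" using step by simp
    have *: "ln (fact (Suc m)) = ln (real m + 1) + ln (fact m)"
      by (simp add: ln_mult add.commute)
    have **: "ln ((real m + 1) / real m) = ln (real m + 1) - ln (real m)"
      using m by (simp add: ln_divide_pos)
    have "(real (Suc m) + 1/2) * ln (real (Suc m)) = ln (real m + 1) + (real m + 1/2) * ln (real m)
       + (real m + 1/2) * ln ((real m + 1) / real m)"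
      unfolding ** by (simp add: algebra_simps)
    then show ?case using ln_Suc_quotient[OF m] step.IH * by (simp add: add.commute)
  qed
  then show "ln (fact m) \<le> 1 + (real m + 1/2) * ln (real m) - real m"
    and "3/4 + 1 / (4 * real m) + (real m + 1/2) * ln (real m) - real m \<le> ln (fact m)" by auto
qed

lemma stirling_bounds:
  assumes m: "m \<ge> (1::nat)"
  shows "real m ^ m * exp (- real m) / fact m \<le> 1 / sqrt (real m)"
    and "exp (-1) / sqrt (real m) \<le> real m ^ m * exp (- real m) / fact m"
proof -
  define r where "r = real m ^ m * exp (- real m) / fact m"
  have r: "r > 0" using m by (simp add: r_def)
  have "ln r = real m * ln (real m) - real m - ln (fact m)"
    using m by (simp add: r_def ln_divide_pos ln_mult ln_realpow)
  moreover have "ln (1 / sqrt (real m)) = - ln (real m) / 2" "ln (exp (-1) / sqrt (real m)) = -1 - ln (real m) / 2"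
    using m by (simp_all add: ln_divide_pos ln_sqrt)
  moreover have "1 / (4 * real m) \<ge> 0" by simp
  moreover have "(real m + 1/2) * ln (real m) = real m * ln (real m) + ln (real m) / 2"
    by (simp add: algebra_simps)
  ultimately have "ln r \<le> ln (1 / sqrt (real m))" "ln (exp (-1) / sqrt (real m)) \<le> ln r"
    using ln_fact_bounds[OF m] by linarith+
  then show "real m ^ m * exp (- real m) / fact m \<le> 1 / sqrt (real m)"
    and "exp (-1) / sqrt (real m) \<le> real m ^ m * exp (- real m) / fact m"
    using r m unfolding r_def by (subst (asm) ln_le_cancel_iff; simp)+
qed


text \<open>
  Evaluating series with nonnegative coefficients in the extended nonnegative reals makes products and
  compositions unconditional.
\<close>

definition fps_value :: "real fps \<Rightarrow> real \<Rightarrow> ennreal" where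
  "fps_value a x = (\<Sum>n. ennreal (a $ n * x ^ n))"

text \<open>Tonelli for the counting measure on the natural numbers.\<close>

lemma suminf_swap_ennreal:
  fixes f :: "nat \<Rightarrow> nat \<Rightarrow> ennreal"
  shows "(\<Sum>i. \<Sum>j. f i j) = (\<Sum>j. \<Sum>i. f i j)"
proof -
  have "(\<integral>\<^sup>+ i. (\<Sum>j. f i j) \<partial>count_space UNIV) = (\<Sum>j. \<integral>\<^sup>+ i. f i j \<partial>count_space UNIV)"
    by (rule nn_integral_suminf) simp
  then show ?thesis by (simp add: nn_integral_count_space_nat)
qed

lemma suminf_cauchy_product_ennreal:
  fixes f g :: "nat \<Rightarrow> ennreal"
  shows "(\<Sum>n. \<Sum>i\<le>n. f i * g (n - i)) = (\<Sum>n. f n) * (\<Sum>n. g n)"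
proof -
  have "(\<Sum>n. \<Sum>i\<le>n. f i * g (n - i)) = (\<Sum>n. \<Sum>i. if i \<le> n then f i * g (n - i) else 0)"
  proof (rule suminf_cong)
    fix n
    have "(\<Sum>i. if i \<le> n then f i * g (n - i) else 0) = (\<Sum>i\<le>n. if i \<le> n then f i * g (n - i) else 0)"
      by (rule suminf_finite) auto
    then show "(\<Sum>i\<le>n. f i * g (n - i)) = (\<Sum>i. if i \<le> n then f i * g (n - i) else 0)" by simp
  qed
  also have "\<dots> = (\<Sum>i. \<Sum>n. if i \<le> n then f i * g (n - i) else 0)"
    by (rule suminf_swap_ennreal)
  also have "\<dots> = (\<Sum>i. f i * (\<Sum>n. g n))"
  proof (rule suminf_cong)
    fix i
    have "(\<Sum>n. if i \<le> n then f i * g (n - i) else 0)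
        = (\<Sum>n. if i \<le> n + i then f i * g (n + i - i) else 0) + (\<Sum>n<i. if i \<le> n then f i * g (n - i) else 0)"
      by (rule suminf_offset) simp
    then show "(\<Sum>n. if i \<le> n then f i * g (n - i) else 0) = f i * (\<Sum>n. g n)"
      by (simp add: ennreal_suminf_cmult)
  qed
  finally show ?thesis by (simp add: ennreal_suminf_multc)
qed

lemma fps_value_mult:
  assumes "\<And>n. a $ n \<ge> 0" "\<And>n. b $ n \<ge> 0" "x \<ge> 0"
  shows "fps_value (a * b) x = fps_value a x * fps_value b x"
proof -
  have "ennreal ((a * b) $ n * x ^ n) = (\<Sum>i\<le>n. ennreal (a $ i * x ^ i) * ennreal (b $ (n - i) * x ^ (n - i)))" for n
  proof -
    have "(a * b) $ n * x ^ n = (\<Sum>i\<le>n. (a $ i * x ^ i) * (b $ (n - i) * x ^ (n - i)))"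
      unfolding fps_mult_nth sum_distrib_right atLeast0AtMost
    proof (rule sum.cong)
      fix i assume "i \<in> {..n}"
      then have "x ^ n = x ^ i * x ^ (n - i)" by (simp flip: power_add)
      then show "a $ i * b $ (n - i) * x ^ n = a $ i * x ^ i * (b $ (n - i) * x ^ (n - i))" by simp
    qed simp
    then show ?thesis using assms by (simp add: ennreal_mult flip: sum_ennreal)
  qed
  then show ?thesis
    using suminf_cauchy_product_ennreal[of "\<lambda>n. ennreal (a $ n * x ^ n)" "\<lambda>n. ennreal (b $ n * x ^ n)"]
    unfolding fps_value_def by simp
qed

lemma fps_power_nonneg:
  fixes a :: "real fps"
  assumes "\<And>n. a $ n \<ge> 0"
  shows "(a ^ i) $ n \<ge> 0"
  by (induction i arbitrary: n) (auto simp: fps_one_nth fps_mult_nth assms intro!: sum_nonneg)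

lemma fps_value_power:
  assumes "\<And>n. a $ n \<ge> 0" "x \<ge> 0"
  shows "fps_value (a ^ i) x = fps_value a x ^ i"
proof (induction i)
  case 0
  have "(\<Sum>n. ennreal ((1::real fps) $ n * x ^ n)) = (\<Sum>n\<in>{0}. ennreal ((1::real fps) $ n * x ^ n))"
    by (rule suminf_finite) auto
  then show ?case by (simp add: fps_value_def)
next
  case (Suc i)
  then show ?case using assms by (simp add: fps_value_mult fps_power_nonneg)
qed

lemma fps_power_nth_below:
  fixes b :: "'a :: comm_ring_1 fps"
  assumes "b $ 0 = 0" "n < i"
  shows "(b ^ i) $ n = 0"
  using assms startsby_zero_power_prefix by blast

lemma fps_value_compose:
  assumes a: "\<And>n. a $ n \<ge> 0" and b: "\<And>n. b $ n \<ge> 0" and b0: "b $ 0 = 0" and x: "x \<ge> 0"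
  shows "fps_value (a oo b) x = (\<Sum>i. ennreal (a $ i) * fps_value b x ^ i)"
proof -
  have "fps_value (a oo b) x = (\<Sum>n. \<Sum>i. ennreal (a $ i) * ennreal ((b ^ i) $ n * x ^ n))"
    unfolding fps_value_def
  proof (rule suminf_cong)
    fix n
    have "(\<Sum>i. ennreal (a $ i) * ennreal ((b ^ i) $ n * x ^ n))
        = (\<Sum>i\<in>{0..n}. ennreal (a $ i) * ennreal ((b ^ i) $ n * x ^ n))"
      by (rule suminf_finite) (auto simp: fps_power_nth_below[OF b0])
    also have "\<dots> = ennreal (\<Sum>i=0..n. a $ i * ((b ^ i) $ n * x ^ n))"
      using a x fps_power_nonneg[OF b] by (simp add: ennreal_mult flip: sum_ennreal)
    also have "(\<Sum>i=0..n. a $ i * ((b ^ i) $ n * x ^ n)) = (a oo b) $ n * x ^ n"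
      by (simp add: fps_compose_nth sum_distrib_right mult.assoc)
    finally show "ennreal ((a oo b) $ n * x ^ n) = (\<Sum>i. ennreal (a $ i) * ennreal ((b ^ i) $ n * x ^ n))"
      by simp
  qed
  also have "\<dots> = (\<Sum>i. \<Sum>n. ennreal (a $ i) * ennreal ((b ^ i) $ n * x ^ n))"
    by (rule suminf_swap_ennreal)
  also have "\<dots> = (\<Sum>i. ennreal (a $ i) * fps_value (b ^ i) x)"
    by (simp add: ennreal_suminf_cmult fps_value_def)
  finally show ?thesis using b x by (simp add: fps_value_power)
qed

lemma fps_compose_nonneg:
  fixes a b :: "real fps"
  assumes "\<And>n. a $ n \<ge> 0" "\<And>n. b $ n \<ge> 0"
  shows "(a oo b) $ n \<ge> 0"
  unfolding fps_compose_nth by (intro sum_nonneg mult_nonneg_nonneg assms fps_power_nonneg)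

lemma fps_value_exp_compose:
  assumes b: "\<And>n. b $ n \<ge> 0" "b $ 0 = 0" "x \<ge> 0" and t: "fps_value b x = ennreal t" "t \<ge> 0"
  shows "fps_value (fps_exp 1 oo b) x = ennreal (exp t)"
proof -
  have "fps_value (fps_exp 1 oo b) x = (\<Sum>i. ennreal (t ^ i /\<^sub>R fact i))"
    using b t by (subst fps_value_compose) (auto simp: ennreal_power divide_inverse mult.commute simp flip: ennreal_mult)
  also have "\<dots> = ennreal (\<Sum>i. t ^ i /\<^sub>R fact i)"
    by (rule suminf_ennreal2) (use t summable_exp_generic[of t] in auto)
  finally show ?thesis by (simp add: exp_def)
qed

section \<open>The functional equation of coloured trees\<close>

text \<open>The weight factors into \<open>i / m\<close>, the Stirling ratio
  \<open>m ^ m exp (-m) / m!\<close> and the product of \<open>1 - l / m\<close> over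
  \<open>l < i\<close>. The ratio supplies \<open>1 / sqrt m\<close>; the product is at most
  \<open>exp (- i (i - 1) / (2 m))\<close>, as in the birthday problem, and supplies the Gaussian
  factor.\<close>

lemma tree_power_exp_le:
  assumes i: "1 \<le> i" and im: "i \<le> m"
  shows "tree_power i $ m * exp (- real m) \<le> 2 * real i / (real m * sqrt (real m)) * exp (- ((real i)^2) / (4 * real m))"
proof -
  have m: "m \<ge> 1" using i im by simp
  have ff: "fact m / (fact (m - i) * real m ^ i) = (\<Prod>l<i. 1 - real l / real m)"
    using im
  proof (induction i)
    case (Suc i)
    have e: "fact (m - i) = real (m - i) * fact (m - Suc i)"
      using Suc.prems by (metis Suc_diff_Suc Suc_le_lessD fact_Suc of_nat_fact of_nat_mult)
    have "(\<Prod>l<Suc i. 1 - real l / real m) = fact m / (fact (m - i) * real m ^ i) * (1 - real i / real m)"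
      using Suc by simp
    also have "1 - real i / real m = real (m - i) / real m"
      using Suc.prems by (simp add: divide_simps)
    also have "fact m / (fact (m - i) * real m ^ i) * (real (m - i) / real m)
        = fact m / (fact (m - Suc i) * real m ^ Suc i)"
      unfolding e using Suc.prems by (simp add: divide_simps)
    finally show ?case by simp
  qed simp
  have P0: "0 \<le> (\<Prod>l<i. 1 - real l / real m)"
    using im by (intro prod_nonneg) (auto simp: divide_simps)
  have "(\<Prod>l<i. 1 - real l / real m) \<le> (\<Prod>l<i. exp (- (real l / real m)))"
  proof (rule prod_mono)
    fix l assume "l \<in> {..<i}"
    then show "0 \<le> 1 - real l / real m \<and> 1 - real l / real m \<le> exp (- (real l / real m))"
      using im exp_ge_add_one_self[of "- (real l / real m)"] by (simp add: divide_simps)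
  qed
  also have "\<dots> = exp (- (\<Sum>l<i. real l) / real m)"
    by (simp add: sum_divide_distrib flip: exp_sum sum_negf)
  also have "(\<Sum>l<i. real l) = real i * (real i - 1) / 2"
    by (induction i) (auto simp: field_simps)
  \<comment> \<open>Half of the quadratic exponent pays for the linear term: by
    \<open>(i - 1)\<^sup>2 \<ge> 0\<close> and \<open>m \<ge> 1\<close> the loss is at most
    \<open>1/4\<close>, hence the factor \<open>exp (1/4) \<le> 2\<close> below.\<close>
  also have "- (real i * (real i - 1) / 2) / real m \<le> 1/4 + - ((real i)^2) / (4 * real m)"
  proof -
    have "(real i)^2 - 2 * real i + 1 \<ge> 0" using zero_le_power2[of "real i - 1"]
      by (simp add: power2_eq_square algebra_simps)
    then have "real m + 2 * (real i * (real i - 1)) - (real i)^2 \<ge> 0"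
      using m im by (simp add: power2_eq_square algebra_simps)
    then have "- (2 * (real i * (real i - 1))) / (4 * real m) \<le> (real m - (real i)^2) / (4 * real m)"
      using m by (intro divide_right_mono) auto
    then show ?thesis using m by (simp add: diff_divide_distrib)
  qed
  finally have *: "(\<Prod>l<i. 1 - real l / real m) \<le> exp (1/4) * exp (- ((real i)^2) / (4 * real m))"
    by (simp flip: exp_add)
  have "exp (1/4::real) \<le> 2"
  proof -
    have "exp (1/4::real) \<le> exp 1" by simp
    have "exp (1/4::real) ^ 4 = exp 1" by (simp flip: exp_of_nat_mult)
    also have "\<dots> \<le> 2 ^ 4" using exp_le by simp
    finally show ?thesis using power_mono_iff[of "exp (1/4::real)" 2 4] by simp
  qed
  then have **: "(\<Prod>l<i. 1 - real l / real m) \<le> 2 * exp (- ((real i)^2) / (4 * real m))"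
    by (intro order_trans[OF *] mult_right_mono) auto
  have "tree_power i $ m * exp (- real m)
     = real i / real m * (real m ^ m * exp (- real m) / fact m) * (\<Prod>l<i. 1 - real l / real m)"
  proof -
    have "real m ^ m = real m ^ (m - i) * real m ^ i" using im by (simp flip: power_add)
    then show ?thesis unfolding ff [symmetric] using im m by (simp add: tree_power_def)
  qed
  also have "\<dots> \<le> real i / real m * (1 / sqrt (real m)) * (2 * exp (- ((real i)^2) / (4 * real m)))"
    using stirling_bounds(1)[OF m] ** P0 by (intro mult_mono mult_left_mono) auto
  finally show ?thesis by (simp add: mult_ac)
qed

lemma tree_power_one_exp_ge:
  assumes m: "1 \<le> m"
  shows "exp (-1) / (real m * sqrt (real m)) \<le> tree_power 1 $ m * exp (- real m)"
proof -
  have "fact m = real m * fact (m - 1)" using m by (metis fact_reduce less_eq_Suc_le One_nat_def of_nat_fact)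
  moreover have "real m ^ m = real m * real m ^ (m - 1)" using m by (metis power_eq_if not_one_le_zero)
  ultimately have "tree_power 1 $ m * exp (- real m) = 1 / real m * (real m ^ m * exp (- real m) / fact m)"
    using m by (simp add: tree_power_def)
  moreover have "1 / real m * (exp (-1) / sqrt (real m)) \<le> 1 / real m * (real m ^ m * exp (- real m) / fact m)"
    using stirling_bounds(2)[OF m] by (intro mult_left_mono) auto
  ultimately show ?thesis by simp
qed

lemma tree_power_nonneg: "tree_power i $ m \<ge> 0"
  by (simp add: tree_power_def)

text \<open>The terms decay like \<open>m powr (-3/2)\<close>, so the tree function still converges
  at its singularity \<open>exp (-1)\<close>. This is what later makes \<open>kh\<close> finite at
  \<open>\<rho>\<close> itself.\<close>

lemma summable_tree_power_one: "summable (\<lambda>m. tree_power 1 $ m * exp (- real m))"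
proof (rule summable_comparison_test')
  show "summable (\<lambda>m. 2 * real m powr (-3/2))"
    by (intro summable_mult) (simp add: summable_real_powr_iff)
  fix m :: nat assume m: "m \<ge> 1"
  have "tree_power 1 $ m * exp (- real m) \<le> 2 * real 1 / (real m * sqrt (real m)) * exp (- ((real 1)^2) / (4 * real m))"
    using m by (intro tree_power_exp_le) auto
  also have "\<dots> \<le> 2 * real 1 / (real m * sqrt (real m)) * 1"
    by (intro mult_left_mono) auto
  also have "real m * sqrt (real m) = real m powr (3/2)"
    using m powr_add[of "real m" 1 "1/2"] by (simp add: powr_half_sqrt)
  finally have "tree_power 1 $ m * exp (- real m) \<le> 2 * real m powr (-3/2)"
    using powr_minus_divide[of "real m" "3/2"] by simp
  then show "norm (tree_power 1 $ m * exp (- real m)) \<le> 2 * real m powr (-3/2)"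
    by (simp add: tree_power_nonneg)
qed

lemma fps_value_ge_term: 
  assumes "\<And>n. a $ n \<ge> 0" "x \<ge> 0"
  shows "ennreal (a $ n * x ^ n) \<le> fps_value a x"
  unfolding fps_value_def using sum_le_suminf[of "\<lambda>n. ennreal (a $ n * x ^ n)" "{n}"] by simp

lemma fps_value_mono:
  assumes "\<And>n. a $ n \<ge> 0" "0 \<le> x" "x \<le> y"
  shows "fps_value a x \<le> fps_value a y"
  unfolding fps_value_def
  by (intro suminf_le allI ennreal_leI mult_left_mono power_mono assms) auto

text \<open>\<open>h n\<close> stands for the number of trees with \<open>n\<close> nodes and a
  given root colour. \<open>rec\<close> is the Euler transform for multisets of branches in
  logarithmically differentiated form. \<open>conv\<close>, which comes from splitting off one
  branch, secures a positive radius of convergence.\<close>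

locale tree_counts =
  fixes k :: nat and h :: "nat \<Rightarrow> nat"
  assumes k: "k \<ge> 1" and h0: "h 0 = 0" and h1: "h 1 = 1"
    and rec: "\<And>n. n \<ge> 1 \<Longrightarrow> (n - 1) * h n = (\<Sum>j=1..n-1. k * (\<Sum>d | d dvd j. d * h d) * h (n - j))"
    and conv: "\<And>n. n \<ge> 2 \<Longrightarrow> h n \<le> k * (\<Sum>m=1..n-1. h m * h (n - m))"
begin

text \<open>
  \<open>F\<close> stands for \<open>\<Sum>i\<ge>2. k H(z\<^sup>i) / i\<close>, whose radius of convergence is the square root of that
  of \<open>H\<close>. Only the term \<open>i = 1\<close> of the multiset exponential is singular, and with \<open>y = k z exp F\<close> the
  functional equation of the trees reads \<open>k H = y exp (k H)\<close>.
\<close>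

definition kh :: "real fps" where "kh = Abs_fps (\<lambda>n. real k * real (h n))"
definition F :: "real fps" where
  "F = Abs_fps (\<lambda>n. real k * real (\<Sum>d | d dvd n \<and> d < n. d * h d) / real n)"
definition y :: "real fps" where "y = fps_const (real k) * fps_X * (fps_exp 1 oo F)"

lemma kh_nonneg: "kh $ n \<ge> 0" and F_nonneg: "F $ n \<ge> 0"
  by (simp_all add: kh_def F_def sum_nonneg)

lemma kh_0: "kh $ 0 = 0" and F_0: "F $ 0 = 0" and kh_1: "kh $ 1 = real k"
  using h0 h1 by (simp_all add: kh_def F_def)

lemma exp_F_nonneg: "(fps_exp 1 oo F) $ n \<ge> 0"
  by (rule fps_compose_nonneg) (auto simp: F_nonneg)

lemma y_nonneg: "y $ n \<ge> 0"
  using exp_F_nonneg by (cases n) (auto simp: y_def mult.assoc)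

lemma y_0: "y $ 0 = 0" and y_1: "y $ 1 = real k"
  by (simp_all add: y_def mult.assoc F_0)

text \<open>The bracket on the right has the divisor sums of \<open>rec\<close> as coefficients: the
  divisor \<open>d = j\<close> comes from \<open>kh\<close>, the proper divisors from
  \<open>F\<close>.\<close>

lemma ode: "fps_X * fps_deriv kh - kh = kh * (fps_X * fps_deriv kh + fps_X * fps_deriv F)"
proof (rule fps_ext)
  fix n
  have D: "(fps_X * fps_deriv kh + fps_X * fps_deriv F) $ j
     = (if j = 0 then 0 else real k * real (\<Sum>d | d dvd j. d * h d))" for j
  proof (cases "j = 0")
    case False
    have fin: "finite {d. d dvd j \<and> d < j}" by simp
    have "{d. d dvd j} = insert j {d. d dvd j \<and> d < j}"
      using False by (auto dest: dvd_imp_le)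
    then have "(\<Sum>d | d dvd j. d * h d) = j * h j + (\<Sum>d | d dvd j \<and> d < j. d * h d)" by simp
    then show ?thesis using False
      by (simp add: kh_def F_def algebra_simps of_nat_diff)
  qed simp
  show "(fps_X * fps_deriv kh - kh) $ n = (kh * (fps_X * fps_deriv kh + fps_X * fps_deriv F)) $ n"
  proof (cases "n = 0")
    case False
    have "(kh * (fps_X * fps_deriv kh + fps_X * fps_deriv F)) $ n
       = ((fps_X * fps_deriv kh + fps_X * fps_deriv F) * kh) $ n" by (simp only: mult.commute)
    also have "\<dots> = (\<Sum>j=0..n. (if j = 0 then 0 else real k * real (\<Sum>d | d dvd j. d * h d))
        * (real k * real (h (n - j))))"
      unfolding fps_mult_nth D by (simp add: kh_def)
    also have "\<dots> = (\<Sum>j=1..n-1. real k * real (\<Sum>d | d dvd j. d * h d) * (real k * real (h (n - j))))"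
    proof (rule sum.mono_neutral_cong_right)
      show "\<forall>j\<in>{0..n} - {1..n-1}. (if j = 0 then 0 else real k * real (\<Sum>d | d dvd j. d * h d))
        * (real k * real (h (n - j))) = 0"
      proof
        fix j assume "j \<in> {0..n} - {1..n-1}"
        then have "j = 0 \<or> j = n" by auto
        then show "(if j = 0 then 0 else real k * real (\<Sum>d | d dvd j. d * h d))
          * (real k * real (h (n - j))) = 0" by (auto simp: h0)
      qed
    qed auto
    also have "\<dots> = real k * real (\<Sum>j=1..n-1. k * (\<Sum>d | d dvd j. d * h d) * h (n - j))"
      by (simp add: sum_distrib_left mult_ac)
    also have "\<dots> = real k * real ((n - 1) * h n)" using rec[of n] False by simp
    also have "\<dots> = (fps_X * fps_deriv kh - kh) $ n"
      using False by (simp add: kh_def algebra_simps of_nat_diff)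
    finally show ?thesis by simp
  qed (simp add: kh_0)
qed

lemma kh_exp: "kh * (fps_exp (-1) oo kh) = y"
  using functional_equation_from_ode[OF kh_0 F_0 ode] kh_1 by (simp add: y_def)

lemma kh_eq: "kh = y * (fps_exp 1 oo kh)"
proof -
  have "y * (fps_exp 1 oo kh) = kh * ((fps_exp 1 oo kh) * (fps_exp (-1) oo kh))"
    unfolding kh_exp [symmetric] by (simp only: mult_ac)
  then show ?thesis by (simp only: fps_exp_compose_inverse[OF kh_0] mult_1_right)
qed

lemma kh_power: "i \<ge> 1 \<Longrightarrow> kh ^ i = tree_power i oo y"
  using power_eq_tree_power_compose[OF kh_0] kh_exp by simp

text \<open>A majorant of Catalan type: consecutive partial sums satisfy
  \<open>s' \<le> x + k s\<^sup>2\<close>, and for \<open>x = 1 / (4 k)\<close> the map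
  \<open>s \<mapsto> x + k s\<^sup>2\<close> has the double fixed point
  \<open>1 / (2 k)\<close>.\<close>

lemma partial_sum_le:
  "(\<Sum>m=1..n. real (h m) * (1 / (4 * real k)) ^ m) \<le> 1 / (2 * real k)"
proof (induction n)
  case (Suc n)
  define x where "x = 1 / (4 * real k)"
  define f where "f m = real (h m) * x ^ m" for m
  have x: "x > 0" using k by (simp add: x_def)
  have fnn: "f m \<ge> 0" for m using x by (simp add: f_def)
  have step: "f m \<le> real k * (\<Sum>i=1..m-1. f i * f (m - i))" if "m \<ge> 2" for m
  proof -
    have "f m \<le> real (k * (\<Sum>i=1..m-1. h i * h (m - i))) * x ^ m"
      unfolding f_def using conv[OF that] x by (intro mult_right_mono) (simp_all only: of_nat_le_iff, auto)
    also have "\<dots> = real k * (\<Sum>i=1..m-1. real (h i) * real (h (m - i)) * x ^ m)"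
      by (simp add: sum_distrib_right mult.assoc)
    also have "(\<Sum>i=1..m-1. real (h i) * real (h (m - i)) * x ^ m) = (\<Sum>i=1..m-1. f i * f (m - i))"
    proof (rule sum.cong)
      fix i assume "i \<in> {1..m-1}"
      then have "x ^ m = x ^ i * x ^ (m - i)" by (subst power_add [symmetric]) auto
      then show "real (h i) * real (h (m - i)) * x ^ m = f i * f (m - i)" by (simp add: f_def)
    qed simp
    finally show ?thesis .
  qed
  have "(\<Sum>m=1..Suc n. f m) = f 1 + (\<Sum>m=2..Suc n. f m)"
    by (subst sum.atLeast_Suc_atMost) (auto simp: numeral_2_eq_2)
  also have "f 1 = x" using h1 by (simp add: f_def)
  also have "(\<Sum>m=2..Suc n. f m) \<le> (\<Sum>m=2..Suc n. real k * (\<Sum>i=1..m-1. f i * f (m - i)))"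
    by (intro sum_mono step) auto
  also have "\<dots> = real k * (\<Sum>(m,i)\<in>(SIGMA m:{2..Suc n}. {1..m-1}). f i * f (m - i))"
    unfolding sum_distrib_left [symmetric] by (subst sum.Sigma) auto
  also have "(\<Sum>(m,i)\<in>(SIGMA m:{2..Suc n}. {1..m-1}). f i * f (m - i))
     = (\<Sum>(i,j)\<in>(\<lambda>(m,i). (i, m - i)) ` (SIGMA m:{2..Suc n}. {1..m-1}). f i * f j)"
    by (subst sum.reindex) (auto simp: inj_on_def case_prod_unfold)
  also have "\<dots> \<le> (\<Sum>(i,j)\<in>{1..n} \<times> {1..n}. f i * f j)"
    by (rule sum_mono2) (auto simp: fnn)
  also have "\<dots> = (\<Sum>m=1..n. f m) * (\<Sum>m=1..n. f m)"
    by (simp add: sum_product sum.cartesian_product)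
  also have "\<dots> \<le> (1 / (2 * real k)) * (1 / (2 * real k))"
    using Suc.IH fnn unfolding f_def x_def by (intro mult_mono sum_nonneg) auto
  finally have "(\<Sum>m=1..Suc n. f m) \<le> x + real k * ((1 / (2 * real k)) * (1 / (2 * real k)))"
    using k by simp
  also have "\<dots> = 1 / (2 * real k)" using k by (simp add: x_def field_simps)
  finally show ?case by (simp add: f_def x_def)
qed simp

lemma fps_value_kh_small: "fps_value kh (1 / (4 * real k)) < top"
proof -
  have "fps_value kh (1 / (4 * real k)) \<le> ennreal 1"
    unfolding fps_value_def
  proof (rule suminf_le_const)
    fix n
    have "(\<Sum>i<n. kh $ i * (1 / (4 * real k)) ^ i) \<le> (\<Sum>i=0..n. kh $ i * (1 / (4 * real k)) ^ i)"
      using kh_nonneg by (intro sum_mono2) auto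
    also have "\<dots> = (\<Sum>i=1..n. kh $ i * (1 / (4 * real k)) ^ i)"
      by (subst sum.atLeast_Suc_atMost) (auto simp: kh_0)
    also have "\<dots> = real k * (\<Sum>m=1..n. real (h m) * (1 / (4 * real k)) ^ m)"
      by (simp add: kh_def sum_distrib_left mult.assoc)
    also have "\<dots> \<le> real k * (1 / (2 * real k))" by (intro mult_left_mono partial_sum_le) auto
    also have "\<dots> \<le> 1" using k by simp
    finally show "(\<Sum>i<n. ennreal (kh $ i * (1 / (4 * real k)) ^ i)) \<le> ennreal 1"
      using kh_nonneg by (subst sum_ennreal) (auto intro: ennreal_leI)
  qed simp
  then show ?thesis by (rule le_less_trans) simp
qed

text \<open>If \<open>kh\<close> has the finite value \<open>t\<close>, then
  \<open>y = t exp (-t)\<close>, and \<open>exp (-1)\<close> is the maximum of this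
  function.\<close>

lemma fps_value_y_le:
  assumes x: "x \<ge> 0" and fin: "fps_value kh x < top"
  shows "fps_value y x \<le> ennreal (exp (-1))"
proof -
  obtain t where t: "fps_value kh x = ennreal t" "t \<ge> 0"
    using fin by (cases "fps_value kh x") auto
  have "ennreal t = fps_value (y * (fps_exp 1 oo kh)) x"
    using t arg_cong[OF kh_eq, of "\<lambda>a. fps_value a x"] by simp
  also have "\<dots> = fps_value y x * ennreal (exp t)"
    using fps_value_mult[of y "fps_exp 1 oo kh" x] fps_value_exp_compose[OF kh_nonneg kh_0 x t]
      x y_nonneg kh_nonneg by (simp add: fps_compose_nonneg)
  finally have "ennreal t = fps_value y x * ennreal (exp t)" .
  then have "ennreal t * ennreal (exp (-t)) = fps_value y x * (ennreal (exp t) * ennreal (exp (- t)))"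
    by (simp add: mult.assoc)
  also have "ennreal (exp t) * ennreal (exp (- t)) = 1"
    by (simp flip: ennreal_mult exp_add)
  finally have "fps_value y x = ennreal (t * exp (-t))"
    using t by (simp add: ennreal_mult)
  moreover have "t * exp (-t) \<le> exp (-1)"
  proof -
    have "t \<le> exp (t - 1)" using exp_ge_add_one_self[of "t - 1"] by simp
    then have "t * exp (-t) \<le> exp (t - 1) * exp (-t)" by (intro mult_right_mono) auto
    then show ?thesis by (simp flip: exp_add)
  qed
  ultimately show ?thesis by (simp add: ennreal_leI)
qed

text \<open>Converse of \<open>fps_value_y_le\<close>: \<open>kh\<close> is the tree function of
  \<open>y\<close>, and the tree function converges up to and including \<open>exp (-1)\<close>. So
  \<open>kh\<close> converges exactly where \<open>y\<close> is at most
  \<open>exp (-1)\<close>.\<close>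

lemma fps_value_kh_finite:
  assumes x: "x \<ge> 0" and le: "fps_value y x \<le> ennreal (exp (-1))"
  shows "fps_value kh x < top"
proof -
  have "fps_value kh x = (\<Sum>m. ennreal (tree_power 1 $ m) * fps_value y x ^ m)"
    using kh_power[of 1] fps_value_compose[OF tree_power_nonneg y_nonneg y_0 x] by simp
  also have "\<dots> \<le> (\<Sum>m. ennreal (tree_power 1 $ m) * ennreal (exp (-1)) ^ m)"
    by (intro suminf_le allI mult_left_mono power_mono le) auto
  also have "\<dots> = (\<Sum>m. ennreal (tree_power 1 $ m * exp (- real m)))"
  proof (rule suminf_cong)
    fix m
    have "exp (-1::real) ^ m = exp (- real m)" using exp_of_nat_mult[of m "-1::real"] by simp
    then show "ennreal (tree_power 1 $ m) * ennreal (exp (-1)) ^ m = ennreal (tree_power 1 $ m * exp (- real m))"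
      by (simp only: ennreal_power ennreal_mult tree_power_nonneg exp_ge_zero)
  qed
  also have "\<dots> < top"
    unfolding less_top [symmetric]
    by (rule ennreal_suminf_neq_top[OF summable_tree_power_one]) (simp add: tree_power_nonneg)
  finally show ?thesis .
qed

end

lemma fps_value_real:
  assumes "\<And>n. a $ n \<ge> 0" "x \<ge> 0" "fps_value a x < top"
  shows "summable (\<lambda>n. a $ n * x ^ n)" and "fps_value a x = ennreal (\<Sum>n. a $ n * x ^ n)"
proof -
  show s: "summable (\<lambda>n. a $ n * x ^ n)"
    using assms unfolding fps_value_def by (intro summable_suminf_not_top) auto
  show "fps_value a x = ennreal (\<Sum>n. a $ n * x ^ n)"
    unfolding fps_value_def using assms s by (intro suminf_ennreal2) auto
qed

lemma fps_power_scale_nth: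
  fixes a :: "real fps"
  shows "(Abs_fps (\<lambda>n. c * a $ n * x ^ n) ^ m) $ n = c ^ m * (a ^ m) $ n * x ^ n"
proof (induction m arbitrary: n)
  case 0
  then show ?case by (simp add: fps_one_nth)
next
  case (Suc m)
  have "(Abs_fps (\<lambda>n. c * a $ n * x ^ n) ^ Suc m) $ n
      = (\<Sum>i=0..n. c * a $ i * x ^ i * (c ^ m * (a ^ m) $ (n - i) * x ^ (n - i)))"
    by (simp add: fps_mult_nth Suc)
  also have "\<dots> = (\<Sum>i=0..n. c ^ Suc m * x ^ n * (a $ i * (a ^ m) $ (n - i)))"
  proof (rule sum.cong)
    fix i assume "i \<in> {0..n}"
    then have "x ^ n = x ^ i * x ^ (n - i)" by (subst power_add [symmetric]) auto
    then show "c * a $ i * x ^ i * (c ^ m * (a ^ m) $ (n - i) * x ^ (n - i))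
      = c ^ Suc m * x ^ n * (a $ i * (a ^ m) $ (n - i))" by simp
  qed simp
  also have "\<dots> = c ^ Suc m * (a ^ Suc m) $ n * x ^ n"
    by (simp add: fps_mult_nth sum_distrib_left sum_distrib_right mult_ac)
  finally show ?case .
qed

section \<open>The radius of convergence and the critical value of \<open>y\<close>\<close>

context tree_counts
begin

definition "conv_set = {x. 0 \<le> x \<and> fps_value kh x < top}"
definition "\<rho> = Sup conv_set"

lemma small_in_conv_set: "1 / (4 * real k) \<in> conv_set"
  using fps_value_kh_small by (simp add: conv_set_def)

text \<open>The linear term \<open>k x\<close> of \<open>y\<close> alone must stay below
  \<open>exp (-1)\<close>. A bound smaller than 1 is needed for \<open>\<rho> < sqrt \<rho>\<close>,
  which leaves room for analyticity beyond \<open>\<rho>\<close>.\<close>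

lemma conv_set_bound:
  assumes "x \<in> conv_set" shows "x \<le> 1/2"
proof -
  have x: "x \<ge> 0" "fps_value kh x < top" using assms by (auto simp: conv_set_def)
  have "ennreal (y $ 1 * x ^ 1) \<le> ennreal (exp (-1))"
    using fps_value_ge_term[OF y_nonneg x(1)] fps_value_y_le[OF x] by (rule order_trans)
  then have "real k * x \<le> exp (-1)" using y_1 by (simp add: ennreal_le_iff)
  moreover have "1 * x \<le> real k * x" using k x by (intro mult_right_mono) auto
  moreover have "exp (-1::real) \<le> 1/2"
  proof -
    have "(2::real) \<le> exp 1" using exp_ge_add_one_self[of "1::real"] by simp
    then show ?thesis by (simp add: exp_minus field_simps)
  qed
  ultimately show ?thesis by simp
qed

lemma rho_pos: "0 < \<rho>" and rho_le: "\<rho> \<le> 1/2"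
proof -
  have bdd: "bdd_above conv_set" using conv_set_bound by (rule bdd_aboveI)
  have "1 / (4 * real k) \<le> \<rho>" unfolding \<rho>_def by (rule cSup_upper[OF small_in_conv_set bdd])
  then show "0 < \<rho>" using k by (simp add: less_le_trans[of 0 "1 / (4 * real k)"])
  show "\<rho> \<le> 1/2" unfolding \<rho>_def
    by (rule cSup_least) (use small_in_conv_set conv_set_bound in auto)
qed

lemma below_rho: assumes "0 \<le> x" "x < \<rho>" shows "x \<in> conv_set"
proof -
  obtain s where s: "s \<in> conv_set" "x < s"
    using assms less_cSupE[of x conv_set] small_in_conv_set unfolding \<rho>_def by blast
  then have "fps_value kh x \<le> fps_value kh s"
    using assms by (intro fps_value_mono kh_nonneg) auto
  then show ?thesis using s assms by (auto simp: conv_set_def)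
qed

text \<open>It is not yet known that the supremum belongs to \<open>conv_set\<close>. Partial sums
  are polynomials, so the bound for them passes to the limit from the left.\<close>

lemma fps_value_y_rho_le: "fps_value y \<rho> \<le> ennreal (exp (-1))"
  unfolding fps_value_def
proof (rule suminf_le_const)
  fix n
  define P where "P x = (\<Sum>i<n. y $ i * x ^ i)" for x
  have "P \<rho> \<le> exp (-1)"
  proof (rule tendsto_upperbound)
    have "isCont P \<rho>" unfolding P_def by (intro continuous_intros)
    then show "(P \<longlongrightarrow> P \<rho>) (at_left \<rho>)"
      unfolding isCont_def by (rule filterlim_mono) (simp_all add: at_le)
    show "\<forall>\<^sub>F x in at_left \<rho>. P x \<le> exp (-1)"
      unfolding eventually_at_left_field
    proof (intro exI[of _ 0] conjI allI impI rho_pos)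
      fix x assume x: "0 < x" "x < \<rho>"
      then have "x \<in> conv_set" using below_rho by simp
      then have "fps_value y x \<le> ennreal (exp (-1))"
        using fps_value_y_le by (simp add: conv_set_def)
      moreover have "ennreal (P x) \<le> fps_value y x"
      proof -
        have "ennreal (P x) = (\<Sum>i<n. ennreal (y $ i * x ^ i))"
          unfolding P_def using x y_nonneg by (intro sum_ennreal [symmetric]) auto
        also have "\<dots> \<le> fps_value y x"
          unfolding fps_value_def by (intro sum_le_suminf) auto
        finally show ?thesis .
      qed
      ultimately have "ennreal (P x) \<le> ennreal (exp (-1))"
        using order_trans by blast
      then show "P x \<le> exp (-1)" using ennreal_le_iff[of "exp (-1)" "P x"] by simp
    qed
  qed simp
  then show "(\<Sum>i<n. ennreal (y $ i * \<rho> ^ i)) \<le> ennreal (exp (-1))"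
    using y_nonneg rho_pos by (subst sum_ennreal) (auto simp: P_def ennreal_leI)
qed simp

lemma fps_value_kh_rho: "fps_value kh \<rho> < top"
  using fps_value_kh_finite fps_value_y_rho_le rho_pos by simp

text \<open>A proper divisor of \<open>n\<close> is at most \<open>n / 2\<close>, and
  \<open>d / n \<le> 1\<close>. The halving is the reason why \<open>F\<close> still converges at
  \<open>sqrt \<rho>\<close>.\<close>

lemma F_le: "F $ n \<le> real k * (\<Sum>d | 2 * d \<le> n. real (h d))"
proof (cases "n = 0")
  case False
  have fin: "finite {d::nat. 2 * d \<le> n}" by (rule finite_subset[of _ "{..n}"]) auto
  have "(\<Sum>d | d dvd n \<and> d < n. d * h d) \<le> (\<Sum>d | d dvd n \<and> d < n. n * h d)"
    by (intro sum_mono) auto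
  also have "\<dots> \<le> (\<Sum>d | 2 * d \<le> n. n * h d)"
  proof (rule sum_mono2[OF fin])
    show "{d. d dvd n \<and> d < n} \<subseteq> {d. 2 * d \<le> n}"
    proof
      fix d assume "d \<in> {d. d dvd n \<and> d < n}"
      then obtain e where e: "n = d * e" and "d < n" by (auto elim: dvdE)
      with False have "e \<ge> 2" by (cases "e = 0 \<or> e = 1") auto
      then have "d * 2 \<le> n" unfolding e by (intro mult_left_mono) auto
      then show "d \<in> {d. 2 * d \<le> n}" by simp
    qed
  qed auto
  also have "\<dots> = n * (\<Sum>d | 2 * d \<le> n. h d)" by (simp add: sum_distrib_left)
  finally have "real (\<Sum>d | d dvd n \<and> d < n. d * h d) \<le> real (n * (\<Sum>d | 2 * d \<le> n. h d))"
    by (simp only: of_nat_le_iff)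
  then have "real (\<Sum>d | d dvd n \<and> d < n. d * h d) / real n \<le> (\<Sum>d | 2 * d \<le> n. real (h d))"
    using False by (simp add: divide_simps mult.commute)
  then have "real k * (real (\<Sum>d | d dvd n \<and> d < n. d * h d) / real n) \<le> real k * (\<Sum>d | 2 * d \<le> n. real (h d))"
    by (intro mult_left_mono) auto
  then show ?thesis by (simp add: F_def)
qed (simp add: F_0 sum_nonneg)

lemma fps_value_F_sqrt_rho: "fps_value F (sqrt \<rho>) < top"
proof -
  define s where "s = sqrt \<rho>"
  have s: "0 < s" "s < 1" "s ^ 2 = \<rho>" using rho_pos rho_le by (auto simp: s_def)
  have "fps_value F s \<le> (\<Sum>n. \<Sum>d. if 2 * d \<le> n then ennreal (kh $ d * s ^ n) else 0)"
    unfolding fps_value_def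
  proof (rule suminf_le)
    fix n
    have fin: "finite {d::nat. 2 * d \<le> n}" by (rule finite_subset[of _ "{..n}"]) auto
    have "F $ n * s ^ n \<le> real k * (\<Sum>d | 2 * d \<le> n. real (h d)) * s ^ n"
      using F_le s by (intro mult_right_mono) auto
    also have "\<dots> = (\<Sum>d | 2 * d \<le> n. kh $ d * s ^ n)"
      by (simp add: kh_def sum_distrib_left sum_distrib_right)
    finally have "ennreal (F $ n * s ^ n) \<le> (\<Sum>d | 2 * d \<le> n. ennreal (kh $ d * s ^ n))"
      using s kh_nonneg by (subst sum_ennreal) (auto intro: ennreal_leI)
    also have "\<dots> = (\<Sum>d | 2 * d \<le> n. if 2 * d \<le> n then ennreal (kh $ d * s ^ n) else 0)"
      by (rule sum.cong) auto
    also have "\<dots> = (\<Sum>d. if 2 * d \<le> n then ennreal (kh $ d * s ^ n) else 0)"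
      by (rule suminf_finite [symmetric]) (use fin in auto)
    finally show "ennreal (F $ n * s ^ n) \<le> (\<Sum>d. if 2 * d \<le> n then ennreal (kh $ d * s ^ n) else 0)" .
  qed auto
  also have "\<dots> = (\<Sum>d. \<Sum>n. if 2 * d \<le> n then ennreal (kh $ d * s ^ n) else 0)"
    by (rule suminf_swap_ennreal)
  \<comment> \<open>The geometric series of \<open>s ^ n\<close> over \<open>n \<ge> 2 d\<close>
    equals \<open>\<rho> ^ d / (1 - s)\<close> since \<open>s\<^sup>2 = \<rho>\<close>.\<close>
  also have "\<dots> = (\<Sum>d. ennreal (kh $ d * \<rho> ^ d) * ennreal (1 / (1 - s)))"
  proof (rule suminf_cong)
    fix d
    have "(\<Sum>n. if 2 * d \<le> n then ennreal (kh $ d * s ^ n) else 0)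
      = (\<Sum>n. if 2 * d \<le> n + 2 * d then ennreal (kh $ d * s ^ (n + 2 * d)) else 0)
        + (\<Sum>n<2*d. if 2 * d \<le> n then ennreal (kh $ d * s ^ n) else 0)"
      by (rule suminf_offset) simp
    also have "(\<Sum>n<2*d. if 2 * d \<le> n then ennreal (kh $ d * s ^ n) else 0) = 0"
      by (rule sum.neutral) auto
    also have "(\<Sum>n. if 2 * d \<le> n + 2 * d then ennreal (kh $ d * s ^ (n + 2 * d)) else 0)
       = (\<Sum>n. ennreal (kh $ d * \<rho> ^ d) * ennreal (s ^ n))"
    proof (rule suminf_cong)
      fix n
      have "kh $ d * s ^ (n + 2 * d) = kh $ d * \<rho> ^ d * s ^ n"
        unfolding s(3)[symmetric] by (simp add: power_add power_mult)
      moreover have "ennreal (kh $ d * \<rho> ^ d * s ^ n) = ennreal (kh $ d * \<rho> ^ d) * ennreal (s ^ n)"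
        using kh_nonneg[of d] rho_pos s by (intro ennreal_mult) auto
      ultimately show "(if 2 * d \<le> n + 2 * d then ennreal (kh $ d * s ^ (n + 2 * d)) else 0)
        = ennreal (kh $ d * \<rho> ^ d) * ennreal (s ^ n)" by (simp only: le_add2 if_True)
    qed
    also have "\<dots> = ennreal (kh $ d * \<rho> ^ d) * (\<Sum>n. ennreal (s ^ n))"
      by (rule ennreal_suminf_cmult)
    also have "(\<Sum>n. ennreal (s ^ n)) = ennreal (1 / (1 - s))"
      by (rule suminf_ennreal_eq) (use s geometric_sums[of s] in auto)
    finally show "(\<Sum>n. if 2 * d \<le> n then ennreal (kh $ d * s ^ n) else 0)
        = ennreal (kh $ d * \<rho> ^ d) * ennreal (1 / (1 - s))" by simp
  qed
  also have "\<dots> = fps_value kh \<rho> * ennreal (1 / (1 - s))"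
    unfolding fps_value_def by (rule ennreal_suminf_multc)
  also have "\<dots> < top" using fps_value_kh_rho by (simp add: ennreal_mult_less_top)
  finally show ?thesis by (simp add: s_def)
qed

lemma fps_value_y_sqrt_rho: "fps_value y (sqrt \<rho>) < top"
proof -
  define s where "s = sqrt \<rho>"
  have s: "0 \<le> s" using rho_pos by (auto simp: s_def)
  obtain t where t: "fps_value F s = ennreal t" "t \<ge> 0"
    using fps_value_F_sqrt_rho unfolding s_def by (cases "fps_value F (sqrt \<rho>)") auto
  have kX: "(fps_const (real k) * fps_X) $ n \<ge> 0" for n by (cases n) auto
  have "fps_value (fps_const (real k) * fps_X) s = (\<Sum>n\<in>{1}. ennreal ((fps_const (real k) * fps_X) $ n * s ^ n))"
    unfolding fps_value_def by (rule suminf_finite) auto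
  then have "fps_value (fps_const (real k) * fps_X) s < top" by simp
  moreover have "fps_value (fps_exp 1 oo F) s < top"
    using fps_value_exp_compose[OF F_nonneg F_0 s t] by simp
  ultimately show ?thesis
    unfolding s_def[symmetric] y_def fps_value_mult[OF kX exp_F_nonneg s] by (simp add: ennreal_mult_less_top)
qed

lemma summable_y_sqrt_rho: "summable (\<lambda>n. y $ n * sqrt \<rho> ^ n)"
  using fps_value_real(1)[OF y_nonneg _ fps_value_y_sqrt_rho] rho_pos by simp

lemma rho_less_sqrt: "\<rho> < sqrt \<rho>"
proof -
  have "\<rho> ^ 2 < \<rho>" using rho_pos rho_le by (simp add: power2_eq_square)
  then show ?thesis using rho_pos by (simp add: real_less_rsqrt)
qed

text \<open>Criticality. If \<open>y\<close> were smaller than \<open>exp (-1)\<close> at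
  \<open>\<rho>\<close>, it would remain so slightly to the right by continuity, and
  \<open>kh\<close> would converge there, against the choice of \<open>\<rho>\<close> as a
  supremum.\<close>

lemma y_rho_sums: "(\<lambda>n. y $ n * \<rho> ^ n) sums exp (-1)"
proof -
  have le: "fps_value y \<rho> \<le> ennreal (exp (-1))" by (rule fps_value_y_rho_le)
  then have fin: "fps_value y \<rho> < top" using le_less_trans ennreal_less_top by blast
  have \<rho>0: "0 \<le> \<rho>" using rho_pos by simp
  note yr = fps_value_real[OF y_nonneg \<rho>0 fin]
  define Y where "Y x = (\<Sum>n. y $ n * x ^ n)" for x
  have "Y \<rho> \<ge> 0" unfolding Y_def using y_nonneg \<rho>0 by (intro suminf_nonneg yr(1)) auto
  then have Yle: "Y \<rho> \<le> exp (-1)" using le unfolding yr(2) Y_def by (simp add: ennreal_le_iff)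
  have "Y \<rho> = exp (-1)"
  proof (rule ccontr)
    assume "Y \<rho> \<noteq> exp (-1)"
    with Yle have lt: "Y \<rho> < exp (-1)" by simp
    have "isCont Y \<rho>" unfolding Y_def
      by (rule isCont_powser[OF summable_y_sqrt_rho]) (use rho_pos rho_less_sqrt in auto)
    then have "(Y \<longlongrightarrow> Y \<rho>) (at_right \<rho>)"
      unfolding isCont_def by (rule filterlim_mono) (simp_all add: at_le)
    then have "\<forall>\<^sub>F x in at_right \<rho>. Y x < exp (-1)"
      using lt by (rule order_tendstoD)
    then obtain b where b: "b > \<rho>" "\<And>x. \<rho> < x \<Longrightarrow> x < b \<Longrightarrow> Y x < exp (-1)"
      unfolding eventually_at_right_field by blast
    define x where "x = (\<rho> + min b (sqrt \<rho>)) / 2"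
    have x: "\<rho> < x" "x < b" "x < sqrt \<rho>" using b rho_less_sqrt by (auto simp: x_def min_def)
    then have x0: "0 \<le> x" using rho_pos by simp
    have "fps_value y x \<le> fps_value y (sqrt \<rho>)"
      using x x0 by (intro fps_value_mono y_nonneg) auto
    then have "fps_value y x < top" using fps_value_y_sqrt_rho by (rule le_less_trans)
    then have "fps_value y x = ennreal (Y x)" unfolding Y_def
      by (rule fps_value_real(2)[OF y_nonneg x0])
    also have "\<dots> \<le> ennreal (exp (-1))" using b(2)[of x] x by (intro ennreal_leI) auto
    finally have "x \<in> conv_set" using fps_value_kh_finite x0 by (simp add: conv_set_def)
    then have "x \<le> \<rho>" unfolding \<rho>_def
      by (rule cSup_upper) (rule bdd_aboveI[OF conv_set_bound])
    then show False using x by simp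
  qed
  then show ?thesis using yr(1) unfolding Y_def by (simp add: sums_iff)
qed

text \<open>The step distribution of the renewal process: \<open>y\<close> tilted to
  \<open>\<rho>\<close>, with total mass 1 by criticality.\<close>

definition p :: "nat \<Rightarrow> real" where "p n = exp 1 * y $ n * \<rho> ^ n"

lemma p_nonneg: "p n \<ge> 0" and p_0: "p 0 = 0" and p_1: "p 1 > 0"
  using y_nonneg rho_pos y_0 y_1 k by (auto simp: p_def)

lemma p_sums: "p sums 1"
proof -
  have "(\<lambda>n. exp 1 * (y $ n * \<rho> ^ n)) sums (exp 1 * exp (-1))"
    by (rule sums_mult[OF y_rho_sums])
  moreover have "exp 1 * exp (-1) = (1::real)" by (simp flip: exp_add)
  moreover have "(\<lambda>n. exp 1 * (y $ n * \<rho> ^ n)) = p" by (auto simp: p_def)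
  ultimately show ?thesis by simp
qed

text \<open>A power series may be differentiated inside its disc of convergence, and for
  \<open>y\<close> this disc reaches at least to \<open>sqrt \<rho> > \<rho>\<close>.\<close>

lemma p_mean: "summable (\<lambda>n. real n * p n)"
proof -
  have "summable (\<lambda>n. diffs (fps_nth y) n * \<rho> ^ n)"
  proof (rule termdiff_converges)
    show "norm \<rho> < sqrt \<rho>" using rho_pos rho_less_sqrt by simp
    fix x :: real assume "norm x < sqrt \<rho>"
    then show "summable (\<lambda>n. y $ n * x ^ n)"
      using powser_inside[OF summable_y_sqrt_rho, of x] rho_pos by simp
  qed
  then have "summable (\<lambda>n. exp 1 * \<rho> * (diffs (fps_nth y) n * \<rho> ^ n))" by (rule summable_mult)
  moreover have "(\<lambda>n. exp 1 * \<rho> * (diffs (fps_nth y) n * \<rho> ^ n)) = (\<lambda>n. real (Suc n) * p (Suc n))"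
    by (rule ext) (simp add: diffs_def p_def)
  ultimately show ?thesis using summable_Suc_iff[of "\<lambda>n. real n * p n"] by simp
qed

definition g :: "nat \<Rightarrow> real" where "g n = real k * real (h n) * \<rho> ^ n"

lemma g_nonneg: "g n \<ge> 0" using rho_pos by (simp add: g_def)

text \<open>By \<open>kh_power\<close>, powers of \<open>kh\<close> are Lagrange coefficients
  composed with \<open>y\<close>. Tilting turns \<open>y ^ m\<close> into the law of a sum of
  \<open>m\<close> independent steps and leaves the factor \<open>exp (- m)\<close> with the
  Lagrange coefficient.\<close>

lemma g_power: 
  assumes "i \<ge> 1"
  shows "(Abs_fps g ^ i) $ n = (\<Sum>m=0..n. tree_power i $ m * exp (- real m) * (Abs_fps p ^ m) $ n)"
proof -
  have "Abs_fps g = Abs_fps (\<lambda>n. 1 * kh $ n * \<rho> ^ n)"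
    by (intro arg_cong[where f = Abs_fps] ext) (simp add: g_def kh_def)
  then have "(Abs_fps g ^ i) $ n = (kh ^ i) $ n * \<rho> ^ n"
    using fps_power_scale_nth[of 1 kh \<rho> i n] by simp
  also have "\<dots> = (\<Sum>m=0..n. tree_power i $ m * (y ^ m) $ n * \<rho> ^ n)"
    unfolding kh_power[OF assms] fps_compose_nth by (simp add: sum_distrib_right)
  also have "\<dots> = (\<Sum>m=0..n. tree_power i $ m * exp (- real m) * (Abs_fps p ^ m) $ n)"
  proof (rule sum.cong)
    fix m
    have "Abs_fps p = Abs_fps (\<lambda>n. exp 1 * y $ n * \<rho> ^ n)"
      by (intro arg_cong[where f = Abs_fps] ext) (simp add: p_def)
    then have "(Abs_fps p ^ m) $ n = exp 1 ^ m * (y ^ m) $ n * \<rho> ^ n"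
      using fps_power_scale_nth[of "exp 1" y \<rho> m n] by simp
    moreover have "exp (- real m) * exp 1 ^ m = (1::real)"
      using exp_of_nat_mult[of m "1::real"] exp_minus_inverse[of "real m"] by (simp add: mult.commute)
    ultimately show "tree_power i $ m * (y ^ m) $ n * \<rho> ^ n
      = tree_power i $ m * exp (- real m) * (Abs_fps p ^ m) $ n"
      by (simp add: mult.assoc)
  qed simp
  finally show ?thesis .
qed

lemma g_summable: "summable g"
proof -
  have "summable (\<lambda>n. kh $ n * \<rho> ^ n)"
    using fps_value_real(1)[OF kh_nonneg _ fps_value_kh_rho] rho_pos by simp
  then show ?thesis by (simp add: kh_def g_def[abs_def])
qed

end

section \<open>Renewal estimates\<close>

lemma sum_inverse_sqrt_le: "(\<Sum>m=1..N. 1 / sqrt (real m)) \<le> 2 * sqrt (real N)"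
proof (induction N)
  case (Suc N)
  define a where "a = sqrt (real N)"
  define b where "b = sqrt (real (Suc N))"
  have ab: "0 \<le> a" "a \<le> b" "0 < b" "b * b - a * a = 1"
    by (auto simp: a_def b_def)
  have "(b - a) * (b + a) = 1" using ab by (simp add: algebra_simps)
  moreover have "(b - a) * (b + a) \<le> (b - a) * (2 * b)" using ab by (intro mult_left_mono) auto
  ultimately have "1 / b \<le> 2 * (b - a)" using ab by (simp add: field_simps)
  then show ?case using Suc by (simp add: a_def b_def)
qed simp

lemma sum_tail_three_halves_le:
  assumes "1 \<le> N" "N \<le> M"
  shows "(\<Sum>m=Suc N..M. 1 / (real m * sqrt (real m))) \<le> 2 / sqrt (real N) - 2 / sqrt (real M)"
  using assms(2)
proof (induction M rule: dec_induct)
  case (step M)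
  define a where "a = sqrt (real M)"
  define b where "b = sqrt (real (Suc M))"
  have ab: "0 < a" "a \<le> b" "0 < b" "b * b - a * a = 1" "real (Suc M) = b * b"
    using assms step by (auto simp: a_def b_def)
  have "(b - a) * (b + a) = 1" using ab by (simp add: algebra_simps)
  moreover have "(b - a) * (b + a) \<le> (b - a) * (2 * b)" using ab by (intro mult_left_mono) auto
  ultimately have 1: "1 \<le> 2 * b * (b - a)" by (simp add: mult_ac)
  have "1 / (b * b * b) = 1 * (1 / (b * b * b))" by simp
  also have "\<dots> \<le> (2 * b * (b - a)) * (1 / (b * b * b))"
    using 1 ab by (intro mult_right_mono) auto
  also have "\<dots> = 2 * (b - a) / (b * b)" using ab(3) by (simp add: field_simps)
  also have "\<dots> \<le> 2 * (b - a) / (a * b)" using ab by (intro divide_left_mono mult_right_mono) auto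
  also have "\<dots> = 2 / a - 2 / b" using ab(1,3) by (simp add: field_simps)
  finally have "1 / (b * b * b) \<le> 2 / a - 2 / b" .
  moreover have "1 / (real (Suc M) * sqrt (real (Suc M))) = 1 / (b * b * b)"
    unfolding ab(5) using ab by (simp add: real_sqrt_mult)
  ultimately show ?case using step by (simp add: a_def b_def)
qed simp


locale renewal =
  fixes p :: "nat \<Rightarrow> real"
  assumes p_nonneg: "\<And>n. p n \<ge> 0" and p_0: "p 0 = 0" and p_1: "p 1 > 0"
    and p_sums: "p sums 1" and p_mean: "summable (\<lambda>n. real n * p n)"
begin

definition "\<mu> = (\<Sum>n. real n * p n)"
definition conv :: "nat \<Rightarrow> nat \<Rightarrow> real" where "conv m n = (Abs_fps p ^ m) $ n"
text \<open>The probability that the renewal process visits \<open>n\<close>. Summing up to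
  \<open>m = n\<close> is enough because every step is at least 1.\<close>

definition u :: "nat \<Rightarrow> real" where "u n = (\<Sum>m=0..n. conv m n)"

lemma conv_nonneg: "conv m n \<ge> 0"
  unfolding conv_def by (rule fps_power_nonneg) (simp add: p_nonneg)

lemma conv_below: "n < m \<Longrightarrow> conv m n = 0"
  unfolding conv_def by (rule fps_power_nth_below) (simp_all add: p_0)

lemma conv_Suc: "conv (Suc m) n = (\<Sum>l=0..n. p l * conv m (n - l))"
  by (simp add: conv_def fps_mult_nth)

lemma sum_p_le: "finite A \<Longrightarrow> (\<Sum>l\<in>A. p l) \<le> 1"
  using sum_le_suminf[of p A] p_sums p_nonneg by (auto simp: sums_iff)

lemma u_eq: "n \<ge> 1 \<Longrightarrow> u n = (\<Sum>l=1..n. p l * u (n - l))"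
proof -
  assume n: "n \<ge> 1"
  have "u n = conv 0 n + (\<Sum>m=1..n. conv m n)"
    unfolding u_def by (subst sum.atLeast_Suc_atMost) auto
  also have "conv 0 n = 0" using n by (simp add: conv_def)
  also have "(\<Sum>m=1..n. conv m n) = (\<Sum>m=0..n-1. conv (Suc m) n)"
    using n by (intro sum.reindex_bij_witness[of _ Suc "\<lambda>m. m - 1"]) auto
  also have "\<dots> = (\<Sum>l=0..n. p l * (\<Sum>m=0..n-1. conv m (n - l)))"
    unfolding conv_Suc sum_distrib_left by (rule sum.swap)
  also have "\<dots> = (\<Sum>l=1..n. p l * (\<Sum>m=0..n-1. conv m (n - l)))"
    by (subst sum.atLeast_Suc_atMost) (auto simp: p_0)
  also have "\<dots> = (\<Sum>l=1..n. p l * u (n - l))"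
  proof (rule sum.cong)
    fix l assume l: "l \<in> {1..n}"
    have "(\<Sum>m=0..n-1. conv m (n - l)) = u (n - l)"
      unfolding u_def by (rule sum.mono_neutral_right) (use l in \<open>auto simp: conv_below\<close>)
    then show "p l * (\<Sum>m=0..n-1. conv m (n - l)) = p l * u (n - l)" by simp
  qed simp
  finally show ?thesis by simp
qed

lemma u_0: "u 0 = 1" by (simp add: u_def conv_def)

lemma u_nonneg: "u n \<ge> 0" unfolding u_def by (intro sum_nonneg conv_nonneg)

lemma u_le: "u n \<le> 1"
proof (induction n rule: less_induct)
  case (less n)
  show ?case
  proof (cases "n = 0")
    case False
    then have "u n = (\<Sum>l=1..n. p l * u (n - l))" by (intro u_eq) auto
    also have "\<dots> \<le> (\<Sum>l=1..n. p l * 1)"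
      by (intro sum_mono mult_left_mono less p_nonneg) (use False in auto)
    also have "\<dots> \<le> 1" using sum_p_le[of "{1..n}"] by simp
    finally show ?thesis .
  qed (simp add: u_0)
qed

definition "tail_prob l = 1 - (\<Sum>i=0..l. p i)"

lemma tail_prob_nonneg: "tail_prob l \<ge> 0" and tail_prob_le: "tail_prob l \<le> 1"
  using sum_p_le[of "{0..l}"] by (auto simp: tail_prob_def p_nonneg sum_nonneg)

text \<open>Decomposition by the last visited point \<open>n - l\<close> not exceeding
  \<open>n\<close>: the step that follows it must be larger than \<open>l\<close>.\<close>

lemma tail_prob_u: "(\<Sum>l=0..n. tail_prob l * u (n - l)) = 1"
proof (induction n)
  case 0
  then show ?case by (simp add: tail_prob_def p_0 u_0)
next
  case (Suc n)
  have u_Suc: "u (Suc n) = (\<Sum>l=1..Suc n. p l * u (Suc n - l))" by (rule u_eq) simp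
  have "(\<Sum>l=0..Suc n. tail_prob l * u (Suc n - l)) = tail_prob 0 * u (Suc n) + (\<Sum>l=1..Suc n. tail_prob l * u (Suc n - l))"
    by (subst sum.atLeast_Suc_atMost) auto
  also have "tail_prob 0 = 1" by (simp add: tail_prob_def p_0)
  also have "(\<Sum>l=1..Suc n. tail_prob l * u (Suc n - l)) = (\<Sum>l=1..Suc n. tail_prob (l - 1) * u (Suc n - l) - p l * u (Suc n - l))"
  proof (rule sum.cong)
    fix l assume "l \<in> {1..Suc n}"
    then have "tail_prob l = tail_prob (l - 1) - p l" by (cases l) (auto simp: tail_prob_def)
    then show "tail_prob l * u (Suc n - l) = tail_prob (l - 1) * u (Suc n - l) - p l * u (Suc n - l)"
      by (simp add: left_diff_distrib)
  qed simp
  also have "\<dots> = (\<Sum>l=1..Suc n. tail_prob (l - 1) * u (Suc n - l)) - u (Suc n)"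
    by (simp only: sum_subtractf u_Suc [symmetric])
  also have "(\<Sum>l=1..Suc n. tail_prob (l - 1) * u (Suc n - l)) = (\<Sum>l=0..n. tail_prob l * u (n - l))"
    by (rule sum.reindex_bij_witness[of _ Suc "\<lambda>m. m - 1"]) auto
  finally show ?case using Suc by simp
qed

lemma sum_tail_prob_eq: "(\<Sum>l<n. tail_prob l) = (\<Sum>i<n. real i * p i) + real n * (1 - (\<Sum>i<n. p i))"
proof (induction n)
  case (Suc n)
  have "tail_prob n = 1 - (\<Sum>i<n. p i) - p n" by (simp add: tail_prob_def atLeast0AtMost lessThan_Suc_atMost[symmetric])
  then show ?case using Suc by (simp add: algebra_simps)
qed simp

lemma mean_tail: "real n * (1 - (\<Sum>i<n. p i)) \<le> \<mu> - (\<Sum>i<n. real i * p i)"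
proof -
  have p: "summable p" "suminf p = 1" using p_sums by (auto simp: sums_iff)
  have "real n * (1 - (\<Sum>i<n. p i)) = (\<Sum>i. real n * p (i + n))"
    using suminf_split_initial_segment[OF p(1), of n] p summable_ignore_initial_segment[OF p(1), of n]
    by (simp add: suminf_mult)
  also have "\<dots> \<le> (\<Sum>i. real (i + n) * p (i + n))"
    using summable_ignore_initial_segment[OF p(1), of n] summable_ignore_initial_segment[OF p_mean, of n]
    by (intro suminf_le mult_right_mono p_nonneg summable_mult) auto
  also have "\<dots> = \<mu> - (\<Sum>i<n. real i * p i)"
    using suminf_split_initial_segment[OF p_mean, of n] by (simp add: \<mu>_def)
  finally show ?thesis .
qed

lemma summable_tail_prob: "summable tail_prob"
proof (rule bounded_imp_summable)
  fix n show "(\<Sum>l\<le>n. tail_prob l) \<le> \<mu>"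
    using sum_tail_prob_eq[of "Suc n"] mean_tail[of "Suc n"] by (simp only: lessThan_Suc_atMost)
qed (rule tail_prob_nonneg)

text \<open>A weak form of the renewal theorem. In \<open>tail_prob_u\<close> the terms with
  \<open>l \<ge> L\<close> contribute at most \<open>1/2\<close>, so some \<open>u (n - l)\<close>
  with \<open>l \<le> L\<close> is bounded below; from \<open>n - l\<close> the process reaches
  \<open>n\<close> by \<open>l\<close> unit steps, which costs \<open>p 1 ^ l\<close>.\<close>

lemma u_lower: "\<exists>c>0. \<forall>n. c \<le> u n"
proof -
  obtain L where L: "norm (\<Sum>i. tail_prob (i + L)) < 1/2"
    using suminf_exist_split[of "1/2" tail_prob] summable_tail_prob by (meson half_gt_zero_iff le_refl zero_less_one)
  have tail: "(\<Sum>l\<in>{L..n}. tail_prob l) \<le> 1/2" for n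
  proof -
    have s: "summable (\<lambda>i. tail_prob (i + L))" using summable_tail_prob by (rule summable_ignore_initial_segment)
    have "(\<Sum>l\<in>{L..n}. tail_prob l) = (\<Sum>i\<in>(\<lambda>l. l - L) ` {L..n}. tail_prob (i + L))"
      by (subst sum.reindex) (auto simp: inj_on_def)
    also have "\<dots> \<le> (\<Sum>i. tail_prob (i + L))" by (rule sum_le_suminf[OF s]) (auto simp: tail_prob_nonneg)
    finally show ?thesis using L by simp
  qed
  have p1: "p 1 \<le> 1" using sum_p_le[of "{1}"] by simp
  have step: "p 1 ^ l * u n \<le> u (n + l)" for l n
  proof (induction l)
    case (Suc l)
    have "p 1 ^ Suc l * u n = p 1 * (p 1 ^ l * u n)" by simp
    also have "\<dots> \<le> p 1 * u (n + l)" using Suc p_1 by (intro mult_left_mono) auto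
    also have "\<dots> = (\<Sum>i\<in>{1}. p i * u (Suc (n + l) - i))" by simp
    also have "\<dots> \<le> (\<Sum>i=1..Suc (n+l). p i * u (Suc (n + l) - i))"
      by (rule sum_mono2) (auto simp: p_nonneg u_nonneg)
    also have "\<dots> = u (n + Suc l)" using u_eq[of "n + Suc l"] by simp
    finally show ?case .
  qed simp
  have "p 1 ^ L / (2 * (real L + 1)) \<le> u n" for n
  proof -
    have "\<exists>l\<le>n. l < L + 1 \<and> u (n - l) \<ge> 1 / (2 * (real L + 1))"
    proof (rule ccontr)
      assume "\<not> ?thesis"
      then have lt: "u (n - l) < 1 / (2 * (real L + 1))" if "l \<le> n" "l < L + 1" for l using that by force
      have "1 = (\<Sum>l\<in>{0..n}. tail_prob l * u (n - l))" using tail_prob_u by simp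
      also have "\<dots> \<le> (\<Sum>l\<in>{0..n} \<inter> {..<L}. 1 * (1 / (2 * (real L + 1)))) + (\<Sum>l\<in>{L..n}. tail_prob l * 1)"
      proof -
        have e: "{0..n} = ({0..n} \<inter> {..<L}) \<union> {L..n}" by auto
        have "(\<Sum>l\<in>{0..n}. tail_prob l * u (n - l)) = (\<Sum>l\<in>{0..n} \<inter> {..<L}. tail_prob l * u (n - l)) + (\<Sum>l\<in>{L..n}. tail_prob l * u (n - l))"
          by (subst e, rule sum.union_disjoint) auto
        moreover have "(\<Sum>l\<in>{0..n} \<inter> {..<L}. tail_prob l * u (n - l)) \<le> (\<Sum>l\<in>{0..n} \<inter> {..<L}. 1 * (1 / (2 * (real L + 1))))"
          using lt by (intro sum_mono mult_mono tail_prob_nonneg tail_prob_le u_nonneg) (auto intro: less_imp_le)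
        moreover have "(\<Sum>l\<in>{L..n}. tail_prob l * u (n - l)) \<le> (\<Sum>l\<in>{L..n}. tail_prob l * 1)"
          by (intro sum_mono mult_left_mono tail_prob_nonneg u_le)
        ultimately show ?thesis by linarith
      qed
      also have "(\<Sum>l\<in>{0..n} \<inter> {..<L}. 1 * (1 / (2 * (real L + 1)))) \<le> real L * (1 / (2 * (real L + 1)))"
      proof -
        have "card ({0..n} \<inter> {..<L}) \<le> card {..<L}" by (rule card_mono) auto
        then show ?thesis by (simp add: divide_right_mono)
      qed
      also have "real L * (1 / (2 * (real L + 1))) < 1/2" by (simp add: field_simps)
      finally show False using tail[of n] by simp
    qed
    then obtain l where l: "l \<le> n" "l \<le> L" "u (n - l) \<ge> 1 / (2 * (real L + 1))" by auto
    have "p 1 ^ L * (1 / (2 * (real L + 1))) \<le> p 1 ^ l * u (n - l)"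
      using l p_1 p1 by (intro mult_mono power_decreasing) auto
    also have "\<dots> \<le> u n" using step[of l "n - l"] l by simp
    finally show ?thesis by simp
  qed
  moreover have "p 1 ^ L / (2 * (real L + 1)) > 0" using p_1 by simp
  ultimately show ?thesis by blast
qed

lemma fps_value_conv: "fps_value (Abs_fps p ^ m) 1 = 1"
proof -
  have "fps_value (Abs_fps p) 1 = ennreal 1"
    unfolding fps_value_def by (rule suminf_ennreal_eq) (use p_nonneg p_sums in auto)
  then show ?thesis using fps_value_power[of "Abs_fps p" 1 m] p_nonneg by simp
qed

lemma sum_conv_le: "finite A \<Longrightarrow> (\<Sum>n\<in>A. conv m n) \<le> 1"
proof -
  assume A: "finite A"
  have "ennreal (\<Sum>n\<in>A. conv m n) = (\<Sum>n\<in>A. ennreal (conv m n))"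
    by (intro sum_ennreal[symmetric] conv_nonneg)
  also have "\<dots> \<le> fps_value (Abs_fps p ^ m) 1"
    unfolding fps_value_def using A by (simp add: conv_def[symmetric]) (intro sum_le_suminf, auto)
  finally show ?thesis unfolding fps_value_conv by (simp add: ennreal_le_iff flip: ennreal_1)
qed

text \<open>A sum of \<open>m\<close> steps has expectation \<open>m \<mu>\<close>. This is read off
  from \<open>X (P ^ m)' = m P ^ (m - 1) X P'\<close>, evaluated at 1.\<close>

lemma sum_mean_conv_le: "finite A \<Longrightarrow> (\<Sum>n\<in>A. real n * conv m n) \<le> real m * \<mu>"
proof (cases "m = 0")
  case True
  then have "(\<Sum>n\<in>A. real n * conv m n) = 0"
    by (intro sum.neutral ballI) (simp add: conv_def)
  then show ?thesis using True by simp
next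
  case False
  assume A: "finite A"
  define P where "P = Abs_fps p"
  define Q where "Q = fps_X * fps_deriv P"
  have Qn: "Q $ n = real n * p n" for n
    by (cases n) (simp_all add: Q_def P_def)
  have "fps_X * fps_deriv (P ^ m) = fps_const (real m) * (P ^ (m - 1) * Q)"
    by (simp add: fps_deriv_power Q_def mult_ac)
  then have e: "real n * conv m n = real m * (P ^ (m - 1) * Q) $ n" for n
  proof -
    have "real n * conv m n = (fps_X * fps_deriv (P ^ m)) $ n"
      by (cases n) (simp_all add: conv_def P_def)
    also have "\<dots> = real m * (P ^ (m - 1) * Q) $ n"
      unfolding \<open>fps_X * fps_deriv (P ^ m) = _\<close> by simp
    finally show ?thesis .
  qed
  have Q1: "fps_value Q 1 = ennreal \<mu>"
    unfolding fps_value_def Qn \<mu>_def by (simp, rule suminf_ennreal2) (use p_nonneg p_mean in auto)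
  have Qnn: "Q $ n \<ge> 0" for n by (simp add: Qn p_nonneg)
  have Pnn: "(P ^ i) $ n \<ge> 0" for i n by (rule fps_power_nonneg) (simp add: P_def p_nonneg)
  have \<mu>: "\<mu> \<ge> 0" unfolding \<mu>_def by (intro suminf_nonneg p_mean) (simp add: p_nonneg)
  have v: "fps_value (P ^ (m - 1) * Q) 1 = ennreal \<mu>"
    using fps_value_mult[OF Pnn Qnn, of 1 "m - 1"] Q1 fps_value_conv[of "m - 1"] by (simp add: P_def)
  have nn: "(P ^ (m - 1) * Q) $ n \<ge> 0" for n
    using Pnn Qnn by (auto simp: fps_mult_nth intro!: sum_nonneg)
  have "ennreal (\<Sum>n\<in>A. (P ^ (m - 1) * Q) $ n) = (\<Sum>n\<in>A. ennreal ((P ^ (m - 1) * Q) $ n))"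
    by (intro sum_ennreal[symmetric] nn)
  also have "\<dots> \<le> ennreal \<mu>"
    unfolding v[symmetric] fps_value_def using A by simp (intro sum_le_suminf, auto)
  finally have "(\<Sum>n\<in>A. (P ^ (m - 1) * Q) $ n) \<le> \<mu>" using \<mu> by (simp add: ennreal_le_iff)
  then have "real m * (\<Sum>n\<in>A. (P ^ (m - 1) * Q) $ n) \<le> real m * \<mu>" by (intro mult_left_mono) auto
  then show ?thesis unfolding e by (simp add: sum_distrib_left)
qed

text \<open>Markov's inequality for the sum of \<open>m\<close> steps.\<close>

lemma sum_conv_tail_le: "N \<ge> 1 \<Longrightarrow> (\<Sum>n=Suc N..M. conv m n) \<le> real m * \<mu> / real N"
proof -
  assume N: "N \<ge> 1"
  have "real N * (\<Sum>n=Suc N..M. conv m n) \<le> (\<Sum>n=Suc N..M. real n * conv m n)"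
    unfolding sum_distrib_left by (intro sum_mono mult_right_mono conv_nonneg) auto
  also have "\<dots> \<le> real m * \<mu>" by (rule sum_mean_conv_le) simp
  finally show ?thesis using N by (simp add: field_simps)
qed

lemma mu_nonneg: "\<mu> \<ge> 0" 
  unfolding \<mu>_def by (intro suminf_nonneg p_mean) (simp add: p_nonneg)

end

text \<open>Half of the exponent is spent on the power of \<open>t\<close>. With the constant 128
  the quadratic Taylor polynomial of \<open>128 exp (t / 8)\<close> is
  \<open>128 + 16 t + t\<^sup>2\<close>, which dominates \<open>t (1 + t)\<close>.\<close>

lemma sqrt_cube_exp_le:
  fixes t :: real
  assumes "t \<ge> 0"
  shows "t * sqrt t * exp (- t / 4) \<le> 128 * exp (- t / 8)"
proof -
  have "sqrt t \<le> 1 + t"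
    using assms by (intro real_le_lsqrt) (auto simp: power2_eq_square algebra_simps)
  then have "t * sqrt t \<le> t * (1 + t)" using assms by (intro mult_left_mono) auto
  also have "\<dots> \<le> 128 * (1 + t / 8 + (t / 8)^2 / 2)"
    using assms by (simp add: power2_eq_square algebra_simps)
  also have "\<dots> \<le> 128 * exp (t / 8)"
    using exp_lower_Taylor_quadratic[of "t / 8"] assms by simp
  finally have "t * sqrt t * exp (- t / 4) \<le> 128 * exp (t / 8) * exp (- t / 4)"
    by (rule mult_right_mono) simp
  also have "\<dots> = 128 * exp (- t / 8)" by (simp flip: exp_add)
  finally show ?thesis .
qed

section \<open>Convolution powers, lower bound and tail of the tree weights\<close>

context tree_counts
begin

sublocale renewal p
  using p_nonneg p_0 p_1 p_sums p_mean by unfold_locales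

lemma g_power_eq:
  assumes "i \<ge> 1" shows "(Abs_fps g ^ i) $ n = (\<Sum>m=i..n. tree_power i $ m * exp (- real m) * conv m n)"
  unfolding g_power[OF assms] conv_def
  by (rule sum.mono_neutral_right) (auto simp: tree_power_def)

text \<open>In terms of \<open>t = i\<^sup>2 / m\<close> the bound of
  \<open>tree_power_exp_le\<close> is \<open>1 / i\<^sup>2\<close> times a function of
  \<open>t\<close> alone. This is estimated uniformly in \<open>m \<le> n\<close>, and what remains
  of the mixture is at most \<open>u n \<le> 1\<close>.\<close>

lemma g_power_le:
  assumes i: "i \<ge> 1" and n: "n \<ge> 1"
  shows "(Abs_fps g ^ i) $ n \<le> 256 / real i ^ 2 * exp (- (real i ^ 2) / (8 * real n))"
proof -
  define B where "B = 256 / real i ^ 2 * exp (- (real i ^ 2) / (8 * real n))"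
  have "(Abs_fps g ^ i) $ n = (\<Sum>m=i..n. tree_power i $ m * exp (- real m) * conv m n)"
    by (rule g_power_eq[OF i])
  also have "\<dots> \<le> (\<Sum>m=i..n. B * conv m n)"
  proof (intro sum_mono mult_right_mono conv_nonneg)
    fix m assume m: "m \<in> {i..n}"
    define t where "t = real i ^ 2 / real m"
    have m0: "real m > 0" using m i by auto
    have t: "t \<ge> 0" by (simp add: t_def)
    have "sqrt t = real i / sqrt (real m)" using i by (simp add: t_def real_sqrt_divide)
    then have e: "real i / (real m * sqrt (real m)) = t * sqrt t / real i ^ 2"
      using m0 i by (simp add: t_def power2_eq_square)
    have "tree_power i $ m * exp (- real m)
        \<le> 2 * real i / (real m * sqrt (real m)) * exp (- ((real i)^2) / (4 * real m))"
      using m i by (intro tree_power_exp_le) auto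
    also have "\<dots> = 2 * (real i / (real m * sqrt (real m))) * exp (- t / 4)"
      by (simp add: t_def)
    also have "\<dots> = 2 / real i ^ 2 * (t * sqrt t * exp (- t / 4))"
      unfolding e by simp
    also have "\<dots> \<le> 2 / real i ^ 2 * (128 * exp (- t / 8))"
      by (intro mult_left_mono sqrt_cube_exp_le t) auto
    also have "\<dots> \<le> 2 / real i ^ 2 * (128 * exp (- (real i ^ 2) / (8 * real n)))"
    proof -
      have "real i ^ 2 / (8 * real n) \<le> real i ^ 2 / (8 * real m)"
        using m m0 by (intro divide_left_mono) auto
      then show ?thesis by (intro mult_left_mono) (auto simp: t_def)
    qed
    finally show "tree_power i $ m * exp (- real m) \<le> B" by (simp add: B_def)
  qed
  also have "\<dots> = B * (\<Sum>m=i..n. conv m n)" by (simp add: sum_distrib_left)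
  also have "\<dots> \<le> B * 1"
  proof (rule mult_left_mono)
    have "(\<Sum>m=i..n. conv m n) \<le> u n" unfolding u_def by (intro sum_mono2) (auto simp: conv_nonneg)
    then show "(\<Sum>m=i..n. conv m n) \<le> 1" using u_le[of n] by simp
  qed (simp add: B_def)
  finally show ?thesis by (simp add: B_def)
qed

lemma g_eq: "g n = (\<Sum>m=1..n. tree_power 1 $ m * exp (- real m) * conv m n)"
  using g_power_eq[of 1 n] by simp

text \<open>The weight of each \<open>m \<le> n\<close> is at least a constant times
  \<open>n powr (-3/2)\<close>, and the mixture over \<open>m\<close> has total mass
  \<open>u n\<close>, which is bounded below.\<close>

lemma g_lower: "\<exists>c>0. \<forall>n\<ge>1. c / (real n * sqrt (real n)) \<le> g n"
proof -
  obtain c where c: "c > 0" "\<And>n. c \<le> u n" using u_lower by auto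
  have "exp (-1) * c / (real n * sqrt (real n)) \<le> g n" if n: "n \<ge> 1" for n
  proof -
    have "exp (-1) * c / (real n * sqrt (real n)) \<le> exp (-1) / (real n * sqrt (real n)) * u n"
      using c(2)[of n] n by (simp add: divide_right_mono)
    also have "u n = (\<Sum>m=1..n. conv m n)"
    proof -
      have "conv 0 n = 0" using n by (simp add: conv_def)
      then show ?thesis unfolding u_def by (subst sum.atLeast_Suc_atMost) auto
    qed
    also have "exp (-1) / (real n * sqrt (real n)) * (\<Sum>m=1..n. conv m n)
        \<le> (\<Sum>m=1..n. tree_power 1 $ m * exp (- real m) * conv m n)"
      unfolding sum_distrib_left
    proof (intro sum_mono mult_right_mono conv_nonneg)
      fix m assume m: "m \<in> {1..n}"
      have "exp (-1) / (real n * sqrt (real n)) \<le> exp (-1) / (real m * sqrt (real m))"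
        using m by (intro divide_left_mono mult_mono) auto
      also have "\<dots> \<le> tree_power 1 $ m * exp (- real m)"
        using m by (intro tree_power_one_exp_ge) auto
      finally show "exp (-1) / (real n * sqrt (real n)) \<le> tree_power 1 $ m * exp (- real m)" .
    qed
    finally show ?thesis unfolding g_eq .
  qed
  then show ?thesis using c(1) by (intro exI[of _ "exp (-1) * c"]) auto
qed

text \<open>The number \<open>m\<close> of steps is split at \<open>N\<close>. For
  \<open>m \<le> N\<close>, exceeding \<open>N\<close> has probability at most
  \<open>m \<mu> / N\<close> by Markov; for \<open>m > N\<close> the weights of order
  \<open>m powr (-3/2)\<close> are summed. Either part is of order
  \<open>1 / sqrt N\<close>.\<close>

lemma g_tail: "\<exists>C>0. \<forall>N\<ge>1. \<forall>M. (\<Sum>n=Suc N..M. g n) \<le> C / sqrt (real N)"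
proof -
  define C where "C = 4 * \<mu> + 4"
  have "(\<Sum>n=Suc N..M. g n) \<le> C / sqrt (real N)" if N: "N \<ge> 1" for N M
  proof (cases "N \<le> M")
    case True
    have w: "tree_power 1 $ m * exp (- real m) \<le> 2 / (real m * sqrt (real m))" if "m \<ge> 1" for m
    proof -
      have "tree_power 1 $ m * exp (- real m)
        \<le> 2 * real 1 / (real m * sqrt (real m)) * exp (- ((real 1)^2) / (4 * real m))"
        using that by (intro tree_power_exp_le) auto
      also have "\<dots> \<le> 2 * real 1 / (real m * sqrt (real m)) * 1" by (intro mult_left_mono) auto
      finally show ?thesis by simp
    qed
    have "(\<Sum>n=Suc N..M. g n) = (\<Sum>n=Suc N..M. \<Sum>m=1..M. tree_power 1 $ m * exp (- real m) * conv m n)"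
    proof (rule sum.cong)
      fix n assume n: "n \<in> {Suc N..M}"
      show "g n = (\<Sum>m=1..M. tree_power 1 $ m * exp (- real m) * conv m n)"
        unfolding g_eq by (rule sum.mono_neutral_left) (use n in \<open>auto simp: conv_below\<close>)
    qed simp
    also have "\<dots> = (\<Sum>m=1..M. tree_power 1 $ m * exp (- real m) * (\<Sum>n=Suc N..M. conv m n))"
      unfolding sum_distrib_left by (rule sum.swap)
    also have "\<dots> = (\<Sum>m=1..N. tree_power 1 $ m * exp (- real m) * (\<Sum>n=Suc N..M. conv m n))
       + (\<Sum>m=Suc N..M. tree_power 1 $ m * exp (- real m) * (\<Sum>n=Suc N..M. conv m n))"
    proof -
      have "{1..M} = {1..N} \<union> {Suc N..M}" using True N by auto
      then show ?thesis by (simp only: sum.union_disjoint[of "{1..N}" "{Suc N..M}"] finite_atLeastAtMost) (subst sum.union_disjoint; auto)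
    qed
    also have "\<dots> \<le> (\<Sum>m=1..N. 2 * \<mu> / real N * (1 / sqrt (real m))) + (\<Sum>m=Suc N..M. 2 * (1 / (real m * sqrt (real m))))"
    proof (intro add_mono sum_mono)
      fix m assume m: "m \<in> {1..N}"
      have "tree_power 1 $ m * exp (- real m) * (\<Sum>n=Suc N..M. conv m n)
         \<le> 2 / (real m * sqrt (real m)) * (real m * \<mu> / real N)"
        using m N by (intro mult_mono w sum_conv_tail_le sum_nonneg conv_nonneg) auto
      also have "\<dots> = 2 * \<mu> / real N * (1 / sqrt (real m))" using m by simp
      finally show "tree_power 1 $ m * exp (- real m) * (\<Sum>n=Suc N..M. conv m n)
         \<le> 2 * \<mu> / real N * (1 / sqrt (real m))" .
    next
      fix m assume m: "m \<in> {Suc N..M}"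
      have "tree_power 1 $ m * exp (- real m) * (\<Sum>n=Suc N..M. conv m n)
         \<le> 2 / (real m * sqrt (real m)) * 1"
        using m N by (intro mult_mono w sum_conv_le sum_nonneg conv_nonneg) auto
      then show "tree_power 1 $ m * exp (- real m) * (\<Sum>n=Suc N..M. conv m n)
         \<le> 2 * (1 / (real m * sqrt (real m)))" by simp
    qed
    also have "\<dots> = 2 * \<mu> / real N * (\<Sum>m=1..N. 1 / sqrt (real m)) + 2 * (\<Sum>m=Suc N..M. 1 / (real m * sqrt (real m)))"
      by (simp only: sum_distrib_left)
    also have "\<dots> \<le> 2 * \<mu> / real N * (2 * sqrt (real N)) + 2 * (2 / sqrt (real N))"
    proof (intro add_mono mult_left_mono sum_inverse_sqrt_le)
      have "(\<Sum>m=Suc N..M. 1 / (real m * sqrt (real m))) \<le> 2 / sqrt (real N) - 2 / sqrt (real M)"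
        by (rule sum_tail_three_halves_le[OF N True])
      moreover have "2 / sqrt (real M) \<ge> 0" by simp
      ultimately show "(\<Sum>m=Suc N..M. 1 / (real m * sqrt (real m))) \<le> 2 / sqrt (real N)" by linarith
    qed (use mu_nonneg in auto)
    also have "2 * \<mu> / real N * (2 * sqrt (real N)) = 4 * \<mu> / sqrt (real N)"
      using N by (simp add: field_simps)
    finally show ?thesis by (simp add: C_def add_divide_distrib)
  next
    case False
    then show ?thesis using mu_nonneg by (simp add: C_def)
  qed
  then show ?thesis using mu_nonneg by (intro exI[of _ C]) (auto simp: C_def)
qed

end

section \<open>Heights\<close>

lemma sum_inverse_square_le:
  assumes "2 \<le> a"
  shows "(\<Sum>m=a..M. 1 / real m ^ 2) \<le> 2 / real a"
proof (cases "a \<le> M")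
  case True
  have "(\<Sum>m=a..M. 1 / real m ^ 2) \<le> 1 / (real a - 1) - 1 / real M"
    using True
  proof (induction M rule: dec_induct)
    case base
    then show ?case using assms by (simp add: divide_simps power2_eq_square)
  next
    case (step M)
    have M: "real M > 0" using step assms by simp
    have "1 / real (Suc M) ^ 2 \<le> 1 / (real M * real (Suc M))"
      using M by (intro divide_left_mono) (auto simp: power2_eq_square)
    also have "\<dots> = 1 / real M - 1 / real (Suc M)" using M by (simp add: field_simps)
    finally show ?case using step by simp
  qed
  also have "\<dots> \<le> 1 / (real a - 1)" by simp
  also have "\<dots> \<le> 2 / real a" using assms by (simp add: divide_simps) 
  finally show ?thesis .
qed simp

text \<open>\<open>e H n\<close> is the mass of the trees with \<open>n\<close> nodes and height
  exactly \<open>H\<close>, scaled such that \<open>g n\<close> bounds its sum over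
  \<open>H\<close>. In \<open>e_step\<close> a branch of height \<open>H\<close> is split off and
  the rest of the tree is charged to \<open>g\<close>.\<close>

locale height_profile =
  fixes g :: "nat \<Rightarrow> real" and e :: "nat \<Rightarrow> nat \<Rightarrow> real" and C0 C1 :: real
  assumes g_nonneg: "\<And>n. g n \<ge> 0" and g_0: "g 0 = 0"
    and g_power_le: "\<And>i n. i \<ge> 1 \<Longrightarrow> n \<ge> 1 \<Longrightarrow>
        (Abs_fps g ^ i) $ n \<le> C0 / real i ^ 2 * exp (- (real i ^ 2) / (8 * real n))"
    and g_tail: "\<And>N M. N \<ge> 1 \<Longrightarrow> (\<Sum>n=Suc N..M. g n) \<le> C1 / sqrt (real N)"
    and e_nonneg: "\<And>H n. e H n \<ge> 0"
    and e_sum_le: "\<And>n A. finite A \<Longrightarrow> (\<Sum>H\<in>A. e H n) \<le> g n"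
    and e_zero: "\<And>H n. n \<le> H \<Longrightarrow> e H n = 0"
    and e_step: "\<And>H n. e (Suc H) n \<le> (\<Sum>j=0..n. g j * e H (n - j))"
    and C0: "C0 > 0" and C1: "C1 > 0"
begin

definition gp :: "nat \<Rightarrow> nat \<Rightarrow> real" where "gp i n = (Abs_fps g ^ i) $ n"

lemma gp_nonneg: "gp i n \<ge> 0"
  unfolding gp_def by (rule fps_power_nonneg) (simp add: g_nonneg)

lemma gp_0: "i \<ge> 1 \<Longrightarrow> gp i 0 = 0"
  unfolding gp_def by (rule fps_power_nth_below) (simp_all add: g_0)

text \<open>Descending \<open>i\<close> levels along a longest path leaves \<open>i\<close> trees
  beside the path, hence the convolution power \<open>gp i\<close>.\<close>

lemma e_iter: "e (H + i) n \<le> (\<Sum>j=0..n. gp i j * e H (n - j))"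
proof -
  have "e (H + i) n \<le> (Abs_fps g ^ i * Abs_fps (e H)) $ n" for n
  proof (induction i arbitrary: n)
    case (Suc i)
    have "e (H + Suc i) n \<le> (\<Sum>j=0..n. g j * e (H + i) (n - j))" using e_step by simp
    also have "\<dots> \<le> (\<Sum>j=0..n. g j * (Abs_fps g ^ i * Abs_fps (e H)) $ (n - j))"
      by (intro sum_mono mult_left_mono Suc g_nonneg)
    also have "\<dots> = (Abs_fps g * (Abs_fps g ^ i * Abs_fps (e H))) $ n"
      by (simp add: fps_mult_nth)
    finally show ?case by (simp add: mult.assoc)
  qed simp
  then show ?thesis by (simp add: fps_mult_nth gp_def)
qed

definition tall_mass :: "nat \<Rightarrow> nat \<Rightarrow> real" where "tall_mass H n = (\<Sum>H'=H..n. e H' n)"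

lemma tall_mass_nonneg: "tall_mass H n \<ge> 0" unfolding tall_mass_def by (intro sum_nonneg e_nonneg)

lemma tall_mass_le: "tall_mass H n \<le> g n" unfolding tall_mass_def by (rule e_sum_le) simp

lemma tall_mass_antimono: "H \<le> H' \<Longrightarrow> tall_mass H' n \<le> tall_mass H n"
  unfolding tall_mass_def by (intro sum_mono2) (auto simp: e_nonneg)

lemma sum_e_le_tall_mass: "finite A \<Longrightarrow> (\<And>H'. H' \<in> A \<Longrightarrow> H \<le> H') \<Longrightarrow> (\<Sum>H'\<in>A. e H' n) \<le> tall_mass H n"
proof -
  assume A: "finite A" "\<And>H'. H' \<in> A \<Longrightarrow> H \<le> H'"
  have "(\<Sum>H'\<in>A. e H' n) = (\<Sum>H'\<in>A \<inter> {H..n}. e H' n)"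
    using A by (intro sum.mono_neutral_right) (auto intro!: e_zero simp: not_le)
  also have "\<dots> \<le> tall_mass H n" unfolding tall_mass_def by (intro sum_mono2) (auto simp: e_nonneg)
  finally show ?thesis .
qed

lemma tall_mass_iter: "tall_mass (H + i) n \<le> (\<Sum>j=0..n. gp i j * tall_mass H (n - j))"
proof -
  have "tall_mass (H + i) n = (\<Sum>H'\<in>{H + i..n}. e (H' - i + i) n)"
    unfolding tall_mass_def by (rule sum.cong) auto
  also have "\<dots> \<le> (\<Sum>H'\<in>{H + i..n}. \<Sum>j=0..n. gp i j * e (H' - i) (n - j))"
    by (intro sum_mono e_iter)
  also have "\<dots> = (\<Sum>j=0..n. gp i j * (\<Sum>H'\<in>{H + i..n}. e (H' - i) (n - j)))"
    unfolding sum_distrib_left by (rule sum.swap)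
  also have "\<dots> \<le> (\<Sum>j=0..n. gp i j * tall_mass H (n - j))"
  proof (intro sum_mono mult_left_mono gp_nonneg)
    fix j
    have "(\<Sum>H'\<in>{H + i..n}. e (H' - i) (n - j)) = (\<Sum>H'\<in>(\<lambda>x. x - i) ` {H + i..n}. e H' (n - j))"
      by (subst sum.reindex) (auto simp: inj_on_def)
    also have "\<dots> \<le> tall_mass H (n - j)" by (rule sum_e_le_tall_mass) auto
    finally show "(\<Sum>H'\<in>{H + i..n}. e (H' - i) (n - j)) \<le> tall_mass H (n - j)" .
  qed
  finally show ?thesis .
qed

lemma sum_tall_mass_le_const: "(\<Sum>n=0..M. tall_mass H n) \<le> g 1 + C1"
proof -
  have "(\<Sum>n=0..M. tall_mass H n) \<le> (\<Sum>n=0..M. g n)" by (intro sum_mono tall_mass_le)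
  also have "\<dots> \<le> (\<Sum>n\<in>{0,1} \<union> {Suc 1..M}. g n)" by (intro sum_mono2) (auto simp: g_nonneg)
  also have "\<dots> = g 1 + (\<Sum>n=Suc 1..M. g n)" by (subst sum.union_disjoint) (auto simp: g_0)
  also have "\<dots> \<le> g 1 + C1" using g_tail[of 1 M] by simp
  finally show ?thesis .
qed

text \<open>
  A tree of height \<open>2 i\<close> contains one of height \<open>i\<close> at depth \<open>i\<close>, and a spine of length \<open>i\<close> rarely
  carries fewer than \<open>i\<^sup>2 / K\<close> nodes. Hence the claim for \<open>i\<close> yields the claim for \<open>2 i\<close> with a
  contraction factor, up to the mass of all trees with more than \<open>i\<^sup>2 / K\<close> nodes.
\<close>

lemma sum_tall_mass_le: "\<exists>D>0. \<forall>H\<ge>1. \<forall>M. (\<Sum>n=0..M. tall_mass H n) \<le> D / real H"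
proof -
  \<comment> \<open>With \<open>N \<le> i\<^sup>2 / K\<close> the spine contributes a factor of at
    most \<open>N C0 / i\<^sup>2 \<le> 1/6\<close>. As \<open>H \<le> 3 i\<close>, the target
    \<open>D / H\<close> is at least \<open>D / (3 i)\<close>, so another \<open>D / (6 i)\<close>
    remains for the trees with more than \<open>N\<close> nodes.\<close>
  obtain K :: nat where K: "real K \<ge> 6 * C0" "K \<ge> 1"
  proof -
    obtain K0 :: nat where "6 * C0 \<le> real K0" using real_arch_simple by blast
    then show ?thesis using that[of "Suc K0"] by simp
  qed
  define G where "G = g 1 + C1"
  \<comment> \<open>The first summand settles the case \<open>i\<^sup>2 < K\<close>, where
    \<open>H \<le> 2 K\<close>; the second one makes the tail \<open>C1 / sqrt N\<close> at most
    \<open>D / (6 i)\<close>.\<close>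
  define D where "D = 2 * real K * G + 6 * C1 * sqrt (2 * real K)"
  have G: "G > 0" using g_nonneg[of 1] C1 by (simp add: G_def)
  have D: "D > 0" "D \<ge> 2 * real K * G" "D \<ge> 6 * C1 * sqrt (2 * real K)"
    using G C1 K by (auto simp: D_def add_pos_nonneg)
  have "\<forall>M. (\<Sum>n=0..M. tall_mass H n) \<le> D / real H" if "H \<ge> 1" for H
    using that
  proof (induction H rule: less_induct)
    case (less H)
    define i where "i = H div 2"
    show ?case
    proof (cases "i ^ 2 < K")
      case True
      have "i \<le> i ^ 2" by (simp add: power2_eq_square)
      with True have "H \<le> 2 * K" by (auto simp: i_def)
      then have "G * real H \<le> G * (2 * real K)" using G by (intro mult_left_mono) auto
      then have "G \<le> D / real H" using D less.prems by (simp add: field_simps)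
      then show ?thesis using sum_tall_mass_le_const[of H] unfolding G_def by (meson order_trans)
    next
      case False
      then have i1: "i \<ge> 1" using K by (cases "i = 0") auto
      then have iH: "i < H" "real H \<le> 3 * real i" unfolding i_def by linarith+
      define N where "N = i ^ 2 div K"
      have NK: "N * K \<le> i ^ 2" by (simp add: N_def)
      have N1: "N \<ge> 1" using False K by (simp add: N_def div_greater_zero_iff Suc_le_eq)
      have "i ^ 2 < K * (N + 1)" unfolding N_def using K
        by (metis Suc_eq_plus1 dividend_less_times_div mult.commute not_less_eq_eq One_nat_def not_one_le_zero mult_Suc_right add.commute less_eq_Suc_le)
      also have "K * (N + 1) \<le> K * (2 * N)" using N1 by (intro mult_left_mono) auto
      finally have "real (i ^ 2) \<le> real (K * (2 * N))" by (simp only: of_nat_le_iff)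
      then have sq: "real i \<le> sqrt (2 * real K) * sqrt (real N)"
        by (subst real_sqrt_mult [symmetric], intro real_le_rsqrt) (simp add: mult_ac)
      show ?thesis
      proof
        fix M
        have "(\<Sum>n=0..M. tall_mass H n) \<le> (\<Sum>n\<in>{0..N} \<union> {Suc N..M}. tall_mass H n)"
          by (intro sum_mono2) (auto simp: tall_mass_nonneg)
        also have "\<dots> = (\<Sum>n=0..N. tall_mass H n) + (\<Sum>n=Suc N..M. tall_mass H n)"
          by (subst sum.union_disjoint) auto
        also have "(\<Sum>n=Suc N..M. tall_mass H n) \<le> C1 / sqrt (real N)"
          by (rule order_trans[OF sum_mono[OF tall_mass_le] g_tail[OF N1]])
        also have "C1 / sqrt (real N) \<le> C1 * sqrt (2 * real K) / real i"
          using sq N1 i1 C1 by (simp add: field_simps) 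
        also have "(\<Sum>n=0..N. tall_mass H n) \<le> (\<Sum>n=0..N. \<Sum>j=0..n. gp i j * tall_mass i (n - j))"
        proof (rule sum_mono)
          fix n
          have "tall_mass H n = tall_mass (H - i + i) n" using iH by simp
          also have "\<dots> \<le> (\<Sum>j=0..n. gp i j * tall_mass (H - i) (n - j))" by (rule tall_mass_iter)
          also have "\<dots> \<le> (\<Sum>j=0..n. gp i j * tall_mass i (n - j))"
            by (intro sum_mono mult_left_mono gp_nonneg tall_mass_antimono) (auto simp: i_def)
          finally show "tall_mass H n \<le> (\<Sum>j=0..n. gp i j * tall_mass i (n - j))" .
        qed
        also have "\<dots> = (\<Sum>(n,j)\<in>(SIGMA n:{0..N}. {0..n}). gp i j * tall_mass i (n - j))"
          by (rule sum.Sigma) auto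
        also have "\<dots> = (\<Sum>(j,m)\<in>(\<lambda>(n,j). (j, n - j)) ` (SIGMA n:{0..N}. {0..n}). gp i j * tall_mass i m)"
          by (subst sum.reindex) (auto simp: inj_on_def case_prod_unfold)
        also have "\<dots> \<le> (\<Sum>(j,m)\<in>{0..N} \<times> {0..N}. gp i j * tall_mass i m)"
          by (intro sum_mono2) (auto simp: gp_nonneg tall_mass_nonneg)
        also have "\<dots> = (\<Sum>j=0..N. gp i j) * (\<Sum>m=0..N. tall_mass i m)"
          by (simp add: sum_product sum.cartesian_product)
        also have "\<dots> \<le> (real N * (C0 / real i ^ 2)) * (D / real i)"
        proof (intro mult_mono)
          have "(\<Sum>j=0..N. gp i j) = (\<Sum>j=1..N. gp i j)"
            by (subst sum.atLeast_Suc_atMost) (auto simp: gp_0[OF i1])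
          also have "\<dots> \<le> (\<Sum>j=1..N. C0 / real i ^ 2)"
          proof (rule sum_mono)
            fix j assume "j \<in> {1..N}"
            then have "gp i j \<le> C0 / real i ^ 2 * exp (- (real i ^ 2) / (8 * real j))"
              unfolding gp_def using i1 by (intro g_power_le) auto
            also have "\<dots> \<le> C0 / real i ^ 2 * 1" using C0 by (intro mult_left_mono) auto
            finally show "gp i j \<le> C0 / real i ^ 2" by simp
          qed
          finally show "(\<Sum>j=0..N. gp i j) \<le> real N * (C0 / real i ^ 2)" by simp
          show "(\<Sum>m=0..N. tall_mass i m) \<le> D / real i" using less.IH[OF iH(1) i1] by simp
        qed (use C0 D in \<open>auto intro!: sum_nonneg tall_mass_nonneg\<close>)
        also have "\<dots> \<le> D / (6 * real i)"
        proof -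
          have "real N * (6 * C0) \<le> real N * real K" using K by (intro mult_left_mono) auto
          also have "\<dots> \<le> real i ^ 2" using NK by (metis of_nat_le_iff of_nat_mult of_nat_power)
          finally have "real N * (C0 / real i ^ 2) \<le> 1 / 6" using i1 by (simp add: field_simps)
          then have "real N * (C0 / real i ^ 2) * (D / real i) \<le> 1 / 6 * (D / real i)"
            using D by (intro mult_right_mono) auto
          then show ?thesis by simp
        qed
        finally have "(\<Sum>n=0..M. tall_mass H n) \<le> D / (6 * real i) + C1 * sqrt (2 * real K) / real i" by simp
        also have "\<dots> = (D / 6 + C1 * sqrt (2 * real K)) / real i" using i1 by (simp add: add_divide_distrib)
        also have "\<dots> \<le> (D / 3) / real i"
          using D i1 by (intro divide_right_mono) auto
        also have "\<dots> = D / (3 * real i)" by simp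
        also have "\<dots> \<le> D / real H" using iH D i1 less.prems by (intro divide_left_mono) auto
        finally show "(\<Sum>n=0..M. tall_mass H n) \<le> D / real H" .
      qed
    qed
  qed
  then show ?thesis using D by blast
qed

text \<open>
  Averaging the bound of \<open>e_iter\<close> over a range of \<open>i\<close> proportional to \<open>H\<close> replaces the profile at one
  height by its sum over many heights.
\<close>

lemma e_le: "\<exists>C>0. \<forall>H\<ge>4. \<forall>n. e H n \<le> C / real H ^ 4 * exp (- (real H ^ 2) / (392 * real n))"
proof -
  obtain D where D: "D > 0" "\<And>H M. H \<ge> 1 \<Longrightarrow> (\<Sum>n=0..M. tall_mass H n) \<le> D / real H"
    using sum_tall_mass_le by blast
  define C where "C = C0 * D * 7 ^ 4 / 2"
  have "e H n \<le> C / real H ^ 4 * exp (- (real H ^ 2) / (392 * real n))" if H: "H \<ge> 4" for H n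
  proof (cases "n = 0")
    case True
    then show ?thesis using e_zero[of 0 H] C0 D by (simp add: C_def)
  next
    case False
    \<comment> \<open>For \<open>i\<close> in \<open>{r..<2*r}\<close> the heights
      \<open>H - i\<close> are distinct and at least \<open>2 r\<close>, so their masses add up to
      at most \<open>tall_mass (2 * r)\<close>. Of the four powers of \<open>r\<close> two come from
      \<open>g_power_le\<close>, one from averaging and one from \<open>D / (2 r)\<close>. The
      constant is \<open>392 = 8 * 7\<^sup>2\<close>, by \<open>H \<le> 7 r\<close>.\<close>
    define r where "r = H div 4"
    have "r \<ge> 1" "4 * r \<le> H" "H \<le> 7 * r" using H unfolding r_def by presburger+
    then have r: "r \<ge> 1" "4 * r \<le> H" "real H \<le> 7 * real r" by (simp_all flip: of_nat_mult)
    define B where "B = C0 / real r ^ 2 * exp (- (real r ^ 2) / (8 * real n))"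
    have B: "B \<ge> 0" using C0 by (simp add: B_def)
    have gpB: "gp i j \<le> B" if "r \<le> i" "j \<le> n" for i j
    proof (cases "j = 0")
      case True
      then show ?thesis using gp_0[of i] that r B by simp
    next
      case False
      have "real r ^ 2 \<le> real i ^ 2" using that by (intro power_mono) auto
      moreover have "real r ^ 2 / (8 * real n) \<le> real i ^ 2 / (8 * real j)"
        using that False by (intro frac_le power_mono) auto
      moreover have "gp i j \<le> C0 / real i ^ 2 * exp (- (real i ^ 2) / (8 * real j))"
        unfolding gp_def using r that False by (intro g_power_le) auto
      ultimately show ?thesis unfolding B_def using C0 r that
        by (elim order_trans) (intro mult_mono divide_left_mono, auto)
    qed
    have "real r * e H n = (\<Sum>i\<in>{r..<2*r}. e (H - i + i) n)"
      using r by simp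
    also have "\<dots> \<le> (\<Sum>i\<in>{r..<2*r}. \<Sum>j=0..n. gp i j * e (H - i) (n - j))"
      by (intro sum_mono e_iter)
    also have "\<dots> \<le> (\<Sum>i\<in>{r..<2*r}. \<Sum>j=0..n. B * e (H - i) (n - j))"
      by (intro sum_mono mult_right_mono gpB e_nonneg) auto
    also have "\<dots> = (\<Sum>j=0..n. B * (\<Sum>i\<in>{r..<2*r}. e (H - i) (n - j)))"
      unfolding sum_distrib_left by (rule sum.swap)
    also have "\<dots> \<le> (\<Sum>j=0..n. B * tall_mass (2 * r) (n - j))"
    proof (intro sum_mono mult_left_mono B)
      fix j
      have "(\<Sum>i\<in>{r..<2*r}. e (H - i) (n - j)) = (\<Sum>H'\<in>(\<lambda>i. H - i) ` {r..<2*r}. e H' (n - j))"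
        using r by (subst sum.reindex) (auto simp: inj_on_def)
      also have "\<dots> \<le> tall_mass (2 * r) (n - j)" by (rule sum_e_le_tall_mass) (use r in auto)
      finally show "(\<Sum>i\<in>{r..<2*r}. e (H - i) (n - j)) \<le> tall_mass (2 * r) (n - j)" .
    qed
    also have "\<dots> = B * (\<Sum>m=0..n. tall_mass (2 * r) m)"
      unfolding sum_distrib_left by (rule sum.reindex_bij_witness[of _ "\<lambda>m. n - m" "\<lambda>m. n - m"]) auto
    also have "\<dots> \<le> B * (D / real (2 * r))"
      using r by (intro mult_left_mono B D) auto
    finally have "e H n \<le> C0 * D / 2 * (1 / real r ^ 4) * exp (- (real r ^ 2) / (8 * real n))"
      using r by (simp add: B_def field_simps power4_eq_xxxx power2_eq_square)
    also have "\<dots> \<le> C0 * D / 2 * (7 ^ 4 / real H ^ 4) * exp (- (real H ^ 2) / (392 * real n))"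
    proof (intro mult_mono mult_left_mono)
      have "real H ^ 4 \<le> (7 * real r) ^ 4" using r by (intro power_mono) auto
      then show "1 / real r ^ 4 \<le> 7 ^ 4 / real H ^ 4"
        using r H by (simp add: field_simps power_mult_distrib)
      have "real H ^ 2 \<le> (7 * real r) ^ 2" using r by (intro power_mono) auto
      then have "real H ^ 2 / (392 * real n) \<le> (49 * real r ^ 2) / (392 * real n)"
        by (intro divide_right_mono) (auto simp: power_mult_distrib)
      then show "exp (- (real r ^ 2) / (8 * real n)) \<le> exp (- (real H ^ 2) / (392 * real n))" by simp
    qed (use C0 D in auto)
    finally show ?thesis by (simp add: C_def)
  qed
  moreover have "C > 0" using C0 D by (simp add: C_def)
  ultimately show ?thesis by blast
qed

text \<open>Two branches contribute \<open>1 / H ^ 8\<close>. Of this, \<open>1 / H0 ^ 6\<close> is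
  taken out and \<open>1 / H\<^sup>2\<close> is summed over \<open>H \<ge> H0\<close>; the free size
  \<open>a\<close> costs a factor of order \<open>n\<close>, and the sum over \<open>b\<close> is
  absorbed by the total mass of \<open>R\<close>. There remains \<open>n / H0 ^ 7\<close>, at most
  \<open>n powr (-5/2)\<close> since \<open>n \<le> H0\<^sup>2\<close>.\<close>

lemma two_high_branches:
  fixes R :: "nat \<Rightarrow> real"
  assumes R: "\<And>n. R n \<ge> 0" and R0: "\<And>M. (\<Sum>n=0..M. R n) \<le> R0"
  shows "\<exists>C>0. \<forall>n\<ge>1. \<forall>H0\<ge>6. n \<le> H0 ^ 2 \<longrightarrow>
    (\<Sum>H=H0..n. \<Sum>a=0..n. \<Sum>b=0..n-a. e (H - 1) a * (e (H - 1) b + e (H - 2) b) * R (n - a - b))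
      \<le> C / (real n ^ 2 * sqrt (real n)) * exp (- (real H0 ^ 2) / (784 * real n))"
proof -
  obtain C where C: "C > 0" "\<And>H n. H \<ge> 4 \<Longrightarrow> e H n \<le> C / real H ^ 4 * exp (- (real H ^ 2) / (392 * real n))"
    using e_le by blast
  have R0nn: "R0 \<ge> 0" using R0[of 0] R[of 0] by simp
  define C' where "C' = 2 * 256 * C ^ 2 * 2 * (R0 + 1) * 2"
  have "(\<Sum>H=H0..n. \<Sum>a=0..n. \<Sum>b=0..n-a. e (H - 1) a * (e (H - 1) b + e (H - 2) b) * R (n - a - b))
      \<le> C' / (real n ^ 2 * sqrt (real n)) * exp (- (real H0 ^ 2) / (784 * real n))"
    if n: "n \<ge> 1" and H0: "H0 \<ge> 6" and nH: "n \<le> H0 ^ 2" for n H0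
  proof -
    define X where "X = exp (- (real H0 ^ 2) / (784 * real n))"
    have main: "(\<Sum>a=0..n. \<Sum>b=0..n-a. e (H - 1) a * (e (H - 1) b + e (H - 2) b) * R (n - a - b))
        \<le> 2 * 256 * C ^ 2 * X * (2 * real n * R0) / real H0 ^ 6 * (1 / real H ^ 2)" if H: "H \<in> {H0..n}" for H
    proof -
      \<comment> \<open>Because \<open>H \<ge> 6\<close>, both branches have height at least
        \<open>H - 2 \<ge> H / 2\<close>; hence \<open>16 = 2 ^ 4\<close> and
        \<open>1568 = 4 * 392\<close>. Squaring \<open>U\<close> then yields 784.\<close>
      define U where "U = 16 * C / real H ^ 4 * exp (- (real H ^ 2) / (1568 * real n))"
      have U: "U \<ge> 0" using C by (simp add: U_def)
      have eU: "e H' b \<le> U" if H': "H - 2 \<le> H'" and b: "b \<le> n" for H' b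
      proof (cases "b = 0")
        case True
        then show ?thesis using e_zero[of 0 H'] U by simp
      next
        case False
        have h: "real H \<le> 2 * real H'" "H' \<ge> 4" using H H0 H' by auto
        have "e H' b \<le> C / real H' ^ 4 * exp (- (real H' ^ 2) / (392 * real b))"
          by (rule C(2)) (use h in auto)
        also have "\<dots> \<le> (16 * C / real H ^ 4) * exp (- (real H ^ 2) / (1568 * real n))"
        proof (rule mult_mono)
          have "real H ^ 4 \<le> (2 * real H') ^ 4" using h by (intro power_mono) auto
          then have "C * real H ^ 4 \<le> C * (16 * real H' ^ 4)" using C by (intro mult_left_mono) (auto simp: power_mult_distrib)
          then show "C / real H' ^ 4 \<le> 16 * C / real H ^ 4"
            using h H H0 by (simp add: field_simps)
          have "real H ^ 2 \<le> (2 * real H') ^ 2" using h by (intro power_mono) auto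
          then have "real H ^ 2 / (1568 * real n) \<le> (4 * real H' ^ 2) / (1568 * real b)"
            using b False by (intro frac_le) (auto simp: power_mult_distrib)
          then show "exp (- (real H' ^ 2) / (392 * real b)) \<le> exp (- (real H ^ 2) / (1568 * real n))" by simp
        qed (use C in auto)
        finally show ?thesis by (simp add: U_def)
      qed
      have U2: "U ^ 2 \<le> 256 * C ^ 2 * X / real H0 ^ 6 * (1 / real H ^ 2)"
      proof -
        have "U ^ 2 = 256 * C ^ 2 * exp (- (real H ^ 2) / (784 * real n)) * (1 / real H ^ 6 * (1 / real H ^ 2))"
        proof -
          have 1: "exp (- (real H ^ 2) / (1568 * real n)) ^ 2 = exp (- (real H ^ 2) / (784 * real n))"
            by (simp flip: exp_of_nat_mult)
          have 2: "(16 * C / real H ^ 4) ^ 2 = 256 * C ^ 2 * (1 / real H ^ 6 * (1 / real H ^ 2))"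
            by (simp add: power_divide power_mult_distrib flip: power_add power_mult)
          show ?thesis unfolding U_def power_mult_distrib[of "16 * C / real H ^ 4"] 1 2 by simp
        qed
        also have "\<dots> \<le> 256 * C ^ 2 * X * (1 / real H0 ^ 6 * (1 / real H ^ 2))"
        proof (intro mult_mono mult_left_mono)
          have "real H0 ^ 2 / (784 * real n) \<le> real H ^ 2 / (784 * real n)"
            using H by (intro divide_right_mono power_mono) auto
          then show "exp (- (real H ^ 2) / (784 * real n)) \<le> X" by (simp add: X_def)
          show "1 / real H ^ 6 \<le> 1 / real H0 ^ 6"
            using H H0 by (intro divide_left_mono power_mono) auto
        qed (auto simp: X_def)
        finally show ?thesis by simp
      qed
      have "(\<Sum>a=0..n. \<Sum>b=0..n-a. e (H - 1) a * (e (H - 1) b + e (H - 2) b) * R (n - a - b))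
          \<le> (\<Sum>a=0..n. \<Sum>b=0..n-a. U * (U + U) * R (n - a - b))"
        by (intro sum_mono mult_right_mono mult_mono add_mono eU R U) (auto intro!: add_nonneg_nonneg e_nonneg)
      also have "\<dots> = (\<Sum>a=0..n. U * (U + U) * (\<Sum>b=0..n-a. R (n - a - b)))"
        by (simp only: sum_distrib_left)
      also have "\<dots> \<le> (\<Sum>a=0..n. U * (U + U) * R0)"
      proof (intro sum_mono mult_left_mono)
        fix a
        have "(\<Sum>b=0..n-a. R (n - a - b)) = (\<Sum>b=0..n-a. R b)"
          by (rule sum.reindex_bij_witness[of _ "\<lambda>m. n - a - m" "\<lambda>m. n - a - m"]) auto
        then show "(\<Sum>b=0..n-a. R (n - a - b)) \<le> R0" using R0 by simp
      qed (use U in auto)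
      also have "\<dots> = 2 * U ^ 2 * (real n + 1) * R0" by (simp add: power2_eq_square algebra_simps)
      also have "\<dots> \<le> 2 * U ^ 2 * (2 * real n) * R0"
        using n R0nn by (intro mult_right_mono mult_left_mono) auto
      also have "\<dots> \<le> 2 * (256 * C ^ 2 * X / real H0 ^ 6 * (1 / real H ^ 2)) * (2 * real n) * R0"
        using R0nn by (intro mult_right_mono mult_left_mono U2) auto
      finally show ?thesis by (simp add: mult_ac)
    qed
    have "(\<Sum>H=H0..n. \<Sum>a=0..n. \<Sum>b=0..n-a. e (H - 1) a * (e (H - 1) b + e (H - 2) b) * R (n - a - b))
       \<le> (\<Sum>H=H0..n. 2 * 256 * C ^ 2 * X * (2 * real n * R0) / real H0 ^ 6 * (1 / real H ^ 2))"
      by (intro sum_mono main)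
    also have "\<dots> = 2 * 256 * C ^ 2 * X * (2 * real n * R0) / real H0 ^ 6 * (\<Sum>H=H0..n. 1 / real H ^ 2)"
      by (rule sum_distrib_left [symmetric])
    also have "\<dots> \<le> 2 * 256 * C ^ 2 * X * (2 * real n * R0) / real H0 ^ 6 * (2 / real H0)"
      using H0 R0nn by (intro mult_left_mono sum_inverse_square_le) (auto simp: X_def)
    also have "\<dots> = 2 * 256 * C ^ 2 * X * 2 * R0 * 2 * (real n / real H0 ^ 7)"
      using H0 by (simp add: field_simps eval_nat_numeral)
    also have "\<dots> \<le> 2 * 256 * C ^ 2 * X * 2 * R0 * 2 * (1 / (real n ^ 2 * sqrt (real n)))"
    proof (intro mult_left_mono)
      have "real n \<le> real H0 ^ 2" using nH by (metis of_nat_le_iff of_nat_power)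
      then have "sqrt (real n) \<le> real H0" by (intro real_le_lsqrt) auto
      then have "sqrt (real n) ^ 7 \<le> real H0 ^ 7" by (intro power_mono) auto
      moreover have "sqrt (real n) ^ 7 = real n ^ 3 * sqrt (real n)"
      proof -
        have x7: "x ^ 7 = (x ^ 2) ^ 3 * x" for x :: real by (simp add: eval_nat_numeral)
        have "sqrt (real n) ^ 2 = real n" by simp
        then show ?thesis unfolding x7[of "sqrt (real n)"] by (rule arg_cong)
      qed
      ultimately have "real n / real H0 ^ 7 \<le> real n / (real n ^ 3 * sqrt (real n))"
        using n H0 by (intro divide_left_mono) auto
      also have "\<dots> = 1 / (real n ^ 2 * sqrt (real n))" using n by (simp add: eval_nat_numeral)
      finally show "real n / real H0 ^ 7 \<le> 1 / (real n ^ 2 * sqrt (real n))" .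
    qed (use R0nn in \<open>auto simp: X_def\<close>)
    also have "\<dots> = (2 * 256 * C ^ 2 * 2 * R0 * 2) * (X * (1 / (real n ^ 2 * sqrt (real n))))" by simp
    also have "\<dots> \<le> C' * (X * (1 / (real n ^ 2 * sqrt (real n))))"
      by (intro mult_right_mono) (auto simp: C'_def X_def mult_left_mono)
    finally show ?thesis by (simp add: X_def mult_ac)
  qed
  moreover have "C' > 0" using C R0nn by (simp add: C'_def)
  ultimately show ?thesis by blast
qed

end

section \<open>Counting coloured trees\<close>

lemma sum_mset_eq_sum_count:
  fixes f :: "'a \<Rightarrow> nat"
  assumes "finite B" "set_mset N \<subseteq> B"
  shows "(\<Sum>a\<in>#N. f a) = (\<Sum>a\<in>B. f a * count N a)"
  using assms(2)
proof (induction N)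
  case (add x N)
  have "(\<Sum>a\<in>B. f a * count (add_mset x N) a) = (\<Sum>a\<in>B. f a * count N a + (if a = x then f a else 0))"
    by (rule sum.cong) auto
  also have "\<dots> = (\<Sum>a\<in>B. f a * count N a) + f x"
    using add.prems assms(1) by (simp add: sum.distrib)
  finally show ?case using add by simp
qed simp

section \<open>The Euler transform for multisets of weighted objects\<close>

definition multisets_of :: "'a set \<Rightarrow> ('a \<Rightarrow> nat) \<Rightarrow> nat \<Rightarrow> 'a multiset set" where
  "multisets_of A w n = {N. set_mset N \<subseteq> A \<and> (\<Sum>a\<in>#N. w a) = n}"

locale weighted_set =
  fixes A :: "'a set" and w :: "'a \<Rightarrow> nat"
  assumes w_pos: "\<And>a. a \<in> A \<Longrightarrow> w a \<ge> 1" and fin: "\<And>d. finite {a \<in> A. w a = d}"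
begin

lemma finite_upto: "finite {a \<in> A. w a \<le> n}"
proof -
  have "{a \<in> A. w a \<le> n} = (\<Union>d\<in>{..n}. {a \<in> A. w a = d})" by auto
  then show ?thesis using fin by auto
qed

lemma size_le: "set_mset N \<subseteq> A \<Longrightarrow> size N \<le> (\<Sum>a\<in>#N. w a)"
proof (induction N)
  case (add x N)
  then show ?case using w_pos[of x] by simp
qed simp

lemma weight_le: "N \<in> multisets_of A w n \<Longrightarrow> a \<in># N \<Longrightarrow> a \<in> A \<and> w a \<le> n"
  unfolding multisets_of_def by (auto dest!: multi_member_split)

lemma finite_multisets_of: "finite (multisets_of A w n)"
proof (rule finite_subset)
  show "multisets_of A w n \<subseteq> mset ` {xs. set xs \<subseteq> {a \<in> A. w a \<le> n} \<and> length xs \<le> n}"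
  proof
    fix N assume N: "N \<in> multisets_of A w n"
    obtain xs where xs: "mset xs = N" using ex_mset by blast
    have "set xs \<subseteq> {a \<in> A. w a \<le> n}" using weight_le[OF N] xs by auto
    moreover have "length xs \<le> n" using size_le[of N] N xs by (auto simp: multisets_of_def)
    ultimately show "N \<in> mset ` {xs. set xs \<subseteq> {a \<in> A. w a \<le> n} \<and> length xs \<le> n}" using xs by auto
  qed
  show "finite (mset ` {xs. set xs \<subseteq> {a \<in> A. w a \<le> n} \<and> length xs \<le> n})"
    using finite_lists_length_le[OF finite_upto] by blast
qed

text \<open>Removing \<open>i\<close> copies of \<open>a\<close> is a bijection onto the multisets
  of the remaining weight.\<close>

lemma card_multisets_of_count_ge:
  assumes a: "a \<in> A"
  shows "card {N \<in> multisets_of A w n. i \<le> count N a}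
    = (if i * w a \<le> n then card (multisets_of A w (n - i * w a)) else 0)"
proof (cases "i * w a \<le> n")
  case True
  have "bij_betw (\<lambda>N. N + replicate_mset i a) (multisets_of A w (n - i * w a))
          {N \<in> multisets_of A w n. i \<le> count N a}"
  proof (rule bij_betw_byWitness[where f' = "\<lambda>N. N - replicate_mset i a"])
    show "(\<lambda>N. N + replicate_mset i a) ` multisets_of A w (n - i * w a) \<subseteq> {N \<in> multisets_of A w n. i \<le> count N a}"
      using a True by (auto simp: multisets_of_def subset_iff split: if_splits)
    have *: "N = N - replicate_mset i a + replicate_mset i a" if "i \<le> count N a" for N
      using that by (simp add: count_le_replicate_mset_subset_eq)
    show "\<forall>N\<in>{N \<in> multisets_of A w n. i \<le> count N a}. N - replicate_mset i a + replicate_mset i a = N"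
      using * by auto
    show "(\<lambda>N. N - replicate_mset i a) ` {N \<in> multisets_of A w n. i \<le> count N a} \<subseteq> multisets_of A w (n - i * w a)"
    proof
      fix N' assume "N' \<in> (\<lambda>N. N - replicate_mset i a) ` {N \<in> multisets_of A w n. i \<le> count N a}"
      then obtain N where N: "N \<in> multisets_of A w n" "i \<le> count N a" "N' = N - replicate_mset i a" by blast
      then have "N = N' + replicate_mset i a" using * by simp
      then show "N' \<in> multisets_of A w (n - i * w a)" using N(1) by (auto simp: multisets_of_def)
    qed
  qed auto
  then show ?thesis using True bij_betw_same_card by fastforce
next
  case False
  have "{N \<in> multisets_of A w n. i \<le> count N a} = {}"
  proof (rule ccontr)
    assume "\<not> ?thesis"
    then obtain N where N: "N \<in> multisets_of A w n" "i \<le> count N a" by blast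
    then have "N = N - replicate_mset i a + replicate_mset i a"
      by (simp add: count_le_replicate_mset_subset_eq)
    then have "(\<Sum>a\<in>#N. w a) = (\<Sum>a\<in>#N - replicate_mset i a. w a) + i * w a"
      by (metis image_mset_union image_replicate_mset sum_mset.union sum_mset_replicate_mset of_nat_id)
    then show False using N False by (simp add: multisets_of_def)
  qed
  then show ?thesis by (simp only: False if_False card.empty)
qed

lemma sum_divisor_weights:
  assumes "1 \<le> j" "j \<le> n"
  shows "(\<Sum>a\<in>{a \<in> A. w a \<le> n}. \<Sum>i=1..n. if i * w a = j then w a else 0)
    = (\<Sum>d | d dvd j. d * card {a \<in> A. w a = d})"
proof -
  have "(\<Sum>i=1..n. if i * w a = j then w a else 0) = (if w a dvd j then w a else 0)" if "a \<in> A" for a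
  proof (cases "w a dvd j")
    case True
    then obtain q where q: "j = w a * q" by (auto elim: dvdE)
    have "q \<le> w a * q" using w_pos[OF that] by (cases "w a") auto
    then have q1: "q \<in> {1..n}" using q assms by (cases q) auto
    have "(\<Sum>i=1..n. if i * w a = j then w a else 0) = (\<Sum>i=1..n. if i = q then w a else 0)"
      using q w_pos[OF that] by (intro sum.cong) auto
    then show ?thesis using True q1 by simp
  next
    case False
    then have "i * w a \<noteq> j" for i by auto
    then show ?thesis using False by simp
  qed
  then have "(\<Sum>a\<in>{a \<in> A. w a \<le> n}. \<Sum>i=1..n. if i * w a = j then w a else 0)
      = (\<Sum>a\<in>{a \<in> A. w a \<le> n}. if w a dvd j then w a else 0)" by (intro sum.cong) auto
  also have "\<dots> = (\<Sum>a\<in>{a \<in> A. w a dvd j}. w a)"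
  proof (rule sum.mono_neutral_cong_right)
    show "{a \<in> A. w a dvd j} \<subseteq> {a \<in> A. w a \<le> n}"
      using assms by (auto dest!: dvd_imp_le)
  qed (use finite_upto in auto)
  also have "\<dots> = (\<Sum>d\<in>{d. d dvd j}. \<Sum>a\<in>{a \<in> {a \<in> A. w a dvd j}. w a = d}. w a)"
  proof (rule sum.group [symmetric])
    have "{a \<in> A. w a dvd j} \<subseteq> {a \<in> A. w a \<le> n}"
      using assms by (auto dest!: dvd_imp_le)
    then show "finite {a \<in> A. w a dvd j}" using finite_upto finite_subset by blast
    show "finite {d. d dvd j}" using assms by simp
  qed auto
  also have "\<dots> = (\<Sum>d | d dvd j. d * card {a \<in> A. w a = d})"
  proof (rule sum.cong)
    fix d assume "d \<in> {d. d dvd j}"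
    then have "{a \<in> {a \<in> A. w a dvd j}. w a = d} = {a \<in> A. w a = d}" by auto
    then show "(\<Sum>a\<in>{a \<in> {a \<in> A. w a dvd j}. w a = d}. w a) = d * card {a \<in> A. w a = d}" by simp
  qed simp
  finally show ?thesis .
qed

text \<open>A combinatorial logarithmic derivative of the Euler product: the weight \<open>n\<close>
  is spread over the elements, the multiplicity of \<open>a\<close> is written as the number of
  \<open>i \<ge> 1\<close> with \<open>i \<le> count N a\<close>, and terms are collected by
  \<open>j = i * w a\<close>.\<close>

lemma multisets_of_recurrence:
  "n * card (multisets_of A w n)
    = (\<Sum>j=1..n. (\<Sum>d | d dvd j. d * card {a \<in> A. w a = d}) * card (multisets_of A w (n - j)))"
proof -
  define B where "B = {a \<in> A. w a \<le> n}"
  have fB: "finite B" unfolding B_def by (rule finite_upto)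
  have "n * card (multisets_of A w n) = (\<Sum>N\<in>multisets_of A w n. n)" by simp
  also have "\<dots> = (\<Sum>N\<in>multisets_of A w n. \<Sum>a\<in>B. \<Sum>i=1..n. if i \<le> count N a then w a else 0)"
  proof (rule sum.cong)
    fix N assume N: "N \<in> multisets_of A w n"
    have sub: "set_mset N \<subseteq> B" using weight_le[OF N] by (auto simp: B_def)
    have "n = (\<Sum>a\<in>B. w a * count N a)"
      using sum_mset_eq_sum_count[OF fB sub, of w] N by (simp add: multisets_of_def)
    also have "\<dots> = (\<Sum>a\<in>B. \<Sum>i=1..n. if i \<le> count N a then w a else 0)"
    proof (rule sum.cong)
      fix a assume "a \<in> B"
      have "count N a \<le> n"
        using count_le_size[of N a] size_le[of N] N by (auto simp: multisets_of_def)
      have "(\<Sum>i=1..n. if i \<le> count N a then w a else 0) = (\<Sum>i\<in>{1..count N a}. w a)"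
        using \<open>count N a \<le> n\<close> by (intro sum.mono_neutral_cong_right) auto
      then show "w a * count N a = (\<Sum>i=1..n. if i \<le> count N a then w a else 0)" by simp
    qed simp
    finally show "n = (\<Sum>a\<in>B. \<Sum>i=1..n. if i \<le> count N a then w a else 0)" .
  qed simp
  also have "\<dots> = (\<Sum>a\<in>B. \<Sum>N\<in>multisets_of A w n. \<Sum>i=1..n. if i \<le> count N a then w a else 0)"
    by (rule sum.swap)
  also have "\<dots> = (\<Sum>a\<in>B. \<Sum>i=1..n. \<Sum>N\<in>multisets_of A w n. if i \<le> count N a then w a else 0)"
    by (intro sum.cong refl sum.swap)
  also have "\<dots> = (\<Sum>a\<in>B. \<Sum>i=1..n. \<Sum>j=1..n. (if i * w a = j then w a else 0) * card (multisets_of A w (n - j)))"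
  proof (intro sum.cong refl)
    fix a i assume a: "a \<in> B" and i: "i \<in> {1..n}"
    have "(\<Sum>N\<in>multisets_of A w n. if i \<le> count N a then w a else 0)
        = (\<Sum>N\<in>{N \<in> multisets_of A w n. i \<le> count N a}. w a)"
      using finite_multisets_of by (intro sum.mono_neutral_cong_right) auto
    also have "\<dots> = w a * card {N \<in> multisets_of A w n. i \<le> count N a}" by simp
    also have "\<dots> = (\<Sum>j=1..n. if j = i * w a then w a * card (multisets_of A w (n - j)) else 0)"
    proof -
      have "a \<in> A" using a by (simp add: B_def)
      moreover have "i * w a \<ge> 1" using w_pos[OF \<open>a \<in> A\<close>] i by (cases "i * w a") auto
      ultimately show ?thesis unfolding card_multisets_of_count_ge[OF \<open>a \<in> A\<close>] by simp
    qed
    also have "\<dots> = (\<Sum>j=1..n. (if i * w a = j then w a else 0) * card (multisets_of A w (n - j)))"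
      by (intro sum.cong) auto
    finally show "(\<Sum>N\<in>multisets_of A w n. if i \<le> count N a then w a else 0)
       = (\<Sum>j=1..n. (if i * w a = j then w a else 0) * card (multisets_of A w (n - j)))" .
  qed
  also have "\<dots> = (\<Sum>a\<in>B. \<Sum>j=1..n. \<Sum>i=1..n. (if i * w a = j then w a else 0) * card (multisets_of A w (n - j)))"
    by (intro sum.cong refl sum.swap)
  also have "\<dots> = (\<Sum>j=1..n. \<Sum>a\<in>B. \<Sum>i=1..n. (if i * w a = j then w a else 0) * card (multisets_of A w (n - j)))"
    by (rule sum.swap)
  also have "\<dots> = (\<Sum>j=1..n. (\<Sum>d | d dvd j. d * card {a \<in> A. w a = d}) * card (multisets_of A w (n - j)))"
  proof (rule sum.cong)
    fix j assume "j \<in> {1..n}"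
    then show "(\<Sum>a\<in>B. \<Sum>i=1..n. (if i * w a = j then w a else 0) * card (multisets_of A w (n - j)))
       = (\<Sum>d | d dvd j. d * card {a \<in> A. w a = d}) * card (multisets_of A w (n - j))"
      using sum_divisor_weights[of j n] unfolding B_def sum_distrib_right [symmetric] by simp
  qed simp
  finally show ?thesis .
qed

lemma multisets_of_0: "multisets_of A w 0 = {{#}}"
proof -
  have "N = {#}" if "N \<in> multisets_of A w 0" for N
  proof -
    have "size N \<le> (\<Sum>a\<in>#N. w a)" "(\<Sum>a\<in>#N. w a) = 0"
      using that size_le[of N] by (auto simp: multisets_of_def)
    then have "size N = 0" by linarith
    then show ?thesis by simp
  qed
  then show ?thesis by (auto simp: multisets_of_def)
qed

end

text \<open>
  A node represents a hedron and carries the colour of the vertex that this hedron does not share with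
  its parent. The root hedron gets the colour \<open>k + 1\<close>, which no vertex has.
\<close>

datatype tree = Node (col: nat) (sub: "tree multiset")

primrec nodes :: "tree \<Rightarrow> nat" where
  "nodes (Node j N) = Suc (\<Sum>\<^sub># (image_mset nodes N))"

primrec height :: "tree \<Rightarrow> nat" where
  "height (Node j N) = (if N = {#} then 0 else Suc (Max (set_mset (image_mset height N))))"

primrec proper :: "nat \<Rightarrow> tree \<Rightarrow> bool" where
  "proper k (Node j N) \<longleftrightarrow> (\<forall>b\<in>#image_mset (proper k) N. b) \<and> (\<forall>s\<in>#N. col s \<le> k \<and> col s \<noteq> j)"

lemma proper_Node: "proper k (Node j N) \<longleftrightarrow> (\<forall>s\<in>#N. proper k s \<and> col s \<le> k \<and> col s \<noteq> j)"
  by auto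

declare proper.simps [simp del] proper_Node [simp]

lemma nodes_pos: "nodes t \<ge> 1" by (cases t) simp

lemma height_ge: "s \<in># N \<Longrightarrow> Suc (height s) \<le> height (Node j N)"
  by auto

lemma height_Suc: "height (Node j N) = Suc H \<Longrightarrow> \<exists>s\<in>#N. height s = H"
proof -
  assume "height (Node j N) = Suc H"
  then have N: "N \<noteq> {#}" and H: "H = Max (height ` set_mset N)" by (auto split: if_splits)
  have "H \<in> height ` set_mset N" unfolding H using N by (intro Max_in) auto
  then show ?thesis by auto
qed

lemma height_less_nodes: "height t < nodes t"
proof (induction t)
  case (Node j N)
  show ?case
  proof (cases "N = {#}")
    case False
    then obtain s where s: "s \<in># N" "height (Node j N) = Suc (height s)"
      using height_Suc[of j N] by fastforce
    then obtain N' where "N = add_mset s N'" by (meson multi_member_split)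
    then show ?thesis using s Node[of s] by simp
  qed simp
qed

section \<open>Trees by number of nodes and root colour\<close>

definition trees :: "nat \<Rightarrow> nat \<Rightarrow> nat \<Rightarrow> tree set" where
  "trees k c n = {t. proper k t \<and> col t = c \<and> nodes t = n}"

definition branches :: "nat \<Rightarrow> nat \<Rightarrow> tree set" where
  "branches k c = {t. proper k t \<and> col t \<le> k \<and> col t \<noteq> c}"

lemma trees_eq: "trees k c (Suc n) = Node c ` multisets_of (branches k c) nodes n"
proof (intro equalityI subsetI)
  fix t assume t: "t \<in> trees k c (Suc n)"
  then show "t \<in> Node c ` multisets_of (branches k c) nodes n"
    by (cases t) (auto simp: trees_def multisets_of_def branches_def)
qed (auto simp: trees_def multisets_of_def branches_def)

lemma trees_0: "trees k c 0 = {}"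
proof -
  have "nodes t \<noteq> 0" for t using nodes_pos[of t] by simp
  then show ?thesis by (auto simp: trees_def)
qed

lemma branches_level: "{t \<in> branches k c. nodes t = d} = (\<Union>c'\<in>{..k} - {c}. trees k c' d)"
  by (auto simp: branches_def trees_def)

lemma finite_trees: "finite (trees k c n)"
proof (induction n arbitrary: c rule: less_induct)
  case (less n)
  show ?case
  proof (cases n)
    case 0
    then show ?thesis by (simp add: trees_0)
  next
    case (Suc m)
    \<comment> \<open>The induction hypothesis provides finite levels only up to \<open>m\<close>,
      so the set of branches is truncated first. Larger branches cannot occur in a tree with
      \<open>Suc m\<close> nodes.\<close>
    define A where "A = {t \<in> branches k c. nodes t \<le> m}"
    interpret A: weighted_set A nodes
    proof
      show "1 \<le> nodes a" for a by (rule nodes_pos)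
      show "finite {a \<in> A. nodes a = d}" for d
      proof (cases "d \<le> m")
        case True
        have "{a \<in> A. nodes a = d} \<subseteq> (\<Union>c'\<in>{..k} - {c}. trees k c' d)"
          unfolding branches_level [symmetric] by (auto simp: A_def)
        moreover have "finite (\<Union>c'\<in>{..k} - {c}. trees k c' d)" using less[of d] True Suc by auto
        ultimately show ?thesis by (rule finite_subset)
      next
        case False
        then have e: "{a \<in> A. nodes a = d} = {}" by (auto simp: A_def)
        show ?thesis by (subst e) simp
      qed
    qed
    have "multisets_of (branches k c) nodes m \<subseteq> multisets_of A nodes m"
      unfolding multisets_of_def A_def by (auto dest!: multi_member_split)
    then have "finite (multisets_of (branches k c) nodes m)"
      using A.finite_multisets_of finite_subset by blast
    then show ?thesis using Suc trees_eq by simp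
  qed
qed

interpretation branches: weighted_set "branches k c" nodes for k c
proof
  show "1 \<le> nodes a" for a by (rule nodes_pos)
  show "finite {a \<in> branches k c. nodes a = d}" for d
    unfolding branches_level using finite_trees by auto
qed

lemma card_trees_Suc: "card (trees k c (Suc n)) = card (multisets_of (branches k c) nodes n)"
  unfolding trees_eq by (rule card_image) (auto simp: inj_on_def)

lemma card_branches_level: "card {t \<in> branches k c. nodes t = d} = (\<Sum>c'\<in>{..k} - {c}. card (trees k c' d))"
  unfolding branches_level by (rule card_UN_disjoint) (auto simp: trees_def finite_trees[unfolded trees_def])

lemma card_trees_1: "card (trees k c 1) = 1"
  using card_trees_Suc[of k c 0] by (simp add: branches.multisets_of_0)

lemma card_trees_recurrence:
  "(n - 1) * card (trees k c n) = (\<Sum>j=1..n-1. (\<Sum>d | d dvd j. d * (\<Sum>c'\<in>{..k} - {c}. card (trees k c' d)))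
      * card (trees k c (n - j)))"
proof (cases n)
  case (Suc m)
  have "(n - 1) * card (trees k c n) = m * card (multisets_of (branches k c) nodes m)"
    using Suc by (simp add: card_trees_Suc)
  also have "\<dots> = (\<Sum>j=1..m. (\<Sum>d | d dvd j. d * (\<Sum>c'\<in>{..k} - {c}. card (trees k c' d)))
      * card (multisets_of (branches k c) nodes (m - j)))"
    unfolding branches.multisets_of_recurrence card_branches_level by simp
  also have "\<dots> = (\<Sum>j=1..m. (\<Sum>d | d dvd j. d * (\<Sum>c'\<in>{..k} - {c}. card (trees k c' d)))
      * card (trees k c (n - j)))"
  proof (rule sum.cong)
    fix j assume "j \<in> {1..m}"
    then have "n - j = Suc (m - j)" using Suc by auto
    then show "(\<Sum>d | d dvd j. d * (\<Sum>c'\<in>{..k} - {c}. card (trees k c' d))) * card (multisets_of (branches k c) nodes (m - j))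
      = (\<Sum>d | d dvd j. d * (\<Sum>c'\<in>{..k} - {c}. card (trees k c' d))) * card (trees k c (n - j))"
      by (simp add: card_trees_Suc)
  qed simp
  finally show ?thesis using Suc by simp
qed (simp add: trees_0)

text \<open>The recurrence relates the root colour only to smaller trees, so the symmetry of the
  colours follows by induction on the size.\<close>

lemma card_trees_colour: "c \<le> k \<Longrightarrow> card (trees k c n) = card (trees k 0 n)"
proof (induction n arbitrary: c rule: less_induct)
  case (less n)
  have eq: "(n - 1) * card (trees k c n) = (\<Sum>j=1..n-1. (\<Sum>d | d dvd j. d * (k * card (trees k 0 d)))
      * card (trees k 0 (n - j)))" if c: "c \<le> k" for c
    unfolding card_trees_recurrence
  proof (intro sum.cong refl arg_cong2[where f = "(*)"])
    fix j assume j: "j \<in> {1..n-1}"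
    show "card (trees k c (n - j)) = card (trees k 0 (n - j))" by (rule less.IH) (use c j in auto)
    fix d assume "d \<in> {d. d dvd j}"
    then have "d < n" using j dvd_imp_le[of d j] by auto
    then have "(\<Sum>c'\<in>{..k} - {c}. card (trees k c' d)) = (\<Sum>c'\<in>{..k} - {c}. card (trees k 0 d))"
      by (intro sum.cong refl less.IH) (use \<open>d < n\<close> in auto)
    also have "\<dots> = k * card (trees k 0 d)" using c by simp
    finally show "(\<Sum>c'\<in>{..k} - {c}. card (trees k c' d)) = k * card (trees k 0 d)" .
  qed
  show ?case
  proof (cases "n \<le> 1")
    case True
    then have "n = 0 \<or> n = 1" by auto
    then show ?thesis using card_trees_1[of k c] card_trees_1[of k 0] by (auto simp: trees_0)
  next
    case False
    then have "n - 1 \<noteq> 0" by simp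
    moreover have "(n - 1) * card (trees k c n) = (n - 1) * card (trees k 0 n)"
      using eq[OF less.prems] eq[of 0] by simp
    ultimately show ?thesis by (metis mult_cancel1)
  qed
qed

lemma card_trees_rec:
  assumes "c \<le> k"
  shows "(n - 1) * card (trees k c n) = (\<Sum>j=1..n-1. k * (\<Sum>d | d dvd j. d * card (trees k 0 d)) * card (trees k c (n - j)))"
  unfolding card_trees_recurrence
proof (intro sum.cong refl arg_cong2[where f = "(*)"])
  fix j
  have "(\<Sum>c'\<in>{..k} - {c}. card (trees k c' d)) = k * card (trees k 0 d)" for d
  proof -
    have "(\<Sum>c'\<in>{..k} - {c}. card (trees k c' d)) = (\<Sum>c'\<in>{..k} - {c}. card (trees k 0 d))"
      by (intro sum.cong card_trees_colour) auto
    then show ?thesis using assms by simp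
  qed
  then show "(\<Sum>d | d dvd j. d * (\<Sum>c'\<in>{..k} - {c}. card (trees k c' d))) = k * (\<Sum>d | d dvd j. d * card (trees k 0 d))"
    by (simp add: sum_distrib_left mult.left_commute)
qed

text \<open>A tree is recovered from one child with \<open>P\<close> and the tree left after its
  removal. Several children may qualify, hence an inequality.\<close>

lemma card_trees_split_le:
  assumes S: "S \<subseteq> trees k c n" and P: "\<And>t. t \<in> S \<Longrightarrow> \<exists>s\<in>#sub t. P s"
  shows "card S \<le> (\<Sum>m=0..n. card {s \<in> branches k c. P s \<and> nodes s = m} * card (trees k c (n - m)))"
proof -
  define B where "B m = {s \<in> branches k c. P s \<and> nodes s = m}" for m
  have fB: "finite (B m)" for m
    using branches.fin[of k c m] by (rule finite_subset[rotated]) (auto simp: B_def)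
  have "S \<subseteq> (\<Union>m\<in>{0..n}. (\<lambda>(s, t'). Node c (add_mset s (sub t'))) ` (B m \<times> trees k c (n - m)))"
  proof
    fix t assume t: "t \<in> S"
    then obtain N where N: "t = Node c N" using S by (cases t) (auto simp: trees_def)
    obtain s where s: "s \<in># N" "P s" using P[OF t] N by auto
    then obtain N' where N': "N = add_mset s N'" by (meson multi_member_split)
    have t': "t \<in> trees k c n" using t S by auto
    have "s \<in> B (nodes s)" using t' s N by (auto simp: B_def branches_def trees_def)
    moreover have "Node c N' \<in> trees k c (n - nodes s)"
      using t' N N' by (auto simp: trees_def)
    moreover have "nodes s \<le> n" using t' N N' by (auto simp: trees_def)
    ultimately show "t \<in> (\<Union>m\<in>{0..n}. (\<lambda>(s, t'). Node c (add_mset s (sub t'))) ` (B m \<times> trees k c (n - m)))"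
      using N N' by (intro UN_I[of "nodes s"] image_eqI[of _ _ "(s, Node c N')"]) auto
  qed
  then have "card S \<le> card (\<Union>m\<in>{0..n}. (\<lambda>(s, t'). Node c (add_mset s (sub t'))) ` (B m \<times> trees k c (n - m)))"
    by (intro card_mono) (auto intro!: fB finite_trees)
  also have "\<dots> \<le> (\<Sum>m=0..n. card ((\<lambda>(s, t'). Node c (add_mset s (sub t'))) ` (B m \<times> trees k c (n - m))))"
    by (rule card_UN_le) simp
  also have "\<dots> \<le> (\<Sum>m=0..n. card (B m) * card (trees k c (n - m)))"
    by (intro sum_mono order_trans[OF card_image_le]) (auto intro!: fB finite_trees simp: card_cartesian_product)
  finally show ?thesis by (simp add: B_def)
qed

lemma card_branches_colour:
  assumes "c \<le> k"
  shows "card {t \<in> branches k c. nodes t = d} = k * card (trees k 0 d)"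
proof -
  have "(\<Sum>c'\<in>{..k} - {c}. card (trees k c' d)) = (\<Sum>c'\<in>{..k} - {c}. card (trees k 0 d))"
    by (intro sum.cong card_trees_colour) auto
  then show ?thesis using assms by (simp add: card_branches_level)
qed

lemma card_trees_le_convolution:
  assumes n: "n \<ge> 2"
  shows "card (trees k 0 n) \<le> k * (\<Sum>m=1..n-1. card (trees k 0 m) * card (trees k 0 (n - m)))"
proof -
  have "card (trees k 0 n) \<le> (\<Sum>m=0..n. card {s \<in> branches k 0. True \<and> nodes s = m} * card (trees k 0 (n - m)))"
  proof (rule card_trees_split_le)
    fix t assume "t \<in> trees k 0 n"
    then have "sub t \<noteq> {#}" using n by (cases t) (auto simp: trees_def)
    then show "\<exists>s\<in>#sub t. True" by auto
  qed simp
  also have "\<dots> = (\<Sum>m=0..n. k * (card (trees k 0 m) * card (trees k 0 (n - m))))"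
    by (simp add: card_branches_colour mult.assoc)
  also have "\<dots> = (\<Sum>m=1..n-1. k * (card (trees k 0 m) * card (trees k 0 (n - m))))"
  proof (rule sum.mono_neutral_right)
    show "\<forall>i\<in>{0..n} - {1..n-1}. k * (card (trees k 0 i) * card (trees k 0 (n - i))) = 0"
    proof
      fix i assume "i \<in> {0..n} - {1..n-1}"
      then have "i = 0 \<or> i = n" by auto
      then show "k * (card (trees k 0 i) * card (trees k 0 (n - i))) = 0" by (auto simp: trees_0)
    qed
  qed auto
  finally show ?thesis by (simp add: sum_distrib_left)
qed

lemma tree_counts_trees: "k \<ge> 1 \<Longrightarrow> tree_counts k (\<lambda>n. card (trees k 0 n))"
  using card_trees_le_convolution[of _ k] card_trees_rec[of 0 k] card_trees_1[of k 0]
  by unfold_locales (auto simp: trees_0)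

section \<open>Trees of prescribed height\<close>

definition tall_trees :: "nat \<Rightarrow> nat \<Rightarrow> nat \<Rightarrow> tree set" where
  "tall_trees k H n = {t. proper k t \<and> col t \<le> k \<and> nodes t = n \<and> height t = H}"

lemma tall_trees_subset: "tall_trees k H n \<subseteq> (\<Union>c\<le>k. trees k c n)"
  by (auto simp: tall_trees_def trees_def)

lemma finite_tall_trees: "finite (tall_trees k H n)"
  by (rule finite_subset[OF tall_trees_subset]) (simp add: finite_trees)

lemma sum_card_tall_trees_le:
  assumes "finite A"
  shows "(\<Sum>H\<in>A. card (tall_trees k H n)) \<le> (k + 1) * card (trees k 0 n)"
proof -
  have "(\<Sum>H\<in>A. card (tall_trees k H n)) = card (\<Union>H\<in>A. tall_trees k H n)"
    using assms by (intro card_UN_disjoint [symmetric]) (auto simp: finite_tall_trees, auto simp: tall_trees_def)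
  also have "\<dots> \<le> card (\<Union>c\<le>k. trees k c n)"
    by (intro card_mono UN_least tall_trees_subset) (simp add: finite_trees)
  also have "\<dots> \<le> (\<Sum>c\<le>k. card (trees k c n))" by (rule card_UN_le) simp
  also have "\<dots> = (\<Sum>c\<le>k. card (trees k 0 n))" by (intro sum.cong card_trees_colour) auto
  finally show ?thesis by simp
qed

lemma tall_trees_zero: "n \<le> H \<Longrightarrow> tall_trees k H n = {}"
  by (auto simp: tall_trees_def) (metis height_less_nodes not_le)

lemma card_tall_trees_step:
  "card (tall_trees k (Suc H) n) \<le> (\<Sum>j=0..n. k * card (trees k 0 j) * card (tall_trees k H (n - j)))"
proof -
  define S where "S c = {t \<in> trees k c n. height t = Suc H}" for c
  have "tall_trees k (Suc H) n \<subseteq> (\<Union>c\<le>k. S c)"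
    by (auto simp: tall_trees_def trees_def S_def)
  then have "card (tall_trees k (Suc H) n) \<le> card (\<Union>c\<le>k. S c)"
    by (intro card_mono) (auto simp: S_def finite_trees)
  also have "\<dots> \<le> (\<Sum>c\<le>k. card (S c))" by (rule card_UN_le) simp
  also have "\<dots> \<le> (\<Sum>c\<le>k. \<Sum>m=0..n. card {s \<in> branches k c. height s = H \<and> nodes s = m} * card (trees k 0 (n - m)))"
  proof (rule sum_mono)
    fix c assume c: "c \<in> {..k}"
    have "card (S c) \<le> (\<Sum>m=0..n. card {s \<in> branches k c. height s = H \<and> nodes s = m} * card (trees k c (n - m)))"
    proof (rule card_trees_split_le)
      fix t assume "t \<in> S c"
      then show "\<exists>s\<in>#sub t. height s = H" using height_Suc by (cases t) (auto simp: S_def)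
    qed (auto simp: S_def)
    then show "card (S c) \<le> (\<Sum>m=0..n. card {s \<in> branches k c. height s = H \<and> nodes s = m} * card (trees k 0 (n - m)))"
      using card_trees_colour[of c k] c by simp
  qed
  also have "\<dots> = (\<Sum>m=0..n. (\<Sum>c\<le>k. card {s \<in> branches k c. height s = H \<and> nodes s = m}) * card (trees k 0 (n - m)))"
    unfolding sum_distrib_right by (rule sum.swap)
  \<comment> \<open>Each branch fits below exactly the \<open>k\<close> root colours that differ
    from its own.\<close>
  also have "\<dots> = (\<Sum>m=0..n. (k * card (tall_trees k H m)) * card (trees k 0 (n - m)))"
  proof (intro sum.cong refl arg_cong2[where f = "(*)"])
    fix m
    have "card {s \<in> branches k c. height s = H \<and> nodes s = m}
        = (\<Sum>s\<in>tall_trees k H m. if col s \<noteq> c then 1 else 0)" for c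
    proof -
      have "{s \<in> branches k c. height s = H \<and> nodes s = m} = {s \<in> tall_trees k H m. col s \<noteq> c}"
        by (auto simp: branches_def tall_trees_def)
      then show ?thesis using finite_tall_trees by (simp add: sum.If_cases Int_def)
    qed
    then have "(\<Sum>c\<le>k. card {s \<in> branches k c. height s = H \<and> nodes s = m})
        = (\<Sum>c\<le>k. \<Sum>s\<in>tall_trees k H m. if col s \<noteq> c then 1 else 0)" by simp
    also have "\<dots> = (\<Sum>s\<in>tall_trees k H m. \<Sum>c\<le>k. if col s \<noteq> c then 1 else 0)" by (rule sum.swap)
    also have "\<dots> = (\<Sum>s\<in>tall_trees k H m. k)"
    proof (rule sum.cong)
      fix s assume "s \<in> tall_trees k H m"
      then have "col s \<le> k" by (simp add: tall_trees_def)
      have "(\<Sum>c\<le>k. if col s \<noteq> c then 1 else 0) = card ({..k} - {col s})"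
        by (simp add: sum.If_cases) (auto intro!: arg_cong[where f = card])
      then show "(\<Sum>c\<le>k. if col s \<noteq> c then 1 else 0) = k" using \<open>col s \<le> k\<close> by simp
    qed simp
    finally show "(\<Sum>c\<le>k. card {s \<in> branches k c. height s = H \<and> nodes s = m}) = k * card (tall_trees k H m)" by simp
  qed
  also have "\<dots> = (\<Sum>j=0..n. k * card (trees k 0 j) * card (tall_trees k H (n - j)))"
    by (rule sum.reindex_bij_witness[of _ "\<lambda>m. n - m" "\<lambda>m. n - m"]) auto
  finally show ?thesis .
qed

definition root_trees :: "nat \<Rightarrow> nat \<Rightarrow> tree set" where "root_trees k n = trees k (Suc k) n"

lemma card_root_trees_ge: "card (trees k 0 n) \<le> card (root_trees k n)"
proof (rule card_inj_on_le)
  show "inj_on (\<lambda>t. Node (Suc k) (sub t)) (trees k 0 n)"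
    by (auto simp: inj_on_def trees_def intro: tree.expand)
  show "(\<lambda>t. Node (Suc k) (sub t)) ` trees k 0 n \<subseteq> root_trees k n"
  proof safe
    fix t assume "t \<in> trees k 0 n"
    then show "Node (Suc k) (sub t) \<in> root_trees k n" by (cases t) (auto simp: trees_def root_trees_def)
  qed
qed (simp add: root_trees_def finite_trees)

text \<open>The branches at the root are split by whether their colour is 0. Those of other colours
  fit below a root of colour 0, those of colour 0 below a root of colour 1, which exists by
  \<open>k \<ge> 1\<close>. Two roots replace one, hence \<open>Suc n\<close>.\<close>

lemma card_root_trees_le:
  assumes k: "k \<ge> 1"
  shows "card (root_trees k n) \<le> (\<Sum>a=0..Suc n. card (trees k 0 a) * card (trees k 0 (Suc n - a)))"
proof -
  define U where "U = (\<Union>a\<in>{0..Suc n}. (\<lambda>(t, t'). Node (Suc k) (sub t + sub t')) ` (trees k 0 a \<times> trees k 1 (Suc n - a)))"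
  have "root_trees k n \<subseteq> U"
  proof
    fix t assume t: "t \<in> root_trees k n"
    then obtain N where N: "t = Node (Suc k) N" by (cases t) (auto simp: root_trees_def trees_def)
    define t1 where "t1 = Node 0 (filter_mset (\<lambda>s. col s \<noteq> 0) N)"
    define t2 where "t2 = Node 1 (filter_mset (\<lambda>s. \<not> col s \<noteq> 0) N)"
    have NN: "N = filter_mset (\<lambda>s. col s \<noteq> 0) N + filter_mset (\<lambda>s. \<not> col s \<noteq> 0) N"
      by (rule multiset_partition)
    have "(\<Sum>s\<in>#N. nodes s) = (\<Sum>s\<in>#filter_mset (\<lambda>s. col s \<noteq> 0) N. nodes s) + (\<Sum>s\<in>#filter_mset (\<lambda>s. \<not> col s \<noteq> 0) N. nodes s)"
      using arg_cong[OF NN, of "\<lambda>N. \<Sum>s\<in>#N. nodes s"]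
      by (simp only: image_mset_union sum_mset.union)
    then have n: "nodes t1 + nodes t2 = Suc n" using t N by (simp add: root_trees_def trees_def t1_def t2_def)
    moreover have "t1 \<in> trees k 0 (nodes t1)" "t2 \<in> trees k 1 (nodes t2)"
      using t N k by (auto simp: root_trees_def trees_def t1_def t2_def)
    moreover have "t = Node (Suc k) (sub t1 + sub t2)" using N NN by (simp add: t1_def t2_def)
    moreover have "nodes t2 = Suc n - nodes t1" using n by simp
    ultimately show "t \<in> U" unfolding U_def
      by (intro UN_I[of "nodes t1"] image_eqI[of _ _ "(t1, t2)"]) auto
  qed
  then have "card (root_trees k n) \<le> card U"
    by (intro card_mono) (auto simp: U_def finite_trees)
  also have "\<dots> \<le> (\<Sum>a=0..Suc n. card ((\<lambda>(t, t'). Node (Suc k) (sub t + sub t')) ` (trees k 0 a \<times> trees k 1 (Suc n - a))))"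
    unfolding U_def by (rule card_UN_le) simp
  also have "\<dots> \<le> (\<Sum>a=0..Suc n. card (trees k 0 a) * card (trees k 1 (Suc n - a)))"
    by (intro sum_mono order_trans[OF card_image_le]) (auto simp: finite_trees card_cartesian_product)
  also have "\<dots> = (\<Sum>a=0..Suc n. card (trees k 0 a) * card (trees k 0 (Suc n - a)))"
    using card_trees_colour[OF k] by simp
  finally show ?thesis .
qed

definition balanced_tall :: "nat \<Rightarrow> nat \<Rightarrow> nat \<Rightarrow> tree set" where
  "balanced_tall k n H0 = {t \<in> root_trees k n. \<exists>H\<ge>H0. \<exists>s s' N.
     sub t = add_mset s (add_mset s' N) \<and> height s = H - 1 \<and> (height s' = H - 1 \<or> height s' = H - 2)}"

lemma card_balanced_tall_le:
  "card (balanced_tall k n H0) \<le> (\<Sum>H=H0..n. \<Sum>a=0..n. \<Sum>b=0..n-a.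
      card (tall_trees k (H - 1) a) * (card (tall_trees k (H - 1) b) + card (tall_trees k (H - 2) b))
      * card (root_trees k (n - a - b)))"
proof -
  define f where "f = (\<lambda>(s, s', r). Node (Suc k) (add_mset s (add_mset s' (sub r))))"
  define Q where "Q H a b = tall_trees k (H - 1) a \<times> (tall_trees k (H - 1) b \<union> tall_trees k (H - 2) b)
      \<times> root_trees k (n - a - b)" for H a b
  have fin: "finite (root_trees k m)" for m by (simp add: root_trees_def finite_trees)
  have fQ: "finite (Q H a b)" for H a b unfolding Q_def by (intro finite_SigmaI finite_UnI finite_tall_trees fin)
  have "balanced_tall k n H0 \<subseteq> (\<Union>H\<in>{H0..n}. \<Union>a\<in>{0..n}. \<Union>b\<in>{0..n-a}. f ` Q H a b)"
  proof
    fix t assume "t \<in> balanced_tall k n H0"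
    then obtain H s s' N where t: "t \<in> root_trees k n" "H \<ge> H0" "sub t = add_mset s (add_mset s' N)"
      "height s = H - 1" "height s' = H - 1 \<or> height s' = H - 2"
      unfolding balanced_tall_def by blast
    have tN: "t = Node (Suc k) (add_mset s (add_mset s' N))"
      using t by (cases t) (auto simp: root_trees_def trees_def)
    have n: "n = Suc (nodes s + (nodes s' + (\<Sum>s\<in>#N. nodes s)))"
      using t(1) tN by (simp add: root_trees_def trees_def)
    have "H \<le> n" using height_less_nodes[of s] t(4) n by linarith
    moreover have "s \<in> tall_trees k (H - 1) (nodes s)" "s' \<in> tall_trees k (H - 1) (nodes s') \<union> tall_trees k (H - 2) (nodes s')"
      using t tN by (auto simp: tall_trees_def root_trees_def trees_def)
    moreover have "Node (Suc k) N \<in> root_trees k (n - nodes s - nodes s')"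
      using t(1) tN n by (auto simp: root_trees_def trees_def)
    ultimately show "t \<in> (\<Union>H\<in>{H0..n}. \<Union>a\<in>{0..n}. \<Union>b\<in>{0..n-a}. f ` Q H a b)"
      using t(2) tN n unfolding Q_def f_def
      by (intro UN_I[of H] UN_I[of "nodes s"] UN_I[of "nodes s'"] image_eqI[of _ _ "(s, s', Node (Suc k) N)"]) auto
  qed
  then have "card (balanced_tall k n H0) \<le> card (\<Union>H\<in>{H0..n}. \<Union>a\<in>{0..n}. \<Union>b\<in>{0..n-a}. f ` Q H a b)"
    by (intro card_mono) (auto simp: fQ)
  also have "\<dots> \<le> (\<Sum>H=H0..n. card (\<Union>a\<in>{0..n}. \<Union>b\<in>{0..n-a}. f ` Q H a b))"
    by (rule card_UN_le) simp
  also have "\<dots> \<le> (\<Sum>H=H0..n. \<Sum>a=0..n. card (\<Union>b\<in>{0..n-a}. f ` Q H a b))"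
    by (intro sum_mono card_UN_le) simp
  also have "\<dots> \<le> (\<Sum>H=H0..n. \<Sum>a=0..n. \<Sum>b=0..n-a. card (f ` Q H a b))"
    by (intro sum_mono card_UN_le) simp
  also have "\<dots> \<le> (\<Sum>H=H0..n. \<Sum>a=0..n. \<Sum>b=0..n-a.
      card (tall_trees k (H - 1) a) * (card (tall_trees k (H - 1) b) + card (tall_trees k (H - 2) b))
      * card (root_trees k (n - a - b)))"
  proof (intro sum_mono)
    fix H a b
    have "card (f ` Q H a b) \<le> card (Q H a b)" by (rule card_image_le[OF fQ])
    also have "\<dots> = card (tall_trees k (H - 1) a) * (card (tall_trees k (H - 1) b \<union> tall_trees k (H - 2) b)
      * card (root_trees k (n - a - b)))" unfolding Q_def by (simp only: card_cartesian_product)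
    also have "\<dots> \<le> card (tall_trees k (H - 1) a) * ((card (tall_trees k (H - 1) b) + card (tall_trees k (H - 2) b))
      * card (root_trees k (n - a - b)))"
      by (intro mult_left_mono mult_right_mono card_Un_le) auto
    finally show "card (f ` Q H a b) \<le> card (tall_trees k (H - 1) a) * (card (tall_trees k (H - 1) b) + card (tall_trees k (H - 2) b))
      * card (root_trees k (n - a - b))" by (simp only: mult.assoc)
  qed
  finally show ?thesis .
qed

lemma tree_count_bounds:
  assumes k: "k \<ge> 1"
  obtains \<rho> c C :: real where "\<rho> > 0" "c > 0" "C > 0"
    and "\<And>n. n \<ge> 1 \<Longrightarrow> c / (real n * sqrt (real n)) \<le> real (card (root_trees k n)) * \<rho> ^ n"
    and "\<And>n H0. n \<ge> 1 \<Longrightarrow> H0 \<ge> 6 \<Longrightarrow> n \<le> H0 ^ 2 \<Longrightarrow>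
      real (card (balanced_tall k n H0)) * \<rho> ^ n
        \<le> C / (real n ^ 2 * sqrt (real n)) * exp (- (real H0 ^ 2) / (784 * real n))"
proof -
  interpret T: tree_counts k "\<lambda>n. card (trees k 0 n)" by (rule tree_counts_trees[OF k])
  note \<rho> = T.rho_pos
  \<comment> \<open>\<open>tall_trees\<close> covers all \<open>k + 1\<close> root colours while
    \<open>g\<close> counts \<open>k\<close> times a single one; the factor
    \<open>k / (k + 1)\<close> reconciles them.\<close>
  define e where "e H n = real k / (real k + 1) * real (card (tall_trees k H n)) * T.\<rho> ^ n" for H n
  obtain C1 where C1: "C1 > 0" "\<And>N M. N \<ge> 1 \<Longrightarrow> (\<Sum>n=Suc N..M. T.g n) \<le> C1 / sqrt (real N)"
    using T.g_tail by blast
  interpret P: height_profile T.g e 256 C1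
  proof
    show "T.g 0 = 0" by (simp add: T.g_def trees_0)
    show "e H n = 0" if "n \<le> H" for H n using that by (simp add: e_def tall_trees_zero)
    show "(\<Sum>H\<in>A. e H n) \<le> T.g n" if "finite A" for n A
    proof -
      have "(\<Sum>H\<in>A. e H n) = real k / (real k + 1) * real (\<Sum>H\<in>A. card (tall_trees k H n)) * T.\<rho> ^ n"
        by (simp add: e_def sum_distrib_left sum_distrib_right)
      also have "\<dots> \<le> real k / (real k + 1) * real ((k + 1) * card (trees k 0 n)) * T.\<rho> ^ n"
        using sum_card_tall_trees_le[OF that, of k n] \<rho>
        by (intro mult_right_mono mult_left_mono) (simp_all only: of_nat_le_iff, auto)
      also have "\<dots> = T.g n" by (simp add: T.g_def field_simps)
      finally show ?thesis .
    qed
    show "e (Suc H) n \<le> (\<Sum>j=0..n. T.g j * e H (n - j))" for H n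
    proof -
      have "e (Suc H) n \<le> real k / (real k + 1) * real (\<Sum>j=0..n. k * card (trees k 0 j) * card (tall_trees k H (n - j))) * T.\<rho> ^ n"
        unfolding e_def using card_tall_trees_step[of k H n] \<rho>
        by (intro mult_right_mono mult_left_mono) (simp_all only: of_nat_le_iff, auto)
      also have "\<dots> = (\<Sum>j=0..n. real k / (real k + 1) * real (k * card (trees k 0 j) * card (tall_trees k H (n - j))) * T.\<rho> ^ n)"
        by (simp only: of_nat_sum sum_distrib_left sum_distrib_right)
      also have "\<dots> = (\<Sum>j=0..n. T.g j * e H (n - j))"
      proof (rule sum.cong)
        fix j assume "j \<in> {0..n}"
        then have "T.\<rho> ^ n = T.\<rho> ^ j * T.\<rho> ^ (n - j)" by (subst power_add [symmetric]) auto
        then show "real k / (real k + 1) * real (k * card (trees k 0 j) * card (tall_trees k H (n - j))) * T.\<rho> ^ n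
            = T.g j * e H (n - j)" by (simp add: T.g_def e_def)
      qed simp
      finally show ?thesis .
    qed
    show "(Abs_fps T.g ^ i) $ n \<le> 256 / real i ^ 2 * exp (- (real i ^ 2) / (8 * real n))"
      if "i \<ge> 1" "n \<ge> 1" for i n using T.g_power_le[OF that] .
  qed (use C1 T.g_nonneg \<rho> in \<open>auto simp: e_def\<close>)
  define R where "R n = real (card (root_trees k n)) * T.\<rho> ^ n" for n
  define S where "S = (\<Sum>n. T.g n)"
  have S: "(\<Sum>n=0..M. T.g n) \<le> S" for M
    unfolding S_def by (rule sum_le_suminf[OF T.g_summable]) (auto simp: T.g_nonneg)
  have Rn: "R n \<le> 1 / (real k ^ 2 * T.\<rho>) * (\<Sum>a=0..Suc n. T.g a * T.g (Suc n - a))" for n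
  proof -
    have "R n \<le> real (\<Sum>a=0..Suc n. card (trees k 0 a) * card (trees k 0 (Suc n - a))) * T.\<rho> ^ n"
      unfolding R_def using card_root_trees_le[OF k, of n] \<rho> by (intro mult_right_mono) (simp_all only: of_nat_le_iff, auto)
    also have "\<dots> = (\<Sum>a=0..Suc n. real (card (trees k 0 a) * card (trees k 0 (Suc n - a))) * T.\<rho> ^ n)"
      by (simp only: of_nat_sum sum_distrib_right)
    also have "\<dots> = (\<Sum>a=0..Suc n. 1 / (real k ^ 2 * T.\<rho>) * (T.g a * T.g (Suc n - a)))"
    proof (rule sum.cong)
      fix a assume "a \<in> {0..Suc n}"
      then have "T.\<rho> * T.\<rho> ^ n = T.\<rho> ^ a * T.\<rho> ^ (Suc n - a)"
        by (subst power_add [symmetric]) auto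
      then have "T.g a * T.g (Suc n - a) = real k ^ 2 * real (card (trees k 0 a) * card (trees k 0 (Suc n - a))) * (T.\<rho> * T.\<rho> ^ n)"
        by (simp add: T.g_def power2_eq_square)
      then show "real (card (trees k 0 a) * card (trees k 0 (Suc n - a))) * T.\<rho> ^ n
         = 1 / (real k ^ 2 * T.\<rho>) * (T.g a * T.g (Suc n - a))" using k \<rho> by simp
    qed simp
    finally show ?thesis by (simp only: sum_distrib_left)
  qed
  \<comment> \<open>\<open>R\<close> is dominated by the convolution of the summable
    \<open>g\<close> with itself, so the part of the tree outside the two tall branches has finite
    total mass.\<close>
  have R0: "(\<Sum>n=0..M. R n) \<le> 1 / (real k ^ 2 * T.\<rho>) * (S * S)" for M
  proof -
    have "(\<Sum>n=0..M. R n) \<le> (\<Sum>n=0..M. 1 / (real k ^ 2 * T.\<rho>) * (\<Sum>a=0..Suc n. T.g a * T.g (Suc n - a)))"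
      by (intro sum_mono Rn)
    also have "\<dots> = 1 / (real k ^ 2 * T.\<rho>) * (\<Sum>n=0..M. \<Sum>a=0..Suc n. T.g a * T.g (Suc n - a))"
      by (simp only: sum_distrib_left)
    also have "(\<Sum>n=0..M. \<Sum>a=0..Suc n. T.g a * T.g (Suc n - a))
        = (\<Sum>(n,a)\<in>(SIGMA n:{0..M}. {0..Suc n}). T.g a * T.g (Suc n - a))"
      by (rule sum.Sigma) auto
    also have "\<dots> = (\<Sum>(a,b)\<in>(\<lambda>(n,a). (a, Suc n - a)) ` (SIGMA n:{0..M}. {0..Suc n}). T.g a * T.g b)"
      by (subst sum.reindex) (auto simp: inj_on_def case_prod_unfold)
    also have "\<dots> \<le> (\<Sum>(a,b)\<in>{0..Suc M} \<times> {0..Suc M}. T.g a * T.g b)"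
      by (intro sum_mono2) (auto simp: T.g_nonneg)
    also have "\<dots> = (\<Sum>a=0..Suc M. T.g a) * (\<Sum>b=0..Suc M. T.g b)"
      by (simp only: sum_product sum.cartesian_product)
    also have "\<dots> \<le> S * S" using S[of "Suc M"] T.g_nonneg S[of 0]
      by (intro mult_mono S sum_nonneg) (auto simp: intro: order_trans[OF sum_nonneg[of "{0..0}" T.g]])
    finally show ?thesis using k \<rho> by (simp add: divide_right_mono)
  qed
  obtain C where C: "C > 0" "\<And>n H0. n \<ge> 1 \<Longrightarrow> H0 \<ge> 6 \<Longrightarrow> n \<le> H0 ^ 2 \<Longrightarrow>
     (\<Sum>H=H0..n. \<Sum>a=0..n. \<Sum>b=0..n-a. e (H - 1) a * (e (H - 1) b + e (H - 2) b) * R (n - a - b))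
      \<le> C / (real n ^ 2 * sqrt (real n)) * exp (- (real H0 ^ 2) / (784 * real n))"
    using P.two_high_branches[of R, OF _ R0] \<rho> unfolding R_def by auto
  obtain c where c: "c > 0" "\<And>n. n \<ge> 1 \<Longrightarrow> c / (real n * sqrt (real n)) \<le> T.g n"
    using T.g_lower by blast
  define q where "q = (real k / (real k + 1)) ^ 2"
  have q: "q > 0" using k by (simp add: q_def)
  show ?thesis
  proof (rule that[of T.\<rho> "c / real k" "C / q"])
    fix n :: nat assume n: "n \<ge> 1"
    have "c / real k / (real n * sqrt (real n)) = c / (real n * sqrt (real n)) / real k" by simp
    also have "\<dots> \<le> T.g n / real k" using c(2)[OF n] by (rule divide_right_mono) simp
    also have "\<dots> = real (card (trees k 0 n)) * T.\<rho> ^ n" using k by (simp add: T.g_def)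
    also have "\<dots> \<le> real (card (root_trees k n)) * T.\<rho> ^ n"
      using card_root_trees_ge[of k n] \<rho> by (intro mult_right_mono) auto
    finally show "c / real k / (real n * sqrt (real n)) \<le> real (card (root_trees k n)) * T.\<rho> ^ n" .
  next
    fix n H0 :: nat assume n: "n \<ge> 1" "H0 \<ge> 6" "n \<le> H0 ^ 2"
    have "q * (real (card (balanced_tall k n H0)) * T.\<rho> ^ n) \<le> q * (real (\<Sum>H=H0..n. \<Sum>a=0..n. \<Sum>b=0..n-a.
      card (tall_trees k (H - 1) a) * (card (tall_trees k (H - 1) b) + card (tall_trees k (H - 2) b))
      * card (root_trees k (n - a - b))) * T.\<rho> ^ n)"
      using card_balanced_tall_le[of k n H0] \<rho> q
      by (intro mult_left_mono mult_right_mono) (simp_all only: of_nat_le_iff, auto)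
    also have "\<dots> = (\<Sum>H=H0..n. \<Sum>a=0..n. \<Sum>b=0..n-a. q * (real (
      card (tall_trees k (H - 1) a) * (card (tall_trees k (H - 1) b) + card (tall_trees k (H - 2) b))
      * card (root_trees k (n - a - b))) * T.\<rho> ^ n))"
      by (simp only: of_nat_sum sum_distrib_left sum_distrib_right)
    also have "\<dots> = (\<Sum>H=H0..n. \<Sum>a=0..n. \<Sum>b=0..n-a. e (H - 1) a * (e (H - 1) b + e (H - 2) b) * R (n - a - b))"
    proof (intro sum.cong refl)
      fix H a b assume "a \<in> {0..n}" "b \<in> {0..n-a}"
      then have "n = a + b + (n - a - b)" by auto
      then have "T.\<rho> ^ n = T.\<rho> ^ a * T.\<rho> ^ b * T.\<rho> ^ (n - a - b)" by (metis power_add)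
      then show "q * (real (card (tall_trees k (H - 1) a) * (card (tall_trees k (H - 1) b) + card (tall_trees k (H - 2) b))
          * card (root_trees k (n - a - b))) * T.\<rho> ^ n) = e (H - 1) a * (e (H - 1) b + e (H - 2) b) * R (n - a - b)"
        by (simp only: q_def e_def R_def of_nat_mult of_nat_add power2_eq_square) (simp only: algebra_simps)
    qed
    also have "\<dots> \<le> C / (real n ^ 2 * sqrt (real n)) * exp (- (real H0 ^ 2) / (784 * real n))"
      by (rule C(2)[OF n])
    finally have "real (card (balanced_tall k n H0)) * T.\<rho> ^ n
      \<le> C / (real n ^ 2 * sqrt (real n)) * exp (- (real H0 ^ 2) / (784 * real n)) / q"
      by (subst pos_le_divide_eq[OF q]) (simp only: mult.commute)
    then show "real (card (balanced_tall k n H0)) * T.\<rho> ^ n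
      \<le> C / q / (real n ^ 2 * sqrt (real n)) * exp (- (real H0 ^ 2) / (784 * real n))"
      by (simp add: mult_ac)
  qed (use \<rho> c C q k in auto)
qed

section \<open>Coloured k-trees as trees of hedra\<close>

definition star :: "'a \<Rightarrow> 'a set \<Rightarrow> ('a \<times> 'a) set" where
  "star v A = {v} \<times> A \<union> A \<times> {v}"

text \<open>
  \<open>hang \<kappa> K N W E\<close>: hanging the trees \<open>N\<close> onto the hedron \<open>K\<close> creates the vertices \<open>W\<close> and the
  arcs \<open>E\<close>. A tree whose root has colour \<open>j\<close> stands for a hedron that shares with \<open>K\<close> all vertices
  except the one of colour \<open>j\<close>, which is replaced by a new vertex \<open>v\<close> of the same colour. Since the
  subtrees of that root avoid the colour \<open>j\<close>, every hedron containing \<open>K - {x}\<close> is hung directly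
  onto \<open>K\<close>, which makes the encoding unique.
\<close>

inductive hang :: "('a \<Rightarrow> nat) \<Rightarrow> 'a set \<Rightarrow> tree multiset \<Rightarrow> 'a set \<Rightarrow> ('a \<times> 'a) set \<Rightarrow> bool"
  for \<kappa> :: "'a \<Rightarrow> nat" where
  empty: "hang \<kappa> K {#} {} {}"
| add: "hang \<kappa> K N W E \<Longrightarrow> hang \<kappa> (insert v (K - {x})) N' W' E' \<Longrightarrow> x \<in> K \<Longrightarrow> \<kappa> x = \<kappa> v \<Longrightarrow>
    v \<notin> K \<Longrightarrow> v \<notin> W \<Longrightarrow> W \<inter> W' = {} \<Longrightarrow> x \<notin> W' \<Longrightarrow> \<forall>s\<in>#N'. col s \<noteq> \<kappa> v \<Longrightarrow>
    hang \<kappa> K (add_mset (Node (\<kappa> v) N') N) (insert v (W \<union> W')) (E \<union> E' \<union> star v (K - {x}))"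

section \<open>Rearranging hung trees\<close>

lemma hang_disjoint: "hang \<kappa> K N W E \<Longrightarrow> W \<inter> K = {}"
  by (induction rule: hang.induct) auto

lemma hang_arcs: "hang \<kappa> K N W E \<Longrightarrow> E \<subseteq> W \<times> (W \<union> K) \<union> (W \<union> K) \<times> W"
  by (induction rule: hang.induct) (auto simp: star_def)

lemma hang_finite: "hang \<kappa> K N W E \<Longrightarrow> finite W"
  by (induction rule: hang.induct) auto

lemma hang_card: "hang \<kappa> K N W E \<Longrightarrow> card W = (\<Sum>s\<in>#N. nodes s)"
proof (induction rule: hang.induct)
  case (add K N W E v x N' W' E')
  have "v \<notin> W'" using hang_disjoint[OF add.hyps(2)] by auto
  then have "card (insert v (W \<union> W')) = Suc (card W + card W')"
    using add hang_finite[OF add.hyps(1)] hang_finite[OF add.hyps(2)] by (simp add: card_Un_disjoint)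
  then show ?case using add by simp
qed simp

lemma hang_proper: "hang \<kappa> K N W E \<Longrightarrow> \<kappa> ` K \<subseteq> {..k} \<Longrightarrow> \<forall>s\<in>#N. proper k s \<and> col s \<le> k"
proof (induction rule: hang.induct)
  case (add K N W E v x N' W' E')
  have "\<kappa> v \<in> \<kappa> ` K" using add.hyps(3,4) by (metis imageI)
  then have v: "\<kappa> v \<le> k" using add.prems by auto
  then have "\<kappa> ` insert v (K - {x}) \<subseteq> {..k}" using add.prems by auto
  then show ?case using v add.IH add.prems add.hyps(9) by auto
qed simp

lemma hang_cong: "hang \<kappa> K N W E \<Longrightarrow> (\<And>a. a \<in> K \<union> W \<Longrightarrow> \<kappa> a = \<kappa>' a) \<Longrightarrow> hang \<kappa>' K N W E"
proof (induction rule: hang.induct)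
  case (add K N W E v x N' W' E')
  have eq: "\<kappa> v = \<kappa>' v" "\<kappa> x = \<kappa>' x" using add.prems add.hyps by auto
  have "hang \<kappa>' K N W E" by (rule add.IH(1)) (use add.prems in auto)
  moreover have "hang \<kappa>' (insert v (K - {x})) N' W' E'" by (rule add.IH(2)) (use add.prems in auto)
  ultimately have "hang \<kappa>' K (add_mset (Node (\<kappa>' v) N') N) (insert v (W \<union> W')) (E \<union> E' \<union> star v (K - {x}))"
    using add.hyps eq by (intro hang.add) auto
  then show ?case using eq by simp
qed (rule hang.empty)

lemma hang_relabel:
  assumes "hang \<kappa> K N W E" "inj_on f (K \<union> W)" "\<And>a. a \<in> K \<union> W \<Longrightarrow> \<kappa>' (f a) = \<kappa> a"
  shows "hang \<kappa>' (f ` K) N (f ` W) (map_prod f f ` E)"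
  using assms
proof (induction rule: hang.induct)
  case (add K N W E v x N' W' E')
  note inj = inj_onD[OF add.prems(1)]
  have K': "f ` insert v (K - {x}) = insert (f v) (f ` K - {f x})"
    using add.hyps inj by (auto simp: image_iff)
  have "hang \<kappa>' (f ` K) N (f ` W) (map_prod f f ` E)"
    by (rule add.IH(1)) (use add.prems in \<open>auto intro: inj_on_subset\<close>)
  moreover have "hang \<kappa>' (f ` insert v (K - {x})) N' (f ` W') (map_prod f f ` E')"
    by (rule add.IH(2)) (use add.prems in \<open>auto intro: inj_on_subset\<close>)
  ultimately have "hang \<kappa>' (f ` K) (add_mset (Node (\<kappa>' (f v)) N') N) (insert (f v) (f ` W \<union> f ` W'))
      (map_prod f f ` E \<union> map_prod f f ` E' \<union> star (f v) (f ` K - {f x}))"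
    unfolding K'
  proof (rule hang.add)
    show "f x \<in> f ` K" using add.hyps by simp
    show "\<kappa>' (f x) = \<kappa>' (f v)" using add.hyps add.prems(2) by simp
    show "f v \<notin> f ` K" "f v \<notin> f ` W" "f x \<notin> f ` W'"
      using add.hyps inj by (auto simp: image_iff)
    show "f ` W \<inter> f ` W' = {}"
      using add.hyps inj_on_image_Int[OF add.prems(1), of W W'] by (auto simp: subset_iff)
    show "\<forall>s\<in>#N'. col s \<noteq> \<kappa>' (f v)" using add.hyps add.prems(2) by simp
  qed
  moreover have "map_prod f f ` star v (K - {x}) = star (f v) (f ` K - {f x})"
  proof -
    have "f ` K - {f x} = f ` (K - {x})"
      using add.hyps inj by (auto simp: image_iff)
    then show ?thesis by (auto simp: star_def)
  qed
  ultimately show ?case using add.prems(2)[of v] by (simp add: image_Un)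
qed (simp add: hang.empty)

text \<open>Branches at the same hedron are independent of each other, so any of them may be taken
  as the one attached last. This gives inversion for a chosen member of the multiset.\<close>

lemma hang_remove:
  assumes "hang \<kappa> K M W E" "s \<in># M"
  shows "\<exists>v x W1 E1 N' W' E'. s = Node (\<kappa> v) N' \<and> hang \<kappa> K (M - {#s#}) W1 E1 \<and>
    hang \<kappa> (insert v (K - {x})) N' W' E' \<and> x \<in> K \<and> \<kappa> x = \<kappa> v \<and> v \<notin> K \<and> v \<notin> W1 \<and> W1 \<inter> W' = {} \<and>
    x \<notin> W' \<and> (\<forall>s\<in>#N'. col s \<noteq> \<kappa> v) \<and> W = insert v (W1 \<union> W') \<and> E = E1 \<union> E' \<union> star v (K - {x})"
  using assms
proof (induction rule: hang.induct)
  case (add K N W E u y N0 W0 E0)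
  show ?case
  proof (cases "s = Node (\<kappa> u) N0")
    case True
    show ?thesis
      by (rule exI[of _ u], rule exI[of _ y], rule exI[of _ W], rule exI[of _ E], rule exI[of _ N0],
          rule exI[of _ W0], rule exI[of _ E0]) (use add.hyps True in auto)
  next
    case False
    then have sN: "s \<in># N" using add.prems by auto
    obtain v x W1 E1 N' W' E' where s: "s = Node (\<kappa> v) N'" "hang \<kappa> K (N - {#s#}) W1 E1"
      "hang \<kappa> (insert v (K - {x})) N' W' E'" "x \<in> K" "\<kappa> x = \<kappa> v" "v \<notin> K" "v \<notin> W1" "W1 \<inter> W' = {}"
      "x \<notin> W'" "\<forall>s\<in>#N'. col s \<noteq> \<kappa> v" "W = insert v (W1 \<union> W')" "E = E1 \<union> E' \<union> star v (K - {x})"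
      using add.IH(1)[OF sN] by blast
    have "hang \<kappa> K (add_mset (Node (\<kappa> u) N0) (N - {#s#})) (insert u (W1 \<union> W0)) (E1 \<union> E0 \<union> star u (K - {y}))"
      by (rule hang.add[OF s(2) add.hyps(2)]) (use add.hyps s in auto)
    moreover have "add_mset (Node (\<kappa> u) N0) (N - {#s#}) = add_mset (Node (\<kappa> u) N0) N - {#s#}"
      using False sN by simp
    ultimately have 1: "hang \<kappa> K (add_mset (Node (\<kappa> u) N0) N - {#s#}) (insert u (W1 \<union> W0)) (E1 \<union> E0 \<union> star u (K - {y}))"
      by simp
    have W': "W' \<inter> insert v (K - {x}) = {}" using hang_disjoint[OF s(3)] .
    have W0: "W0 \<inter> insert u (K - {y}) = {}" using hang_disjoint[OF add.hyps(2)] .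
    have vu: "v \<noteq> u" "v \<notin> W0" "u \<notin> W'" using add.hyps(6,7) s(11) by auto
    then have 2: "v \<notin> insert u (W1 \<union> W0)" using s(7) add.hyps(7) s(11) by auto
    have 3: "insert u (W1 \<union> W0) \<inter> W' = {}" using s(8,11) add.hyps(7) vu by auto
    have 4: "insert u (W \<union> W0) = insert v (insert u (W1 \<union> W0) \<union> W')" unfolding s(11) by auto
    have 5: "E \<union> E0 \<union> star u (K - {y}) = (E1 \<union> E0 \<union> star u (K - {y})) \<union> E' \<union> star v (K - {x})"
      unfolding s(12) by auto
    show ?thesis
      by (rule exI[of _ v], rule exI[of _ x], rule exI[of _ "insert u (W1 \<union> W0)"],
          rule exI[of _ "E1 \<union> E0 \<union> star u (K - {y})"], rule exI[of _ N'], rule exI[of _ W'], rule exI[of _ E'])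
        (intro conjI s(1,3-6,9,10) 1 2 3 4 5)
  qed
qed simp

lemma hang_join:
  assumes "hang \<kappa> K A WA EA" "hang \<kappa> K B WB EB" "WA \<inter> WB = {}"
  shows "hang \<kappa> K (A + B) (WA \<union> WB) (EA \<union> EB)"
  using assms
proof (induction rule: hang.induct)
  case (add K N W E v x N' W' E')
  have "hang \<kappa> K (N + B) (W \<union> WB) (E \<union> EB)"
    by (rule add.IH(1)[OF add.prems(1)]) (use add.prems(2) in auto)
  then have "hang \<kappa> K (add_mset (Node (\<kappa> v) N') (N + B)) (insert v ((W \<union> WB) \<union> W')) ((E \<union> EB) \<union> E' \<union> star v (K - {x}))"
    by (rule hang.add[OF _ add.hyps(2)]) (use add.hyps(3-9) add.prems(2) in auto)
  moreover have "insert v ((W \<union> WB) \<union> W') = insert v (W \<union> W') \<union> WB" by auto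
  moreover have "(E \<union> EB) \<union> E' \<union> star v (K - {x}) = E \<union> E' \<union> star v (K - {x}) \<union> EB" by auto
  ultimately show ?case by simp
qed simp

lemma hang_split:
  assumes "hang \<kappa> K M W E"
  shows "\<exists>WA EA WB EB. hang \<kappa> K (filter_mset Q M) WA EA \<and> hang \<kappa> K (filter_mset (\<lambda>s. \<not> Q s) M) WB EB \<and>
    WA \<inter> WB = {} \<and> W = WA \<union> WB \<and> E = EA \<union> EB"
  using assms
proof (induction rule: hang.induct)
  case (empty K)
  show ?case using hang.empty[of \<kappa> K] by auto
next
  case (add K N W E v x N' W' E')
  obtain WA EA WB EB where *: "hang \<kappa> K (filter_mset Q N) WA EA" "hang \<kappa> K (filter_mset (\<lambda>s. \<not> Q s) N) WB EB"
    "WA \<inter> WB = {}" "W = WA \<union> WB" "E = EA \<union> EB" using add.IH(1) by blast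
  have W': "W' \<inter> insert v (K - {x}) = {}" using hang_disjoint[OF add.hyps(2)] .
  show ?case
  proof (cases "Q (Node (\<kappa> v) N')")
    case True
    have "hang \<kappa> K (add_mset (Node (\<kappa> v) N') (filter_mset Q N)) (insert v (WA \<union> W')) (EA \<union> E' \<union> star v (K - {x}))"
      by (rule hang.add[OF *(1) add.hyps(2)]) (use add.hyps(3-9) *(3,4) in auto)
    then show ?thesis using True * add.hyps(3-9) W'
      by (intro exI[of _ "insert v (WA \<union> W')"] exI[of _ "EA \<union> E' \<union> star v (K - {x})"] exI[of _ WB] exI[of _ EB]) auto
  next
    case False
    have "hang \<kappa> K (add_mset (Node (\<kappa> v) N') (filter_mset (\<lambda>s. \<not> Q s) N)) (insert v (WB \<union> W')) (EB \<union> E' \<union> star v (K - {x}))"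
      by (rule hang.add[OF *(2) add.hyps(2)]) (use add.hyps(3-9) *(3,4) in auto)
    then show ?thesis using False * add.hyps(3-9) W'
      by (intro exI[of _ WA] exI[of _ EA] exI[of _ "insert v (WB \<union> W')"] exI[of _ "EB \<union> E' \<union> star v (K - {x})"]) auto
  qed
qed

text \<open>A branch whose root has the colour of \<open>x\<close> starts with a hedron containing
  \<open>K - {x}\<close>. This set is common to \<open>K\<close> and
  \<open>insert v (K - {x})\<close>, so the branch can be hung onto either of them.\<close>

lemma hang_front:
  assumes "hang \<kappa> K A W E" "\<forall>s\<in>#A. col s = \<kappa> v" "x \<in> K" "\<kappa> x = \<kappa> v" "inj_on \<kappa> K" "v \<notin> W" "v \<notin> K"
  shows "hang \<kappa> (insert v (K - {x})) A W E"
  using assms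
proof (induction rule: hang.induct)
  case (add K N W E u y N' W' E')
  have y: "y = x" using add.hyps(3,4) add.prems(1,2,3) by (intro inj_onD[OF add.prems(4)]) auto
  have e: "insert v (K - {x}) - {v} = K - {x}" using add.prems by auto
  have "hang \<kappa> (insert v (K - {x})) (add_mset (Node (\<kappa> u) N') N) (insert u (W \<union> W')) (E \<union> E' \<union> star u (insert v (K - {x}) - {v}))"
  proof (rule hang.add)
    show "hang \<kappa> (insert v (K - {x})) N W E"
      by (rule add.IH(1)) (use add.prems in auto)
    show "hang \<kappa> (insert u (insert v (K - {x}) - {v})) N' W' E'" unfolding e using add.hyps(2) y by simp
  qed (use add.hyps(3-9) add.prems y in auto)
  then show ?case unfolding e using y by simp
qed (simp add: hang.empty)

section \<open>Graphs represented by a root hedron and its branches\<close>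

definition graph_of :: "'a set \<Rightarrow> 'a set \<Rightarrow> ('a \<times> 'a) set \<Rightarrow> 'a pair_pre_digraph" where
  "graph_of K W E = \<lparr> pverts = K \<union> W, parcs = {(a, b). a \<in> K \<and> b \<in> K \<and> a \<noteq> b} \<union> E \<rparr>"

definition represents :: "nat \<Rightarrow> 'a pair_pre_digraph \<Rightarrow> ('a \<Rightarrow> nat) \<Rightarrow> 'a set \<Rightarrow> tree multiset \<Rightarrow> bool" where
  "represents k G \<kappa> K N \<longleftrightarrow> finite K \<and> inj_on \<kappa> K \<and> \<kappa> ` K = {..k} \<and> (\<exists>W E. hang \<kappa> K N W E \<and> G = graph_of K W E)"

text \<open>The root moves from \<open>K\<close> to the first hedron
  \<open>insert v (K - {x})\<close> of the branch \<open>s\<close>. The other branches of colour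
  \<open>j\<close> also contain \<open>K - {x}\<close> and move along. The rest stays at
  \<open>K\<close>, which becomes a child of the new root with new vertex \<open>x\<close>, again of
  colour \<open>j\<close>; that no branch of colour \<open>j\<close> stays there is what
  \<open>hang\<close> demands.\<close>

lemma represents_reroot:
  assumes r: "represents k G \<kappa> K N" and s: "s \<in># N" "s = Node j N'"
  shows "\<exists>K'. represents k G \<kappa> K' (add_mset (Node j (filter_mset (\<lambda>t. \<not> col t = j) (N - {#s#})))
     (filter_mset (\<lambda>t. col t = j) (N - {#s#}) + N'))"
proof -
  define M where "M = N - {#s#}"
  obtain W E where K: "finite K" "inj_on \<kappa> K" "\<kappa> ` K = {..k}" and h: "hang \<kappa> K N W E" and G: "G = graph_of K W E"
    using r by (auto simp: represents_def)
  obtain v x W1 E1 W' E' where d: "j = \<kappa> v" "hang \<kappa> K M W1 E1"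
    "hang \<kappa> (insert v (K - {x})) N' W' E'" "x \<in> K" "\<kappa> x = \<kappa> v" "v \<notin> K" "v \<notin> W1" "W1 \<inter> W' = {}"
    "x \<notin> W'" "\<forall>s\<in>#N'. col s \<noteq> \<kappa> v" "W = insert v (W1 \<union> W')" "E = E1 \<union> E' \<union> star v (K - {x})"
    using hang_remove[OF h s(1), folded M_def] s(2) by auto
  define K' where "K' = insert v (K - {x})"
  obtain WA EA WB EB where AB: "hang \<kappa> K (filter_mset (\<lambda>t. col t = j) M) WA EA"
    "hang \<kappa> K (filter_mset (\<lambda>t. \<not> col t = j) M) WB EB" "WA \<inter> WB = {}" "W1 = WA \<union> WB" "E1 = EA \<union> EB"
    using hang_split[OF d(2)] by blast
  have W1K: "W1 \<inter> K = {}" by (rule hang_disjoint[OF d(2)])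
  have "hang \<kappa> K' (filter_mset (\<lambda>t. col t = j) M) WA EA"
    unfolding K'_def by (rule hang_front[OF AB(1)]) (use d AB K in auto)
  then have 1: "hang \<kappa> K' (filter_mset (\<lambda>t. col t = j) M + N') (WA \<union> W') (EA \<union> E')"
    by (rule hang_join) (use d AB in \<open>auto simp: K'_def\<close>)
  have e: "K' - {v} = K - {x}" "insert x (K' - {v}) = K" using d by (auto simp: K'_def)
  have "hang \<kappa> K' (add_mset (Node (\<kappa> x) (filter_mset (\<lambda>t. \<not> col t = j) M)) (filter_mset (\<lambda>t. col t = j) M + N'))
    (insert x (WA \<union> W' \<union> WB)) (EA \<union> E' \<union> EB \<union> star x (K' - {v}))"
  proof (rule hang.add[OF 1])
    show "hang \<kappa> (insert x (K' - {v})) (filter_mset (\<lambda>t. \<not> col t = j) M) WB EB"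
      unfolding e(2) by (rule AB(2))
  qed (use d AB W1K in \<open>auto simp: K'_def\<close>)
  moreover have "graph_of K W E = graph_of K' (insert x (WA \<union> W' \<union> WB)) (EA \<union> E' \<union> EB \<union> star x (K' - {v}))"
    unfolding graph_of_def e using d AB by (auto simp: K'_def star_def)
  moreover have "inj_on \<kappa> K'" "\<kappa> ` K' = {..k}"
  proof -
    have "\<kappa> ` K' = insert (\<kappa> x) (\<kappa> ` (K - {x}))" using d by (simp add: K'_def)
    also have "\<dots> = \<kappa> ` K" using d by blast
    finally show "\<kappa> ` K' = {..k}" using K by simp
    show "inj_on \<kappa> K'"
      unfolding K'_def using K(2) d(4,5,6) by (auto simp: inj_on_def)
  qed
  moreover have "finite K'" using K by (simp add: K'_def)
  ultimately show ?thesis unfolding represents_def G M_def [symmetric] using d by (intro exI[of _ K']) auto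
qed

inductive_cases hang_emptyE: "hang \<kappa> K {#} W E"

lemma map_prod_image_cong:
  "E \<subseteq> S \<times> S \<Longrightarrow> (\<And>a. a \<in> S \<Longrightarrow> g a = h a) \<Longrightarrow> map_prod g g ` E = map_prod h h ` E"
  by (rule image_cong) auto

lemma hang_arcs_square: "hang \<kappa> K N W E \<Longrightarrow> E \<subseteq> (W \<union> K) \<times> (W \<union> K)"
  by (drule hang_arcs) auto

text \<open>The tree determines the graph: \<open>f\<close> is extended branch by branch, and the
  colour of a branch tells which vertex of the hedron it replaces.\<close>

lemma hang_iso:
  assumes "hang \<kappa> K N W E" "hang \<kappa>' L N Y F" "bij_betw f K L" "\<And>a. a \<in> K \<Longrightarrow> \<kappa>' (f a) = \<kappa> a" "inj_on \<kappa>' L"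
  shows "\<exists>g. (\<forall>a\<in>K. g a = f a) \<and> bij_betw g W Y \<and> map_prod g g ` E = F"
  using assms
proof (induction arbitrary: L Y F f rule: hang.induct)
  case (empty K)
  then have "Y = {}" "F = {}" by (auto elim: hang_emptyE)
  then show ?case by (intro exI[of _ f]) (auto simp: bij_betw_def)
next
  case (add K N W E v x N' W' E')
  obtain w y Y1 F1 N'' Y' F' where d: "Node (\<kappa> v) N' = Node (\<kappa>' w) N''"
    "hang \<kappa>' L (add_mset (Node (\<kappa> v) N') N - {#Node (\<kappa> v) N'#}) Y1 F1"
    "hang \<kappa>' (insert w (L - {y})) N'' Y' F'" "y \<in> L" "\<kappa>' y = \<kappa>' w" "w \<notin> L" "w \<notin> Y1" "Y1 \<inter> Y' = {}"
    "y \<notin> Y'" "Y = insert w (Y1 \<union> Y')" "F = F1 \<union> F' \<union> star w (L - {y})"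
    using hang_remove[OF add.prems(1), of "Node (\<kappa> v) N'"] by auto
  have w: "\<kappa>' w = \<kappa> v" and h1: "hang \<kappa>' L N Y1 F1" and h2: "hang \<kappa>' (insert w (L - {y})) N' Y' F'"
    using d(1,2,3) by simp_all
  have injf: "inj_on f K" and imf: "f ` K = L" using add.prems(2) by (auto simp: bij_betw_def)
  have fx: "f x = y"
    using add.hyps(3,4) add.prems(3) imf d(4,5) w by (intro inj_onD[OF add.prems(4)]) auto
  obtain g1 where g1: "\<forall>a\<in>K. g1 a = f a" "bij_betw g1 W Y1" "map_prod g1 g1 ` E = F1"
    using add.IH(1)[OF h1 add.prems(2,3,4)] by blast
  define f2 where "f2 = f(v := w)"
  have im: "f ` (K - {x}) = L - {y}"
    using inj_on_image_set_diff[OF injf, of K "{x}"] add.hyps(3) imf fx by simp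
  have f2im: "f2 ` (K - {x}) = L - {y}" using im add.hyps(5) by (auto simp: f2_def)
  have "bij_betw f2 (insert v (K - {x})) (insert w (L - {y}))"
  proof -
    have "inj_on f2 (K - {x})" using injf add.hyps(5) unfolding f2_def by (auto simp: inj_on_def)
    moreover have f2v: "f2 v = w" by (simp add: f2_def)
    moreover have "w \<notin> L - {y}" "v \<notin> K - {x}" using d(6) add.hyps(5) by auto
    ultimately show ?thesis
      unfolding bij_betw_def inj_on_insert image_insert f2v by (simp add: f2im)
  qed
  moreover have "\<kappa>' (f2 a) = \<kappa> a" if "a \<in> insert v (K - {x})" for a
    using that add.prems(3) w add.hyps(5) by (auto simp: f2_def)
  moreover have "inj_on \<kappa>' (insert w (L - {y}))"
    using add.prems(4) d(4,5,6) by (auto simp: inj_on_def)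
  ultimately obtain g2 where g2: "\<forall>a\<in>insert v (K - {x}). g2 a = f2 a" "bij_betw g2 W' Y'" "map_prod g2 g2 ` E' = F'"
    using add.IH(2)[OF h2] by blast
  define g where "g a = (if a \<in> K then f a else if a = v then w else if a \<in> W then g1 a else g2 a)" for a
  have WK: "W \<inter> K = {}" by (rule hang_disjoint[OF add.hyps(1)])
  have W'K: "W' \<inter> insert v (K - {x}) = {}" by (rule hang_disjoint[OF add.hyps(2)])
  have ga1: "g a = g1 a" if "a \<in> W \<union> K" for a
    using that WK add.hyps(5,6) g1(1) by (auto simp: g_def)
  have ga2: "g a = g2 a" if "a \<in> W' \<union> insert v (K - {x})" for a
    using that W'K add.hyps(5,7,8) g2(1) by (auto simp: g_def f2_def)
  have "bij_betw g W Y1" using g1(2) ga1 by (subst bij_betw_cong[of W g g1]) auto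
  moreover have "bij_betw g W' Y'" using g2(2) ga2 by (subst bij_betw_cong[of W' g g2]) auto
  moreover have "bij_betw g {v} {w}" using add.hyps(5) by (simp add: bij_betw_def g_def)
  ultimately have "bij_betw g ((W \<union> W') \<union> {v}) ((Y1 \<union> Y') \<union> {w})"
    using d(7,8) hang_disjoint[OF h2] by (intro bij_betw_combine) auto
  then have bij: "bij_betw g (insert v (W \<union> W')) Y" unfolding d(10) by simp
  have "map_prod g g ` E = map_prod g1 g1 ` E"
    by (rule map_prod_image_cong[OF hang_arcs_square[OF add.hyps(1)] ga1])
  moreover have "map_prod g g ` E' = map_prod g2 g2 ` E'"
    by (rule map_prod_image_cong[OF hang_arcs_square[OF add.hyps(2)] ga2])
  moreover have "map_prod g g ` star v (K - {x}) = star w (L - {y})"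
  proof -
    have gK: "g ` (K - {x}) = L - {y}" unfolding im[symmetric] by (intro image_cong refl) (auto simp: g_def)
    have gv: "g v = w" using add.hyps(5) by (simp add: g_def)
    have "map_prod g g ` star v (K - {x}) = {g v} \<times> g ` (K - {x}) \<union> g ` (K - {x}) \<times> {g v}"
      by (auto simp: star_def)
    then show ?thesis unfolding gK gv by (simp add: star_def)
  qed
  ultimately have "map_prod g g ` (E \<union> E' \<union> star v (K - {x})) = F"
    using g1(3) g2(3) by (simp add: image_Un d(11))
  moreover have "\<forall>a\<in>K. g a = f a" by (simp add: g_def)
  ultimately show ?case using bij by blast
qed

lemma represents_iso:
  assumes G: "represents k G \<kappa> K N" and H: "represents k H \<kappa>' L N"
  shows "\<exists>g. inj_on g (pverts G) \<and> H = relabel g G"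
proof -
  obtain W E where K: "finite K" "inj_on \<kappa> K" "\<kappa> ` K = {..k}" "hang \<kappa> K N W E" "G = graph_of K W E"
    using G by (auto simp: represents_def)
  obtain Y F where L: "finite L" "inj_on \<kappa>' L" "\<kappa>' ` L = {..k}" "hang \<kappa>' L N Y F" "H = graph_of L Y F"
    using H by (auto simp: represents_def)
  have b1: "bij_betw \<kappa> K {..k}" "bij_betw \<kappa>' L {..k}" using K L by (auto simp: bij_betw_def)
  define f where "f = inv_into L \<kappa>' \<circ> \<kappa>"
  have f: "bij_betw f K L" unfolding f_def using b1 by (intro bij_betw_trans[OF b1(1)] bij_betw_inv_into)
  have "\<kappa>' (f a) = \<kappa> a" if "a \<in> K" for a
    using that K(3) L(3) unfolding f_def by (auto intro!: f_inv_into_f)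
  then obtain g where g: "\<forall>a\<in>K. g a = f a" "bij_betw g W Y" "map_prod g g ` E = F"
    using hang_iso[OF K(4) L(4) f _ L(2)] by blast
  have gK: "bij_betw g K L" using f g(1) by (subst bij_betw_cong[of K g f]) auto
  have "bij_betw g (K \<union> W) (L \<union> Y)"
    using bij_betw_combine[OF gK g(2)] hang_disjoint[OF L(4)] by auto
  then have inj: "inj_on g (K \<union> W)" and im: "g ` (K \<union> W) = L \<union> Y" by (auto simp: bij_betw_def)
  have injK: "inj_on g K" and imK: "g ` K = L" using gK by (auto simp: bij_betw_def)
  have "map_prod g g ` {(a, b). a \<in> K \<and> b \<in> K \<and> a \<noteq> b} = {(a, b). a \<in> L \<and> b \<in> L \<and> a \<noteq> b}"
    unfolding imK[symmetric] using injK by (auto simp: inj_on_def image_iff) 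
  then have "H = relabel g G"
    unfolding K(5) L(5) graph_of_def relabel_def using im g(3) by (simp add: image_Un)
  moreover have "inj_on g (pverts G)" using inj by (simp add: K(5) graph_of_def)
  ultimately show ?thesis by blast
qed

lemma represents_relabel:
  assumes G: "represents k G \<kappa> K N" and f: "inj_on f (pverts G)"
  shows "represents k (relabel f G) (\<kappa> \<circ> inv_into (pverts G) f) (f ` K) N"
proof -
  obtain W E where K: "finite K" "inj_on \<kappa> K" "\<kappa> ` K = {..k}" "hang \<kappa> K N W E" "G = graph_of K W E"
    using G by (auto simp: represents_def)
  have pG: "pverts G = K \<union> W" by (simp add: K(5) graph_of_def)
  define \<kappa>' where "\<kappa>' = \<kappa> \<circ> inv_into (pverts G) f"
  have \<kappa>': "\<kappa>' (f a) = \<kappa> a" if "a \<in> K \<union> W" for a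
    using that f by (simp add: \<kappa>'_def pG)
  have h: "hang \<kappa>' (f ` K) N (f ` W) (map_prod f f ` E)"
    by (rule hang_relabel[OF K(4)]) (use f \<kappa>' in \<open>auto simp: pG\<close>)
  have injK: "inj_on f K" using f by (rule inj_on_subset) (simp add: pG)
  have "map_prod f f ` {(a, b). a \<in> K \<and> b \<in> K \<and> a \<noteq> b} = {(a, b). a \<in> f ` K \<and> b \<in> f ` K \<and> a \<noteq> b}"
    using injK by (auto simp: inj_on_def image_iff)
  then have "relabel f G = graph_of (f ` K) (f ` W) (map_prod f f ` E)"
    unfolding K(5) graph_of_def relabel_def by (simp add: image_Un)
  moreover have "inj_on \<kappa>' (f ` K)" using K(2) \<kappa>' by (auto simp: inj_on_def)
  moreover have "\<kappa>' ` f ` K = {..k}" using K(3) \<kappa>' by (force simp: image_image)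
  ultimately show ?thesis unfolding represents_def \<kappa>'_def[symmetric] using K(1) h by blast
qed

lemma clique_supergraph: "clique m G K \<Longrightarrow> pverts G \<subseteq> pverts H \<Longrightarrow> parcs G \<subseteq> parcs H \<Longrightarrow> clique m H K"
  by (auto simp: clique_def)

text \<open>Each use of \<open>hang.add\<close> adjoins \<open>v\<close> to the
  \<open>k\<close>-clique \<open>K - {x}\<close> and thereby makes \<open>insert v (K - {x})\<close>
  a hedron that can carry the subtrees.\<close>

lemma hang_k_tree:
  assumes "hang \<kappa> K N W E" "k_tree k G" "clique (Suc k) G K" "W \<inter> pverts G = {}"
  shows "k_tree k \<lparr>pverts = pverts G \<union> W, parcs = parcs G \<union> E\<rparr>"
  using assms
proof (induction arbitrary: G rule: hang.induct)
  case (empty K)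
  then show ?case by (cases G) simp
next
  case (add K N W E v x N' W' E')
  define G1 where "G1 = \<lparr>pverts = pverts G \<union> W, parcs = parcs G \<union> E\<rparr>"
  have G1: "k_tree k G1" unfolding G1_def by (rule add.IH(1)) (use add.prems in auto)
  have K1: "clique (Suc k) G1 K" by (rule clique_supergraph[OF add.prems(2)]) (auto simp: G1_def)
  then have Kx: "clique k G1 (K - {x})" using add.hyps(3) by (auto simp: clique_def)
  have v1: "v \<notin> pverts G1" using add.prems(3) add.hyps(6) by (auto simp: G1_def)
  define G2 where "G2 = adjoin_vertex G1 v (K - {x})"
  have G2: "k_tree k G2" unfolding G2_def by (rule k_tree.adjoin[OF G1 Kx v1])
  have "clique (Suc k) G2 (insert v (K - {x}))"
    unfolding G2_def clique_adjoin[OF k_tree_graph[OF G1] v1 Kx]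
    using Kx by (intro disjI2 exI[of _ "K - {x}"]) (auto simp: clique_def)
  moreover have "W' \<inter> pverts G2 = {}"
    using add.prems(3) add.hyps(7) hang_disjoint[OF add.hyps(2)]
    by (auto simp: G2_def G1_def adjoin_vertex_def)
  ultimately have "k_tree k \<lparr>pverts = pverts G2 \<union> W', parcs = parcs G2 \<union> E'\<rparr>"
    by (rule add.IH(2)[OF G2])
  moreover have "\<lparr>pverts = pverts G2 \<union> W', parcs = parcs G2 \<union> E'\<rparr>
      = \<lparr>pverts = pverts G \<union> insert v (W \<union> W'), parcs = parcs G \<union> (E \<union> E' \<union> star v (K - {x}))\<rparr>"
    by (auto simp: G2_def G1_def adjoin_vertex_def star_def)
  ultimately show ?case by simp
qed

lemma k_tree_hedron:
  assumes "finite K" "card K = Suc k"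
  shows "k_tree k (graph_of K {} {})" "clique (Suc k) (graph_of K {} {}) K"
proof -
  obtain x where x: "x \<in> K" using assms by fastforce
  have "complete_digraph k (with_proj (graph_of (K - {x}) {} {}))"
    using assms x by (auto simp: complete_digraph_pair_def graph_of_def)
  then have 1: "k_tree k (graph_of (K - {x}) {} {})" by (rule k_tree.complete)
  have "clique k (graph_of (K - {x}) {} {}) (K - {x})"
    using assms x by (auto simp: clique_def graph_of_def)
  then have "k_tree k (adjoin_vertex (graph_of (K - {x}) {} {}) x (K - {x}))"
    by (rule k_tree.adjoin[OF 1]) (simp add: graph_of_def)
  moreover have "adjoin_vertex (graph_of (K - {x}) {} {}) x (K - {x}) = graph_of K {} {}"
    using x by (auto simp: adjoin_vertex_def graph_of_def)
  ultimately show "k_tree k (graph_of K {} {})" by simp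
  show "clique (Suc k) (graph_of K {} {}) K" using assms by (auto simp: clique_def graph_of_def)
qed

lemma represents_card:
  assumes "represents k G \<kappa> K N"
  shows "finite K" "card K = Suc k" 
proof -
  show "finite K" using assms by (simp add: represents_def)
  show "card K = Suc k" using card_image[of \<kappa> K] assms by (auto simp: represents_def)
qed

lemma represents_k_tree:
  assumes r: "represents k G \<kappa> K N"
  shows "k_tree k G" "card (hedra k G) = nodes (Node c N)"
proof -
  obtain W E where K: "hang \<kappa> K N W E" "G = graph_of K W E"
    using r by (auto simp: represents_def)
  note fc = represents_card[OF r]
  have WK: "W \<inter> K = {}" by (rule hang_disjoint[OF K(1)])
  have "k_tree k \<lparr>pverts = pverts (graph_of K {} {}) \<union> W, parcs = parcs (graph_of K {} {}) \<union> E\<rparr>"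
    by (rule hang_k_tree[OF K(1) k_tree_hedron[OF fc]]) (use WK in \<open>auto simp: graph_of_def\<close>)
  also have "\<lparr>pverts = pverts (graph_of K {} {}) \<union> W, parcs = parcs (graph_of K {} {}) \<union> E\<rparr> = G"
    by (simp add: K(2) graph_of_def)
  finally show kt: "k_tree k G" .
  have "card (pverts G) = card K + card W"
    using WK fc(1) hang_finite[OF K(1)] by (simp add: K(2) graph_of_def card_Un_disjoint Int_commute)
  then show "card (hedra k G) = nodes (Node c N)"
    using k_tree_card_verts[OF kt] fc hang_card[OF K(1)] by simp
qed

lemma represents_root_tree:
  assumes r: "represents k G \<kappa> K N"
  shows "Node (Suc k) N \<in> trees k (Suc k) (card (hedra k G))"
proof -
  obtain W E where K: "hang \<kappa> K N W E" "\<kappa> ` K = {..k}"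
    using r by (auto simp: represents_def)
  have "\<forall>s\<in>#N. proper k s \<and> col s \<le> k" by (rule hang_proper[OF K(1)]) (simp add: K(2))
  then show ?thesis unfolding represents_k_tree(2)[OF r, of "Suc k"] by (auto simp: trees_def)
qed

lemma fresh_residue:
  assumes "finite S" "j \<le> (k::nat)"
  shows "\<exists>v. v \<notin> S \<and> v mod Suc k = j"
proof -
  obtain m where m: "\<And>a. a \<in> S \<Longrightarrow> a < m" using finite_nat_set_iff_bounded[of S] assms by auto
  have "j + Suc k * m \<notin> S" using m[of "j + Suc k * m"] by auto
  moreover have "(j + Suc k * m) mod Suc k = j" unfolding mod_mult_self2 using assms(2) by simp
  ultimately show ?thesis by blast
qed

lemma hang_exists:
  fixes K :: "nat set"
  assumes "\<And>s. s \<in># N \<Longrightarrow> proper k s \<and> col s \<le> k" "finite F" "finite K" "{..k} \<subseteq> (\<lambda>a. a mod Suc k) ` K"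
  shows "\<exists>W E. hang (\<lambda>a. a mod Suc k) K N W E \<and> W \<inter> F = {}"
  using assms
proof (induction "\<Sum>s\<in>#N. nodes s" arbitrary: N K F rule: less_induct)
  case less
  define \<kappa> where "\<kappa> = (\<lambda>a::nat. a mod Suc k)"
  show ?case
  proof (cases N)
    case empty
    then show ?thesis using hang.empty by blast
  next
    case (add s M)
    obtain j N' where s: "s = Node j N'" by (cases s)
    have pr: "j \<le> k" "\<And>t. t \<in># N' \<Longrightarrow> proper k t \<and> col t \<le> k \<and> col t \<noteq> j" "\<And>t. t \<in># M \<Longrightarrow> proper k t \<and> col t \<le> k"
      using less.prems(1)[of s] less.prems(1) add s by auto
    have lt: "(\<Sum>s\<in>#M. nodes s) < (\<Sum>s\<in>#N. nodes s)" using add s by simp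
    have "\<exists>W E. hang (\<lambda>a. a mod Suc k) K M W E \<and> W \<inter> F = {}"
      by (rule less.hyps[OF lt pr(3) less.prems(2,3,4)])
    then obtain W E where W: "hang \<kappa> K M W E" "W \<inter> F = {}" unfolding \<kappa>_def by blast
    have "finite (F \<union> K \<union> W)" using less.prems hang_finite[OF W(1)] by simp
    then obtain v where v: "v \<notin> F \<union> K \<union> W" "\<kappa> v = j"
      using fresh_residue[of "F \<union> K \<union> W" j k] pr(1) unfolding \<kappa>_def by metis
    have "j \<in> \<kappa> ` K" unfolding \<kappa>_def by (rule subsetD[OF less.prems(4)]) (use pr(1) in simp)
    then obtain x where x: "x \<in> K" "\<kappa> x = j" by blast
    have K': "{..k} \<subseteq> (\<lambda>a. a mod Suc k) ` insert v (K - {x})"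
    proof
      fix i assume i: "i \<in> {..k}"
      then have "i \<in> \<kappa> ` K" unfolding \<kappa>_def by (rule subsetD[OF less.prems(4)])
      then obtain a where a: "a \<in> K" "\<kappa> a = i" by blast
      show "i \<in> (\<lambda>a. a mod Suc k) ` insert v (K - {x})"
      proof (cases "a = x")
        case True
        then have "i = \<kappa> v" using a x v by simp
        then show ?thesis by (auto simp: \<kappa>_def)
      next
        case False
        then show ?thesis using a by (auto simp: \<kappa>_def)
      qed
    qed
    have "\<exists>W' E'. hang (\<lambda>a. a mod Suc k) (insert v (K - {x})) N' W' E' \<and> W' \<inter> (F \<union> K \<union> W) = {}"
    proof (rule less.hyps)
      show "(\<Sum>s\<in>#N'. nodes s) < (\<Sum>s\<in>#N. nodes s)" using add s by simp
      show "proper k t \<and> col t \<le> k" if "t \<in># N'" for t using pr(2)[OF that] by simp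
      show "finite (F \<union> K \<union> W)" by fact
      show "finite (insert v (K - {x}))" using less.prems by simp
      show "{..k} \<subseteq> (\<lambda>a. a mod Suc k) ` insert v (K - {x})" by (rule K')
    qed
    then obtain W' E' where W': "hang \<kappa> (insert v (K - {x})) N' W' E'" "W' \<inter> (F \<union> K \<union> W) = {}"
      unfolding \<kappa>_def by blast
    have "hang \<kappa> K (add_mset (Node (\<kappa> v) N') M) (insert v (W \<union> W')) (E \<union> E' \<union> star v (K - {x}))"
      by (rule hang.add[OF W(1) W'(1)]) (use v x W'(2) pr(2) in auto)
    moreover have "insert v (W \<union> W') \<inter> F = {}" using W(2) W'(2) v by auto
    ultimately show ?thesis unfolding \<kappa>_def[symmetric] using add s v(2) by blast
  qed
qed

lemma exists_represented:
  assumes "Node c N \<in> trees k (Suc k) n"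
  shows "\<exists>(G :: nat pair_pre_digraph) K. represents k G (\<lambda>a. a mod Suc k) K N"
proof -
  have "\<exists>W E. hang (\<lambda>a. a mod Suc k) {..k} N W E \<and> W \<inter> {} = {}"
  proof (rule hang_exists)
    have "i \<in> (\<lambda>a. a mod Suc k) ` {..k}" if "i \<le> k" for i
      using that by (intro image_eqI[of _ _ i]) auto
    then show "{..k} \<subseteq> (\<lambda>a. a mod Suc k) ` {..k}" by auto
  qed (use assms in \<open>auto simp: trees_def\<close>)
  then obtain W E where h: "hang (\<lambda>a. a mod Suc k) {..k} N W E" by blast
  have "represents k (graph_of {..k} W E) (\<lambda>a. a mod Suc k) {..k} N"
    unfolding represents_def using h by (auto simp: inj_on_def intro!: image_eqI)
  then show ?thesis by blast
qed

section \<open>Existence and uniqueness of the encoding\<close>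

lemma missing_colour:
  assumes K: "finite K" "inj_on \<kappa> K" "\<kappa> ` K = {..k}" and C: "C \<subseteq> K" "card C = k" and j: "j \<le> k" "j \<notin> \<kappa> ` C"
  shows "\<exists>x\<in>K. \<kappa> x = j \<and> C = K - {x}"
proof -
  obtain x where x: "x \<in> K" "\<kappa> x = j" using K(3) j(1) by (metis atMost_iff imageE)
  have "C \<subseteq> K - {x}" using C(1) x j(2) by auto
  moreover have "card K = Suc k" using card_image[OF K(2)] K(3) by simp
  then have "card (K - {x}) = card C" using x C(2) by simp
  ultimately have "C = K - {x}" using K(1) by (intro card_subset_eq) auto
  then show ?thesis using x by blast
qed

text \<open>A new vertex \<open>z\<close> joined to a \<open>k\<close>-clique \<open>C\<close>
  becomes a leaf below the hedron closest to the root that contains \<open>C\<close>. The clause on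
  the colours of \<open>N1\<close> strengthens the induction: a new colour among the children arises
  only if \<open>C \<subseteq> K\<close>, which protects the condition that children avoid the
  colour of their parent.\<close>

lemma hang_leaf:
  assumes "hang \<kappa> K N W E" "finite K" "inj_on \<kappa> K" "\<kappa> ` K = {..k}" "C \<subseteq> K \<union> W" "card C = k"
    "\<And>a b. a \<in> C \<Longrightarrow> b \<in> C \<Longrightarrow> a \<noteq> b \<Longrightarrow> a \<in> K \<and> b \<in> K \<or> (a, b) \<in> E"
    "z \<notin> K \<union> W" "\<kappa> z \<le> k" "\<kappa> z \<notin> \<kappa> ` C"
  shows "\<exists>N1. hang \<kappa> K N1 (insert z W) (E \<union> star z C) \<and> (\<forall>s\<in>#N1. s \<in># N \<or> col s \<in> col ` set_mset N \<or> (col s = \<kappa> z \<and> C \<subseteq> K))"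
  using assms
proof (induction rule: hang.induct)
  case (empty K)
  have CK: "C \<subseteq> K" using empty.prems(4) by simp
  obtain x where x: "x \<in> K" "\<kappa> x = \<kappa> z" "C = K - {x}"
    using missing_colour[OF empty.prems(1,2,3) CK empty.prems(5,8,9)] by blast
  have "hang \<kappa> K (add_mset (Node (\<kappa> z) {#}) {#}) (insert z ({} \<union> {})) ({} \<union> {} \<union> star z (K - {x}))"
    by (rule hang.add[OF hang.empty hang.empty]) (use x empty.prems(7) in auto)
  then show ?case using x by (intro exI[of _ "{#Node (\<kappa> z) {#}#}"]) auto
next
  case (add K N W E v x N' W' E')
  have WK: "W \<inter> K = {}" by (rule hang_disjoint[OF add.hyps(1)])
  have W'K: "W' \<inter> insert v (K - {x}) = {}" by (rule hang_disjoint[OF add.hyps(2)])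
  have E: "E \<subseteq> (W \<union> K) \<times> (W \<union> K)" by (rule hang_arcs_square[OF add.hyps(1)])
  have E': "E' \<subseteq> W' \<times> (W' \<union> insert v (K - {x})) \<union> (W' \<union> insert v (K - {x})) \<times> W'"
    by (rule hang_arcs[OF add.hyps(2)])
  show ?case
  proof (cases "C \<subseteq> K \<union> W")
    case True
    have "\<exists>N1. hang \<kappa> K N1 (insert z W) (E \<union> star z C) \<and> (\<forall>s\<in>#N1. s \<in># N \<or> col s \<in> col ` set_mset N \<or> (col s = \<kappa> z \<and> C \<subseteq> K))"
    proof (rule add.IH(1)[OF add.prems(1,2,3) True add.prems(5)])
      fix a b assume ab: "a \<in> C" "b \<in> C" "a \<noteq> b"
      then have "a \<in> K \<union> W" "b \<in> K \<union> W" using True by auto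
      then have nW': "a \<notin> W'" "b \<notin> W'" "a \<noteq> v" "b \<noteq> v"
        using add.hyps(5,6,7,8) W'K by auto
      then have "(a, b) \<notin> E'" "(a, b) \<notin> star v (K - {x})" using E' by (auto simp: star_def)
      then show "a \<in> K \<and> b \<in> K \<or> (a, b) \<in> E" using add.prems(6)[OF ab] by auto
    qed (use add.prems in auto)
    then obtain N1 where N1: "hang \<kappa> K N1 (insert z W) (E \<union> star z C)"
      "\<forall>s\<in>#N1. s \<in># N \<or> col s \<in> col ` set_mset N \<or> (col s = \<kappa> z \<and> C \<subseteq> K)" by blast
    have "hang \<kappa> K (add_mset (Node (\<kappa> v) N') N1) (insert v (insert z W \<union> W')) ((E \<union> star z C) \<union> E' \<union> star v (K - {x}))"
      by (rule hang.add[OF N1(1) add.hyps(2)]) (use add.hyps(3-9) add.prems(7) in auto)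
    moreover have "insert v (insert z W \<union> W') = insert z (insert v (W \<union> W'))" by auto
    moreover have "(E \<union> star z C) \<union> E' \<union> star v (K - {x}) = E \<union> E' \<union> star v (K - {x}) \<union> star z C" by auto
    ultimately show ?thesis using N1(2) by (intro exI[of _ "add_mset (Node (\<kappa> v) N') N1"]) auto
  next
    case False
    \<comment> \<open>Neighbours of vertices in \<open>insert v W'\<close> stay within
      \<open>insert v (K - {x}) \<union> W'\<close>. As \<open>C\<close> is a clique, all of it lies
      in this branch, and the descent goes on there.\<close>
    then obtain c where c: "c \<in> C" "c = v \<or> c \<in> W'" using add.prems(4) by auto
    have cnot: "c \<notin> K" "c \<notin> W"
      using c(2) add.hyps(5,6,7,8) W'K by auto
    define K' where "K' = insert v (K - {x})"
    have arc: "(a, b) \<in> E'" if "a \<in> C" "b \<in> C" "a \<noteq> b" "a \<in> W' \<or> b \<in> W'" for a b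
    proof -
      have "a \<notin> K \<and> a \<notin> W \<and> a \<noteq> v \<or> b \<notin> K \<and> b \<notin> W \<and> b \<noteq> v"
        using that(4) add.hyps(5,6,7,8) W'K by auto
      then have "(a, b) \<notin> E" "(a, b) \<notin> star v (K - {x})" "\<not> (a \<in> K \<and> b \<in> K)"
        using E by (auto simp: star_def)
      then show ?thesis using add.prems(6)[OF that(1,2,3)] by auto
    qed
    have sub: "C \<subseteq> K' \<union> W'"
    proof
      fix a assume a: "a \<in> C"
      show "a \<in> K' \<union> W'"
      proof (cases "a = c \<or> c \<in> W'")
        case True
        then show ?thesis using arc[OF a c(1)] c(2) E' by (auto simp: K'_def)
      next
        case False
        then have "c = v" "a \<noteq> c" using c(2) by auto
        then have "(a, c) \<in> E \<union> E' \<union> star v (K - {x})" using add.prems(6)[OF a c(1)] cnot by auto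
        then show ?thesis using E E' cnot by (auto simp: star_def K'_def)
      qed
    qed
    have K': "finite K'" "inj_on \<kappa> K'" "\<kappa> ` K' = {..k}"
    proof -
      have "\<kappa> ` K' = insert (\<kappa> x) (\<kappa> ` (K - {x}))" using add.hyps(4) by (simp add: K'_def)
      also have "\<dots> = \<kappa> ` K" using add.hyps(3) by blast
      finally show "\<kappa> ` K' = {..k}" using add.prems(3) by simp
      show "inj_on \<kappa> K'" using add.prems(2) add.hyps(3,4,5) by (auto simp: K'_def inj_on_def)
      show "finite K'" using add.prems(1) by (simp add: K'_def)
    qed
    have "\<exists>N1. hang \<kappa> K' N1 (insert z W') (E' \<union> star z C) \<and> (\<forall>s\<in>#N1. s \<in># N' \<or> col s \<in> col ` set_mset N' \<or> (col s = \<kappa> z \<and> C \<subseteq> K'))"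
      unfolding K'_def
    proof (rule add.IH(2)[OF K'[unfolded K'_def] sub[unfolded K'_def] add.prems(5)])
      fix a b assume ab: "a \<in> C" "b \<in> C" "a \<noteq> b"
      show "a \<in> insert v (K - {x}) \<and> b \<in> insert v (K - {x}) \<or> (a, b) \<in> E'"
        using arc[OF ab] sub ab by (auto simp: K'_def)
    qed (use add.prems in auto)
    then obtain N1 where N1: "hang \<kappa> K' N1 (insert z W') (E' \<union> star z C)"
      "\<forall>s\<in>#N1. s \<in># N' \<or> col s \<in> col ` set_mset N' \<or> (col s = \<kappa> z \<and> C \<subseteq> K')" by blast
    \<comment> \<open>If a new colour appears at \<open>K'\<close>, then
      \<open>C \<subseteq> K'\<close> and hence \<open>v \<in> C\<close>; the colour of
      \<open>z\<close> is missing from \<open>C\<close>, so it differs from that of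
      \<open>v\<close>.\<close>
    have cols: "\<forall>s\<in>#N1. col s \<noteq> \<kappa> v"
    proof
      fix s assume s: "s \<in># N1"
      show "col s \<noteq> \<kappa> v"
      proof (cases "col s = \<kappa> z \<and> C \<subseteq> K'")
        case True
        then have "c \<in> K'" using c by auto
        then have "c = v" using c(2) W'K by (auto simp: K'_def)
        then have "\<kappa> z \<noteq> \<kappa> v" using add.prems(9) c(1) by auto
        then show ?thesis using True by simp
      next
        case False
        then show ?thesis using N1(2) s add.hyps(9) by auto
      qed
    qed
    have "hang \<kappa> K (add_mset (Node (\<kappa> v) N1) N) (insert v (W \<union> insert z W')) (E \<union> (E' \<union> star z C) \<union> star v (K - {x}))"
      by (rule hang.add[OF add.hyps(1) N1(1)[unfolded K'_def]]) (use add.hyps(3-8) add.prems(7) cols in auto)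
    moreover have "insert v (W \<union> insert z W') = insert z (insert v (W \<union> W'))" by auto
    moreover have "E \<union> (E' \<union> star z C) \<union> star v (K - {x}) = E \<union> E' \<union> star v (K - {x}) \<union> star z C" by auto
    ultimately show ?thesis by (intro exI[of _ "add_mset (Node (\<kappa> v) N1) N"]) auto
  qed
qed

text \<open>The colouring grows with the k-tree: a new vertex receives a colour missing from its
  clique and is inserted by \<open>hang_leaf\<close>. The start is the first vertex adjoined to the
  complete graph on \<open>k\<close> vertices.\<close>

lemma k_tree_represented:
  assumes "k_tree k G" "hedra k G \<noteq> {}"
  shows "\<exists>\<kappa> K N. represents k G \<kappa> K N"
  using assms
proof (induction rule: k_tree.induct)
  case (complete G)
  then have "finite (pverts G)" "card (pverts G) = k" by (auto simp: complete_digraph_pair_def)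
  then have "hedra k G = {}"
    using card_mono[of "pverts G"] by (fastforce simp: hedra_def clique_def)
  then show ?case using complete by simp
next
  case (adjoin G C v)
  have C: "finite C" "card C = k" "C \<subseteq> pverts G" "\<And>a b. a \<in> C \<Longrightarrow> b \<in> C \<Longrightarrow> a \<noteq> b \<Longrightarrow> (a, b) \<in> parcs G"
    using adjoin.hyps(2) by (auto simp: clique_def)
  show ?case
  proof (cases "hedra k G = {}")
    case False
    obtain \<kappa> K N where r: "represents k G \<kappa> K N" using adjoin.IH[OF False] by blast
    obtain W E where K: "finite K" "inj_on \<kappa> K" "\<kappa> ` K = {..k}" "hang \<kappa> K N W E" "G = graph_of K W E"
      using r by (auto simp: represents_def)
    have v: "v \<notin> K \<union> W" using adjoin.hyps(3) by (simp add: K(5) graph_of_def)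
    have "card (\<kappa> ` C) \<le> k" using card_image_le[OF C(1), of \<kappa>] C(2) by simp
    then have "\<not> {..k} \<subseteq> \<kappa> ` C" using card_mono[of "\<kappa> ` C" "{..k}"] C(1) by auto
    then obtain j where j: "j \<le> k" "j \<notin> \<kappa> ` C" by auto
    define \<kappa>' where "\<kappa>' = \<kappa>(v := j)"
    have eq: "\<kappa>' a = \<kappa> a" if "a \<in> K \<union> W" for a using that v by (auto simp: \<kappa>'_def)
    have CKW: "C \<subseteq> K \<union> W" using C(3) by (simp add: K(5) graph_of_def)
    have h': "hang \<kappa>' K N W E" by (rule hang_cong[OF K(4)]) (use eq in auto)
    have inj': "inj_on \<kappa>' K" using K(2) eq by (auto simp: inj_on_def)
    have im': "\<kappa>' ` K = {..k}" unfolding K(3)[symmetric] by (rule image_cong) (use eq in auto)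
    have jC: "\<kappa>' v \<le> k" "\<kappa>' v \<notin> \<kappa>' ` C"
    proof -
      show "\<kappa>' v \<le> k" using j by (simp add: \<kappa>'_def)
      have "\<kappa>' ` C = \<kappa> ` C" by (rule image_cong) (use eq CKW in auto)
      then show "\<kappa>' v \<notin> \<kappa>' ` C" using j by (simp add: \<kappa>'_def)
    qed
    have "\<exists>N1. hang \<kappa>' K N1 (insert v W) (E \<union> star v C) \<and> (\<forall>s\<in>#N1. s \<in># N \<or> col s \<in> col ` set_mset N \<or> (col s = \<kappa>' v \<and> C \<subseteq> K))"
    proof (rule hang_leaf[OF h' K(1) inj' im' CKW C(2) _ v jC])
      fix a b assume "a \<in> C" "b \<in> C" "a \<noteq> b"
      then show "a \<in> K \<and> b \<in> K \<or> (a, b) \<in> E" using C(4)[of a b] by (auto simp: K(5) graph_of_def)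
    qed
    then obtain N1 where "hang \<kappa>' K N1 (insert v W) (E \<union> star v C)" by blast
    moreover have "adjoin_vertex G v C = graph_of K (insert v W) (E \<union> star v C)"
      by (auto simp: adjoin_vertex_def K(5) graph_of_def star_def)
    ultimately show ?thesis unfolding represents_def using K(1) inj' im' by blast
  next
    case True
    have "card (pverts G) = k" using k_tree_card_verts[OF adjoin.hyps(1)] True by simp
    moreover have "finite (pverts G)"
      using k_tree_graph[OF adjoin.hyps(1)] by (simp add: pair_graph_def pair_digraph_def pair_fin_digraph.pair_finite_verts)
    ultimately have CG: "C = pverts G" using C(2,3) by (intro card_subset_eq) auto
    interpret pair_graph G by (rule k_tree_graph[OF adjoin.hyps(1)])
    have "parcs G = {(a, b). a \<in> C \<and> b \<in> C \<and> a \<noteq> b}"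
      using C(4) no_loops' by (auto simp: CG dest: in_arcsD1 in_arcsD2)
    then have e: "adjoin_vertex G v C = graph_of (insert v C) {} {}"
      using adjoin.hyps(3) by (auto simp: adjoin_vertex_def graph_of_def CG)
    have "card (insert v C) = card {..k}" using C(1,2) adjoin.hyps(3) CG by simp
    then obtain \<kappa> where \<kappa>: "bij_betw \<kappa> (insert v C) {..k}"
      using finite_same_card_bij[of "insert v C" "{..k}"] C(1) by auto
    have "represents k (adjoin_vertex G v C) \<kappa> (insert v C) {#}"
      unfolding represents_def e using \<kappa> C(1) hang.empty[of \<kappa> "insert v C"] by (auto simp: bij_betw_def)
    then show ?thesis by blast
  qed
qed

text \<open>
  The first argument is fuel. The colouring is only ever consulted on the current hedron, so the
  tree is determined by the graph, the root hedron and the colours of its \<open>k + 1\<close> vertices.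
\<close>

primrec read_tree :: "nat \<Rightarrow> 'a pair_pre_digraph \<Rightarrow> ('a \<Rightarrow> nat) \<Rightarrow> 'a set \<Rightarrow> nat \<Rightarrow> tree" where
  "read_tree 0 G \<kappa> K c = Node c {#}"
| "read_tree (Suc m) G \<kappa> K c = Node c (image_mset
     (\<lambda>(x, v). read_tree m G (\<kappa>(v := \<kappa> x)) (insert v (K - {x})) (\<kappa> x))
     (mset_set {(x, v). x \<in> K \<and> \<kappa> x \<noteq> c \<and> v \<in> pverts G - K \<and> (\<forall>u\<in>K - {x}. (v, u) \<in> parcs G)}))"

lemma read_tree_cong:
  "(\<And>x. x \<in> K \<Longrightarrow> \<kappa> x = \<kappa>' x) \<Longrightarrow> read_tree m G \<kappa> K c = read_tree m G \<kappa>' K c"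
proof (induction m arbitrary: \<kappa> \<kappa>' K c)
  case (Suc m)
  define P where "P \<kappa> = {(x, v). x \<in> K \<and> \<kappa> x \<noteq> c \<and> v \<in> pverts G - K \<and> (\<forall>u\<in>K - {x}. (v, u) \<in> parcs G)}" for \<kappa>
  have P: "P \<kappa> = P \<kappa>'" using Suc.prems by (auto simp: P_def)
  have "image_mset (\<lambda>(x, v). read_tree m G (\<kappa>(v := \<kappa> x)) (insert v (K - {x})) (\<kappa> x)) (mset_set (P \<kappa>'))
     = image_mset (\<lambda>(x, v). read_tree m G (\<kappa>'(v := \<kappa>' x)) (insert v (K - {x})) (\<kappa>' x)) (mset_set (P \<kappa>'))"
  proof (rule image_mset_cong)
    fix xv assume xv: "xv \<in># mset_set (P \<kappa>')"
    have "xv \<in> P \<kappa>'" using xv by (cases "finite (P \<kappa>')") auto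
    then obtain x v where e: "xv = (x, v)" "x \<in> K" unfolding P_def by blast
    have "read_tree m G (\<kappa>(v := \<kappa> x)) (insert v (K - {x})) (\<kappa> x) = read_tree m G (\<kappa>'(v := \<kappa>' x)) (insert v (K - {x})) (\<kappa> x)"
      by (rule Suc.IH) (use Suc.prems e in auto)
    then show "(case xv of (x, v) \<Rightarrow> read_tree m G (\<kappa>(v := \<kappa> x)) (insert v (K - {x})) (\<kappa> x))
      = (case xv of (x, v) \<Rightarrow> read_tree m G (\<kappa>'(v := \<kappa>' x)) (insert v (K - {x})) (\<kappa>' x))"
      using Suc.prems e by simp
  qed
  then show ?case unfolding read_tree.simps P_def[symmetric] P by simp
qed simp

text \<open>A branch replaces a vertex of \<open>K\<close> of its own colour, and no vertex of the
  branch is adjacent to the replaced one. Since children avoid the colour of their parent, vertices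
  deeper in a branch miss two vertices of \<open>K\<close>; this is how \<open>read_hang\<close>
  tells children from later descendants.\<close>

lemma hang_nonadjacent:
  assumes "hang \<kappa> K N W E" "w \<in> W"
  shows "\<exists>x\<in>K. (w, x) \<notin> E \<and> \<kappa> x \<in> col ` set_mset N"
  using assms
proof (induction rule: hang.induct)
  case (add K N W E v x N' W' E')
  have WK: "W \<inter> K = {}" by (rule hang_disjoint[OF add.hyps(1)])
  have W'K: "W' \<inter> insert v (K - {x}) = {}" by (rule hang_disjoint[OF add.hyps(2)])
  have E: "E \<subseteq> (W \<union> K) \<times> (W \<union> K)" by (rule hang_arcs_square[OF add.hyps(1)])
  have E': "E' \<subseteq> (W' \<union> insert v (K - {x})) \<times> (W' \<union> insert v (K - {x}))" by (rule hang_arcs_square[OF add.hyps(2)])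
  have xE': "(a, x) \<notin> E'" for a using E' add.hyps(3,5,8) by auto
  have xs: "(a, x) \<notin> star v (K - {x})" if "a \<noteq> x" for a using that add.hyps(3,5) by (auto simp: star_def)
  have col: "\<kappa> x \<in> col ` set_mset (add_mset (Node (\<kappa> v) N') N)" using add.hyps(4) by simp
  consider "w = v" | "w \<in> W" | "w \<in> W'" using add.prems by auto
  then show ?case
  proof cases
    case 1
    have "(w, x) \<notin> E" "w \<noteq> x" using 1 E add.hyps(3,5,6) by auto
    then show ?thesis using xE' xs col add.hyps(3) by (intro bexI[of _ x]) auto
  next
    case 2
    obtain y where y: "y \<in> K" "(w, y) \<notin> E" "\<kappa> y \<in> col ` set_mset N" using add.IH(1)[OF 2] by blast
    have "w \<notin> W'" "w \<noteq> v" "w \<notin> K" using 2 add.hyps(6,7) WK by auto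
    then have "(w, y) \<notin> E'" "(w, y) \<notin> star v (K - {x})" using E' by (auto simp: star_def)
    then show ?thesis using y by (intro bexI[of _ y]) auto
  next
    case 3
    have "w \<noteq> x" "w \<notin> W" "w \<notin> K" using 3 add.hyps(7,8) W'K by auto
    then have "(w, x) \<notin> E" "w \<noteq> x" using E by auto
    then show ?thesis using xE' xs col add.hyps(3) by (intro bexI[of _ x]) auto
  qed
qed simp

text \<open>The ambient graph \<open>G\<close> stays fixed during the induction. It may be larger
  than the hung part but must have no arcs at \<open>W\<close> other than \<open>E\<close>, a
  condition inherited by the branches.\<close>

lemma read_hang:
  assumes "hang \<kappa> K N W E" "inj_on \<kappa> K" "finite K" "E \<subseteq> parcs G" "W \<subseteq> pverts G"
    "\<And>a b. (a, b) \<in> parcs G \<Longrightarrow> a \<in> W \<or> b \<in> W \<Longrightarrow> (a, b) \<in> E"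
    "\<And>a b. a \<in> K \<Longrightarrow> b \<in> K \<Longrightarrow> a \<noteq> b \<Longrightarrow> (a, b) \<in> parcs G" "(\<Sum>s\<in>#N. nodes s) \<le> m"
  shows "image_mset (\<lambda>(x, v). read_tree m G (\<kappa>(v := \<kappa> x)) (insert v (K - {x})) (\<kappa> x))
     (mset_set {(x, v). x \<in> K \<and> v \<in> W \<and> (\<forall>u\<in>K - {x}. (v, u) \<in> parcs G)}) = N"
  using assms
proof (induction arbitrary: m rule: hang.induct)
  case (add K N W E v x N' W' E')
  note amb = add.prems(5)
  have WK: "W \<inter> K = {}" by (rule hang_disjoint[OF add.hyps(1)])
  have W'K: "W' \<inter> insert v (K - {x}) = {}" by (rule hang_disjoint[OF add.hyps(2)])
  have E: "E \<subseteq> (W \<union> K) \<times> (W \<union> K)" by (rule hang_arcs_square[OF add.hyps(1)])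
  have E': "E' \<subseteq> W' \<times> (W' \<union> insert v (K - {x})) \<union> (W' \<union> insert v (K - {x})) \<times> W'"
    by (rule hang_arcs[OF add.hyps(2)])
  define K' where "K' = insert v (K - {x})"
  have ambW: "(a, b) \<in> E" if "(a, b) \<in> parcs G" "a \<in> W \<or> b \<in> W" for a b
  proof -
    have "(a, b) \<in> E \<union> E' \<union> star v (K - {x})" by (rule amb) (use that in auto)
    moreover have "a \<notin> W' \<union> K' \<or> b \<notin> W' \<union> K'" using that(2) add.hyps(6,7) WK by (auto simp: K'_def)
    then have "(a, b) \<notin> E'" "(a, b) \<notin> star v (K - {x})" using E' by (auto simp: star_def K'_def)
    ultimately show ?thesis by auto
  qed
  have ambW': "(a, b) \<in> E'" if "(a, b) \<in> parcs G" "a \<in> W' \<or> b \<in> W'" for a b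
  proof -
    have "(a, b) \<in> E \<union> E' \<union> star v (K - {x})" by (rule amb) (use that in auto)
    moreover have "a \<notin> W \<union> K \<and> a \<noteq> v \<or> b \<notin> W \<union> K \<and> b \<noteq> v" using that(2) add.hyps(7,8) W'K by auto
    then have "(a, b) \<notin> E" "(a, b) \<notin> star v (K - {x})" using E by (auto simp: star_def)
    ultimately show ?thesis by auto
  qed
  have vK: "(v, a) \<in> parcs G" "(a, v) \<in> parcs G" if "a \<in> K - {x}" for a
    using that add.prems(3) by (auto simp: star_def)
  have K': "inj_on \<kappa> K'" "finite K'"
    using add.prems(1,2) add.hyps(3,4,5) by (auto simp: K'_def inj_on_def)
  have cliqueK': "(a, b) \<in> parcs G" if "a \<in> K'" "b \<in> K'" "a \<noteq> b" for a b
    using that add.prems(6) vK by (auto simp: K'_def)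
  define A where "A = {(x1, w). x1 \<in> K \<and> w \<in> insert v (W \<union> W') \<and> (\<forall>u\<in>K - {x1}. (w, u) \<in> parcs G)}"
  define B where "B = {(x1, w). x1 \<in> K \<and> w \<in> W \<and> (\<forall>u\<in>K - {x1}. (w, u) \<in> parcs G)}"
  define f where "f m = (\<lambda>(x, v). read_tree m G (\<kappa>(v := \<kappa> x)) (insert v (K - {x})) (\<kappa> x))" for m
  have vx: "(v, x) \<notin> parcs G"
  proof
    assume "(v, x) \<in> parcs G"
    then have "(v, x) \<in> E \<union> E' \<union> star v (K - {x})" by (rule amb) simp
    then show False using E E' WK add.hyps(3,5,6,8) by (auto simp: star_def)
  qed
  have W'x: "(w, x) \<notin> parcs G" if "w \<in> W'" for w
  proof
    assume "(w, x) \<in> parcs G"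
    then have "(w, x) \<in> E'" using ambW' that by blast
    then show False using E' add.hyps(3,5,8) by auto
  qed
  have AB: "A = insert (x, v) B"
  proof (intro equalityI subsetI)
    fix q assume "q \<in> A"
    then obtain x1 w where q: "q = (x1, w)" "x1 \<in> K" "w \<in> insert v (W \<union> W')" "\<forall>u\<in>K - {x1}. (w, u) \<in> parcs G"
      unfolding A_def by blast
    consider "w = v" | "w \<in> W" | "w \<in> W'" using q(3) by auto
    then show "q \<in> insert (x, v) B"
    proof cases
      case 1
      then have "x1 = x" using q(4) vx add.hyps(3) by auto
      then show ?thesis using 1 q by simp
    next
      case 2
      then show ?thesis using q by (auto simp: B_def)
    next
      case 3
      \<comment> \<open>A vertex \<open>w\<close> of \<open>W'\<close> misses \<open>x\<close> and a
        further vertex \<open>x'\<close> of \<open>K - {x}\<close>, so it cannot be adjacent to all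
        but one vertex of \<open>K\<close>.\<close>
      obtain x' where x': "x' \<in> insert v (K - {x})" "(w, x') \<notin> E'" "\<kappa> x' \<in> col ` set_mset N'"
        using hang_nonadjacent[OF add.hyps(2) 3] by blast
      have "x' \<noteq> v" using x'(3) add.hyps(9) by auto
      then have "x' \<in> K - {x}" using x'(1) by auto
      moreover have "(w, x') \<notin> parcs G" using ambW' 3 x'(2) by blast
      ultimately have "x' = x1" "x' \<noteq> x" using q(4) by auto
      then have "x \<in> K - {x1}" using add.hyps(3) by auto
      then have False using q(4) W'x[OF 3] by blast
      then show ?thesis ..
    qed
  next
    fix q assume "q \<in> insert (x, v) B"
    then show "q \<in> A" using vK(1) add.hyps(3) unfolding A_def B_def by auto
  qed
  have xvB: "(x, v) \<notin> B" using add.hyps(6) by (simp add: B_def)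
  have finB: "finite B"
    by (rule finite_subset[of _ "K \<times> W"]) (use add.prems(2) hang_finite[OF add.hyps(1)] in \<open>auto simp: B_def\<close>)
  have IH1: "image_mset (f m) (mset_set B) = N"
    unfolding f_def B_def
    by (rule add.IH(1)) (use add.prems(1-4,6,7) ambW in auto)
  obtain m' where m': "m = Suc m'" using add.prems(7) by (cases m) auto
  have "f m (x, v) = Node (\<kappa> v) N'"
  proof -
    have upd: "\<kappa>(v := \<kappa> x) = \<kappa>" using add.hyps(4) by (simp add: fun_upd_idem)
    \<comment> \<open>The left side is what \<open>read_tree\<close> inspects at \<open>K'\<close>.
      Its colour condition excludes replacing \<open>v\<close>, which would lead back to
      \<open>K\<close> or to a sibling; any other candidate is adjacent to \<open>v\<close> and
      therefore lies in \<open>W'\<close>.\<close>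
    have "{(x', w). x' \<in> K' \<and> \<kappa> x' \<noteq> \<kappa> v \<and> w \<in> pverts G - K' \<and> (\<forall>u\<in>K' - {x'}. (w, u) \<in> parcs G)}
       = {(x', w). x' \<in> K' \<and> w \<in> W' \<and> (\<forall>u\<in>K' - {x'}. (w, u) \<in> parcs G)}" (is "?L = ?R")
    proof (intro equalityI subsetI)
      fix q assume "q \<in> ?L"
      then obtain x' w where q: "q = (x', w)" "x' \<in> K'" "\<kappa> x' \<noteq> \<kappa> v" "w \<in> pverts G - K'" "\<forall>u\<in>K' - {x'}. (w, u) \<in> parcs G"
        by blast
      have "v \<in> K' - {x'}" using q(3) by (auto simp: K'_def)
      then have "(w, v) \<in> parcs G" using q(5) by blast
      then have "(w, v) \<in> E \<union> E' \<union> star v (K - {x})" by (rule amb) simp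
      moreover have "(w, v) \<notin> E" using E add.hyps(5,6) by auto
      moreover have "(w, v) \<notin> star v (K - {x})" using q(4) add.hyps(5) by (auto simp: star_def K'_def)
      ultimately have "(w, v) \<in> E'" by blast
      then have "w \<in> W'" using E' q(4) W'K by (auto simp: K'_def)
      then show "q \<in> ?R" using q by blast
    next
      fix q assume "q \<in> ?R"
      then obtain x' w where q: "q = (x', w)" "x' \<in> K'" "w \<in> W'" "\<forall>u\<in>K' - {x'}. (w, u) \<in> parcs G" by blast
      have "w \<in> pverts G - K'" using q(3) add.prems(4) W'K by (auto simp: K'_def)
      moreover have "\<kappa> x' \<noteq> \<kappa> v"
      proof
        assume "\<kappa> x' = \<kappa> v"
        then have "x' = v" using inj_onD[OF K'(1)] q(2) by (auto simp: K'_def)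
        obtain y where y: "y \<in> insert v (K - {x})" "(w, y) \<notin> E'" "\<kappa> y \<in> col ` set_mset N'"
          using hang_nonadjacent[OF add.hyps(2) q(3)] by blast
        have "y \<noteq> v" using y(3) add.hyps(9) by auto
        then have "(w, y) \<in> parcs G" using q(4) y(1) \<open>x' = v\<close> by (auto simp: K'_def)
        then show False using ambW' q(3) y(2) by blast
      qed
      ultimately show "q \<in> ?L" using q by blast
    qed
    moreover have "image_mset (\<lambda>(x, v). read_tree m' G (\<kappa>(v := \<kappa> x)) (insert v (K' - {x})) (\<kappa> x)) (mset_set ?R) = N'"
      unfolding K'_def
    proof (rule add.IH(2))
      show "(\<Sum>s\<in>#N'. nodes s) \<le> m'" using add.prems(7) m' by simp
      show "(a, b) \<in> parcs G" if "a \<in> insert v (K - {x})" "b \<in> insert v (K - {x})" "a \<noteq> b" for a b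
        using cliqueK' that by (simp add: K'_def)
    qed (use K' add.prems(3,4) ambW' in \<open>auto simp: K'_def\<close>)
    ultimately show ?thesis
      unfolding f_def m' prod.case upd read_tree.simps K'_def[symmetric] using add.hyps(4) by simp
  qed
  then have "image_mset (f m) (mset_set A) = add_mset (Node (\<kappa> v) N') N"
    unfolding AB using finB xvB IH1 by simp
  then show ?case unfolding A_def f_def .
qed simp

lemma read_represents:
  assumes r: "represents k G \<kappa> K N" and m: "nodes (Node (Suc k) N) \<le> m"
  shows "read_tree m G \<kappa> K (Suc k) = Node (Suc k) N"
proof -
  obtain W E where K: "finite K" "inj_on \<kappa> K" "\<kappa> ` K = {..k}" "hang \<kappa> K N W E" "G = graph_of K W E"
    using r by (auto simp: represents_def)
  have WK: "W \<inter> K = {}" by (rule hang_disjoint[OF K(4)])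
  obtain m' where m': "m = Suc m'" "(\<Sum>s\<in>#N. nodes s) \<le> m'" using m by (cases m) auto
  have c: "\<kappa> x \<noteq> Suc k" if "x \<in> K" for x using K(3) that by (metis atMost_iff imageI not_less_eq_eq order_refl)
  have "{(x, v). x \<in> K \<and> \<kappa> x \<noteq> Suc k \<and> v \<in> pverts G - K \<and> (\<forall>u\<in>K - {x}. (v, u) \<in> parcs G)}
     = {(x, v). x \<in> K \<and> v \<in> W \<and> (\<forall>u\<in>K - {x}. (v, u) \<in> parcs G)}"
    using c WK by (auto simp: K(5) graph_of_def)
  moreover have "image_mset (\<lambda>(x, v). read_tree m' G (\<kappa>(v := \<kappa> x)) (insert v (K - {x})) (\<kappa> x))
     (mset_set {(x, v). x \<in> K \<and> v \<in> W \<and> (\<forall>u\<in>K - {x}. (v, u) \<in> parcs G)}) = N"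
    by (rule read_hang[OF K(4,2,1)]) (use m'(2) WK in \<open>auto simp: K(5) graph_of_def\<close>)
  ultimately show ?thesis unfolding m'(1) read_tree.simps by simp
qed

section \<open>Diameters\<close>

lemma graph_distance_le:
  assumes G: "pair_graph G" and u: "u \<in> pverts G" and uv: "(u, v) \<in> parcs G ^^ l"
  shows "graph_distance G u v \<le> ereal (real l)"
proof -
  interpret pair_graph G by (rule G)
  have cost: "awalk_cost (\<lambda>_. 1) p = real (length p)" for p by (induction p) auto
  have "\<exists>p. awalk u p v \<and> length p = l"
    using u uv
  proof (induction l arbitrary: u)
    case 0
    then show ?case by (intro exI[of _ "[]"]) (simp add: awalk_Nil_iff)
  next
    case (Suc l)
    obtain w where w: "(u, w) \<in> parcs G" "(w, v) \<in> parcs G ^^ l" using Suc.prems(2) by (meson relpow_Suc_D2)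
    then have "w \<in> pverts G" by (auto dest: in_arcsD2)
    then obtain p where p: "awalk w p v" "length p = l" using Suc.IH w(2) by blast
    have "awalk u ((u, w) # p) v" using w(1) p(1) by (simp add: awalk_Cons_iff)
    then show ?case using p(2) by (intro exI[of _ "(u, w) # p"]) simp
  qed
  then obtain p where p: "awalk u p v" "length p = l" by blast
  have "\<mu> (\<lambda>_. 1) u v \<le> ereal (awalk_cost (\<lambda>_. 1) p)"
    unfolding \<mu>_def by (rule INF_lower) (use p in simp)
  then show ?thesis unfolding graph_distance_def using p(2) by (simp add: cost)
qed

lemma relpow_mono_base:
  fixes R S :: "('a \<times> 'a) set"
  shows "R \<subseteq> S \<Longrightarrow> R ^^ n \<subseteq> S ^^ n"
  by (induction n) auto

text \<open>A vertex below \<open>v\<close> reaches \<open>insert v (K - {x})\<close> within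
  \<open>h - 1\<close> steps. If it arrives at \<open>v\<close>, one more step leads into
  \<open>K - {x}\<close>, which is nonempty because \<open>K\<close> has at least two
  vertices.\<close>

lemma hang_depth:
  assumes "hang \<kappa> K N W E" "\<forall>s\<in>#N. Suc (height s) \<le> h" "\<forall>x. K - {x} \<noteq> {}" "w \<in> W"
  shows "\<exists>u\<in>K. \<exists>l\<le>h. (w, u) \<in> E ^^ l"
  using assms
proof (induction arbitrary: h rule: hang.induct)
  case (add K N W E v x N' W' E')
  define E0 where "E0 = E \<union> E' \<union> star v (K - {x})"
  have mono: "E ^^ l \<subseteq> E0 ^^ l" "E' ^^ l \<subseteq> E0 ^^ l" for l
    by (rule relpow_mono_base; auto simp: E0_def)+
  obtain y where y: "y \<in> K - {x}" using add.prems(2) by blast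
  then have vy: "(v, y) \<in> E0" by (simp add: E0_def star_def)
  have h: "height (Node (\<kappa> v) N') < h" using add.prems(1) by auto
  consider "w = v" | "w \<in> W" | "w \<in> W'" using add.prems(3) by auto
  then have "\<exists>u\<in>K. \<exists>l\<le>h. (w, u) \<in> E0 ^^ l"
  proof cases
    case 1
    then have "(w, y) \<in> E0 ^^ 1" "1 \<le> h" using vy h by auto
    then show ?thesis using y by blast
  next
    case 2
    obtain u l where "u \<in> K" "l \<le> h" "(w, u) \<in> E ^^ l"
      using add.IH(1)[OF _ add.prems(2) 2, of h] add.prems(1) by auto
    then show ?thesis using mono(1) by blast
  next
    case 3
    have 1: "\<forall>s\<in>#N'. Suc (height s) \<le> h - 1"
      using height_ge[of _ N' "\<kappa> v"] h by fastforce
    have 2: "\<forall>z. insert v (K - {x}) - {z} \<noteq> {}"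
    proof
      fix z
      show "insert v (K - {x}) - {z} \<noteq> {}"
        using y add.hyps(5) by (cases "z = v") auto
    qed
    obtain u l where u: "u \<in> insert v (K - {x})" "l \<le> h - 1" "(w, u) \<in> E' ^^ l"
      using add.IH(2)[OF 1 2 3] by blast
    show ?thesis
    proof (cases "u = v")
      case True
      then have "(w, y) \<in> E0 ^^ Suc l" using u(3) mono(2) vy by (intro relpow_Suc_I) auto
      moreover have "Suc l \<le> h" using u(2) h by simp
      ultimately show ?thesis using y by blast
    next
      case False
      then have "u \<in> K" "l \<le> h" using u by auto
      then show ?thesis using u(3) mono(2) by blast
    qed
  qed
  then show ?case by (simp only: E0_def)
qed simp

text \<open>Both vertices walk to the root hedron; the additional 1 is a step inside it.\<close>

lemma represents_diameter:
  assumes r: "represents k G \<kappa> K N" and k: "k \<ge> 1"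
  shows "graph_diameter G \<le> ereal (real (2 * height (Node c N) + 1))"
proof -
  obtain W E where K: "hang \<kappa> K N W E" "G = graph_of K W E"
    using r by (auto simp: represents_def)
  define h where "h = height (Node c N)"
  have G: "pair_graph G" using k_tree_graph[OF represents_k_tree(1)[OF r]] .
  have h: "\<forall>s\<in>#N. Suc (height s) \<le> h" using height_ge[of _ N c] by (auto simp: h_def simp del: height.simps)
  have ne: "\<forall>x. K - {x} \<noteq> {}"
  proof safe
    fix x assume "K - {x} = {}"
    then have "card K \<le> card {x}" by (intro card_mono) auto
    then show False using represents_card(2)[OF r] k by simp
  qed
  have E: "E ^^ l \<subseteq> parcs G ^^ l" for l by (rule relpow_mono_base) (auto simp: K(2) graph_of_def)
  have near: "\<exists>a\<in>K. \<exists>l\<le>h. (u, a) \<in> parcs G ^^ l" if "u \<in> pverts G" for u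
  proof (cases "u \<in> K")
    case True
    then show ?thesis by (intro bexI[of _ u] exI[of _ 0]) auto
  next
    case False
    then have "u \<in> W" using that by (simp add: K(2) graph_of_def)
    then obtain a l where "a \<in> K" "l \<le> h" "(u, a) \<in> E ^^ l" using hang_depth[OF K(1) h ne] by blast
    then show ?thesis using E by blast
  qed
  have "sym (parcs G)"
  proof -
    interpret pair_graph G by (rule G)
    show ?thesis using pair_sym_arcs by (simp add: symmetric_def)
  qed
  then have sym: "sym (parcs G ^^ l)" for l
  proof (induction l)
    case (Suc l)
    then have "sym (parcs G ^^ l)" by blast
    then have "(parcs G ^^ Suc l)\<inverse> = parcs G ^^ Suc l"
      using Suc.prems by (simp add: converse_relcomp sym_conv_converse_eq relpow_commute)
    then show ?case by (simp add: sym_conv_converse_eq)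
  qed (auto simp: sym_def)
  have "graph_distance G u v \<le> ereal (real (2 * h + 1))" if uv: "u \<in> pverts G" "v \<in> pverts G" for u v
  proof -
    obtain a l where a: "a \<in> K" "l \<le> h" "(u, a) \<in> parcs G ^^ l" using near[OF uv(1)] by blast
    obtain b m where b: "b \<in> K" "m \<le> h" "(v, b) \<in> parcs G ^^ m" using near[OF uv(2)] by blast
    have b': "(b, v) \<in> parcs G ^^ m" using symD[OF sym b(3)] .
    have "\<exists>q\<le>1. (a, b) \<in> parcs G ^^ q"
    proof (cases "a = b")
      case True
      then show ?thesis by (intro exI[of _ 0]) auto
    next
      case False
      then have "(a, b) \<in> parcs G" using a b by (simp add: K(2) graph_of_def)
      then show ?thesis by (intro exI[of _ 1]) auto
    qed
    then obtain q where q: "q \<le> 1" "(a, b) \<in> parcs G ^^ q" by blast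
    have "(u, v) \<in> parcs G ^^ (l + (q + m))"
      unfolding relpow_add using a(3) q(2) b' by blast
    then have "graph_distance G u v \<le> ereal (real (l + (q + m)))"
      by (rule graph_distance_le[OF G uv(1)])
    also have "\<dots> \<le> ereal (real (2 * h + 1))" using a(2) b(2) q(1) by simp
    finally show ?thesis .
  qed
  then show ?thesis unfolding graph_diameter_def h_def by (intro SUP_least) blast
qed

lemma digraph_iso_imp_relabel:
  assumes iso: "digraph_iso (with_proj G) (with_proj H)"
  shows "\<exists>f. inj_on f (pverts G) \<and> H = relabel f G"
proof -
  obtain h where h: "pre_digraph.digraph_isomorphism (with_proj G) h" "with_proj H = app_iso h (with_proj G)"
    using iso by (auto simp: digraph_iso_def)
  have 1: "inj_on (iso_verts h) (pverts G)"
    and 2: "\<And>a. a \<in> parcs G \<Longrightarrow> iso_verts h (fst a) = iso_tail h (iso_arcs h a) \<and> iso_verts h (snd a) = iso_head h (iso_arcs h a)"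
    using h(1) by (auto simp: pre_digraph.digraph_isomorphism_def)
  have verts: "pverts H = iso_verts h ` pverts G" and arcs: "parcs H = iso_arcs h ` parcs G"
    and tail: "iso_tail h = fst" and head: "iso_head h = snd"
    using arg_cong[OF h(2), of verts] arg_cong[OF h(2), of arcs] arg_cong[OF h(2), of tail] arg_cong[OF h(2), of head]
    by simp_all
  have "iso_arcs h ` parcs G = map_prod (iso_verts h) (iso_verts h) ` parcs G"
  proof (rule image_cong)
    fix a assume "a \<in> parcs G"
    then show "iso_arcs h a = map_prod (iso_verts h) (iso_verts h) a"
      using 2[of a] unfolding tail head by (cases a, cases "iso_arcs h a") auto
  qed simp
  then have "H = relabel (iso_verts h) G" using verts arcs by (simp add: relabel_def)
  then show ?thesis using 1 by blast
qed

text \<open>Reroot at a branch \<open>s\<close> of height \<open>H - 1\<close>. Its subtrees move up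
  one level and cannot account for height \<open>H\<close> any more, so by minimality another branch
  does: one of the same colour and height at least \<open>H - 1\<close>, or one below the old root,
  which moved down, of height at least \<open>H - 2\<close>.\<close>

lemma represents_height_minimal:
  assumes r: "represents k G \<kappa> K N" and H: "height (Node c N) = H" "H \<ge> 2"
    and min: "\<And>\<kappa>' K' N'. represents k G \<kappa>' K' N' \<Longrightarrow> H \<le> height (Node c N')"
  shows "\<exists>s s' M. N = add_mset s (add_mset s' M) \<and> height s = H - 1 \<and> (height s' = H - 1 \<or> height s' = H - 2)"
proof -
  have le: "height t \<le> H - 1" if "t \<in># N" for t using height_ge[OF that, of c] H by (simp del: height.simps)
  have "height (Node c N) = Suc (H - 1)" using H by simp
  then obtain s where s: "s \<in># N" "height s = H - 1" using height_Suc by blast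
  obtain j N' where sj: "s = Node j N'" by (cases s)
  define M where "M = N - {#s#}"
  have N: "N = add_mset s M" using s(1) by (simp add: M_def)
  define B where "B = filter_mset (\<lambda>t. \<not> col t = j) M"
  define A where "A = filter_mset (\<lambda>t. col t = j) M"
  obtain K' where "represents k G \<kappa> K' (add_mset (Node j B) (A + N'))"
    using represents_reroot[OF r s(1) sj] unfolding M_def[symmetric] A_def[symmetric] B_def[symmetric] by blast
  then have "H \<le> height (Node c (add_mset (Node j B) (A + N')))" by (rule min)
  then obtain h where h: "height (Node c (add_mset (Node j B) (A + N'))) = Suc h" "H - 1 \<le> h"
    using H(2) by (cases "height (Node c (add_mset (Node j B) (A + N')))") auto
  obtain t where t: "t \<in># add_mset (Node j B) (A + N')" "height t = h" using height_Suc[OF h(1)] by blast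
  have "\<exists>s'\<in>#M. height s' = H - 1 \<or> height s' = H - 2"
  proof -
    consider "t = Node j B" | "t \<in># A" | "t \<in># N'" using t(1) by auto
    then show ?thesis
    proof cases
      case 1
      then obtain h' where h': "height (Node j B) = Suc h'" "H - 2 \<le> h'"
        using t(2) h(2) H(2) by (cases h) auto
      obtain s' where s': "s' \<in># B" "height s' = h'" using height_Suc[OF h'(1)] by blast
      then have "s' \<in># M" by (simp add: B_def)
      moreover have "height s' \<le> H - 1" using le[of s'] \<open>s' \<in># M\<close> N by simp
      ultimately show ?thesis using s'(2) h'(2) by (intro bexI[of _ s']) auto
    next
      case 2
      then have "t \<in># M" by (simp add: A_def)
      moreover have "height t \<le> H - 1" using le[of t] \<open>t \<in># M\<close> N by simp
      ultimately show ?thesis using t(2) h(2) by (intro bexI[of _ t]) auto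
    next
      case 3
      have "Suc (height t) \<le> height (Node j N')" by (rule height_ge[OF 3])
      then show ?thesis using t(2) h(2) s(2) sj H(2) by simp
    qed
  qed
  then obtain s' where s': "s' \<in># M" "height s' = H - 1 \<or> height s' = H - 2" by blast
  then obtain M' where "M = add_mset s' M'" by (meson multi_member_split)
  then show ?thesis using N s(2) s'(2) by blast
qed

section \<open>Comparing isomorphism classes with rooted trees\<close>

lemma unlabelled_class:
  assumes "U \<in> unlabelled_k_trees k n" "G \<in> U"
  shows "G \<in> k_trees k n" "U = isomorphic_k_trees k n `` {G}"
proof -
  obtain G0 where G0: "G0 \<in> k_trees k n" "U = isomorphic_k_trees k n `` {G0}"
    using assms(1) by (auto simp: unlabelled_k_trees_def elim: quotientE)
  then have "(G0, G) \<in> isomorphic_k_trees k n" using assms(2) by simp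
  then show "U = isomorphic_k_trees k n `` {G}" using G0 equiv_class_eq[OF equiv_isomorphic_k_trees] by blast
  show "G \<in> k_trees k n" using \<open>(G0, G) \<in> _\<close> by (simp add: isomorphic_k_trees_def)
qed

lemma unlabelled_class_nonempty:
  assumes "U \<in> unlabelled_k_trees k n" shows "\<exists>G. G \<in> U"
  using in_quotient_imp_non_empty[OF equiv_isomorphic_k_trees] assms by (fastforce simp: unlabelled_k_trees_def)

text \<open>Each class is sent to an encoding of least height, which is tall by
  \<open>represents_diameter\<close> and has two tall branches by minimality. The map is injective
  because a tree determines its graph up to isomorphism.\<close>

lemma card_diameter_ge:
  assumes k: "k \<ge> 1" and n: "n \<ge> 1" and H0: "H0 \<ge> 2" "real (2 * H0) - 1 < x"
  shows "card {U \<in> unlabelled_k_trees k n. unlabelled_diameter U \<ge> ereal x} \<le> card (balanced_tall k n H0)"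
proof -
  define S where "S = {U \<in> unlabelled_k_trees k n. unlabelled_diameter U \<ge> ereal x}"
  define R where "R U t \<longleftrightarrow> (\<exists>G\<in>U. \<exists>\<kappa> K. represents k G \<kappa> K (sub t))" for U :: "nat pair_pre_digraph set" and t
  have ex: "\<exists>t\<in>balanced_tall k n H0. R U t" if U: "U \<in> S" for U
  proof -
    have U1: "U \<in> unlabelled_k_trees k n" "unlabelled_diameter U \<ge> ereal x" using U by (auto simp: S_def)
    obtain G where G: "G \<in> U" using unlabelled_class_nonempty[OF U1(1)] by blast
    have Gk: "k_tree k G" "card (hedra k G) = n" using unlabelled_class(1)[OF U1(1) G] by (auto simp: k_trees_def)
    have "hedra k G \<noteq> {}" using Gk(2) n by auto
    define P where "P H \<longleftrightarrow> (\<exists>\<kappa> K N. represents k G \<kappa> K N \<and> height (Node (Suc k) N) = H)" for H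
    obtain H1 where "P H1" using k_tree_represented[OF Gk(1) \<open>hedra k G \<noteq> {}\<close>] unfolding P_def by blast
    define H where "H = (LEAST H. P H)"
    have "P H" unfolding H_def using \<open>P H1\<close> by (rule LeastI)
    then obtain \<kappa> K N where r: "represents k G \<kappa> K N" "height (Node (Suc k) N) = H" unfolding P_def by blast
    have min: "H \<le> height (Node (Suc k) N')" if "represents k G \<kappa>' K' N'" for \<kappa>' K' N'
      unfolding H_def by (rule Least_le) (use that in \<open>auto simp: P_def simp del: height.simps\<close>)
    have "ereal x \<le> graph_diameter G" using U1(2) unlabelled_diameter_eq[OF U1(1) G] by simp
    also have "\<dots> \<le> ereal (real (2 * H + 1))" using represents_diameter[OF r(1) k, of "Suc k"] r(2) by simp
    finally have "x \<le> real (2 * H + 1)" by simp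
    then have "real (2 * H0) < real (2 * H + 2)" using H0(2) by simp
    then have HH0: "H0 \<le> H" by simp
    then have "H \<ge> 2" using H0 by simp
    obtain s s' M where s: "N = add_mset s (add_mset s' M)" "height s = H - 1" "height s' = H - 1 \<or> height s' = H - 2"
      using represents_height_minimal[OF r \<open>H \<ge> 2\<close>] min by blast
    have "Node (Suc k) N \<in> root_trees k n"
      using represents_root_tree[OF r(1)] Gk(2) by (simp add: root_trees_def)
    then have "Node (Suc k) N \<in> balanced_tall k n H0"
      unfolding balanced_tall_def using s HH0 by auto
    moreover have "R U (Node (Suc k) N)" unfolding R_def using G r(1) by auto
    ultimately show ?thesis by blast
  qed
  then obtain f where f: "\<And>U. U \<in> S \<Longrightarrow> f U \<in> balanced_tall k n H0 \<and> R U (f U)" by metis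
  have "inj_on f S"
  proof (rule inj_onI)
    fix U V assume UV: "U \<in> S" "V \<in> S" "f U = f V"
    obtain G \<kappa> K where G: "G \<in> U" "represents k G \<kappa> K (sub (f U))" using f[OF UV(1)] unfolding R_def by blast
    obtain H \<kappa>' L where H: "H \<in> V" "represents k H \<kappa>' L (sub (f U))" using f[OF UV(2)] UV(3) unfolding R_def by auto
    obtain g where g: "inj_on g (pverts G)" "H = relabel g G" using represents_iso[OF G(2) H(2)] by blast
    have U: "U \<in> unlabelled_k_trees k n" and V: "V \<in> unlabelled_k_trees k n" using UV by (auto simp: S_def)
    note cG = unlabelled_class[OF U G(1)] and cH = unlabelled_class[OF V H(1)]
    have "pair_graph G" using cG(1) by (auto simp: k_trees_def intro: k_tree_graph)
    then have "digraph_iso (with_proj G) (with_proj H)" unfolding g(2) using g(1) by (rule digraph_iso_relabel)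
    then have "(G, H) \<in> isomorphic_k_trees k n" using cG(1) cH(1) by (simp add: isomorphic_k_trees_def)
    then show "U = V" unfolding cG(2) cH(2) by (rule equiv_class_eq[OF equiv_isomorphic_k_trees])
  qed
  moreover have "f ` S \<subseteq> balanced_tall k n H0" using f by auto
  moreover have "finite (balanced_tall k n H0)"
    by (rule finite_subset[of _ "root_trees k n"]) (auto simp: balanced_tall_def root_trees_def finite_trees)
  ultimately show ?thesis unfolding S_def[symmetric] by (rule card_inj_on_le)
qed

lemma card_root_trees_le_unlabelled:
  "card (root_trees k n) \<le> card (unlabelled_k_trees k n) * (n * Suc k ^ Suc k)"
proof -
  define r where "r U = (SOME G. G \<in> U)" for U :: "nat pair_pre_digraph set"
  define X where "X U = (\<Union>K\<in>hedra k (r U). (\<lambda>\<kappa>. read_tree n (r U) \<kappa> K (Suc k)) ` (K \<rightarrow>\<^sub>E {..k}))" for U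
  have rU: "r U \<in> U" if "U \<in> unlabelled_k_trees k n" for U
    unfolding r_def using unlabelled_class_nonempty[OF that] by (rule someI_ex)
  have hed: "finite (hedra k (r U))" "card (hedra k (r U)) = n" if "U \<in> unlabelled_k_trees k n" for U
    using unlabelled_class(1)[OF that rU[OF that]] by (auto simp: k_trees_def intro: finite_hedra k_tree_graph)
  have finK: "finite K" "card K = Suc k" if "K \<in> hedra k G" for K :: "nat set" and G
    using that by (auto simp: hedra_def clique_def)
  have "root_trees k n \<subseteq> (\<Union>U\<in>unlabelled_k_trees k n. X U)"
  proof
    fix t assume t: "t \<in> root_trees k n"
    then obtain N where N: "t = Node (Suc k) N" by (cases t) (auto simp: root_trees_def trees_def)
    obtain G :: "nat pair_pre_digraph" and K where r: "represents k G (\<lambda>a. a mod Suc k) K N"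
      using exists_represented t unfolding N root_trees_def by blast
    have nt: "nodes t = n" using t by (simp add: root_trees_def trees_def)
    have G: "G \<in> k_trees k n"
      using represents_k_tree(1)[OF r] represents_k_tree(2)[OF r, of "Suc k"] nt N by (simp add: k_trees_def)
    define U where "U = isomorphic_k_trees k n `` {G}"
    have U: "U \<in> unlabelled_k_trees k n" unfolding U_def unlabelled_k_trees_def using G by (rule quotientI)
    have "digraph_iso (with_proj G) (with_proj (r U))"
      using rU[OF U] unfolding U_def by (auto simp: isomorphic_k_trees_def)
    then obtain f where f: "inj_on f (pverts G)" "r U = relabel f G" using digraph_iso_imp_relabel by blast
    define K' where "K' = f ` K"
    obtain \<kappa> where \<kappa>: "represents k (r U) \<kappa> K' N"
      unfolding f(2) K'_def using represents_relabel[OF r f(1)] by blast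
    have K': "K' \<in> hedra k (r U)"
      using represents_card[OF \<kappa>] \<kappa> by (auto simp: hedra_def clique_def represents_def graph_of_def)
    have im: "\<kappa> ` K' = {..k}" using \<kappa> by (simp add: represents_def)
    have "read_tree n (r U) (restrict \<kappa> K') K' (Suc k) = read_tree n (r U) \<kappa> K' (Suc k)"
      by (rule read_tree_cong) simp
    also have "\<dots> = t" unfolding N by (rule read_represents[OF \<kappa>]) (use nt N in simp)
    finally have "t = read_tree n (r U) (restrict \<kappa> K') K' (Suc k)" by simp
    moreover have "restrict \<kappa> K' \<in> K' \<rightarrow>\<^sub>E {..k}" using im by auto
    ultimately have "t \<in> X U" unfolding X_def using K' by blast
    then show "t \<in> (\<Union>U\<in>unlabelled_k_trees k n. X U)" using U by blast
  qed
  moreover have finX: "finite (X U)" and cardX: "card (X U) \<le> n * Suc k ^ Suc k" if U: "U \<in> unlabelled_k_trees k n" for U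
  proof -
    have fP: "finite (K \<rightarrow>\<^sub>E {..k})" "card (K \<rightarrow>\<^sub>E {..k}) = Suc k ^ Suc k" if "K \<in> hedra k (r U)" for K
      using finK[OF that] by (auto simp: card_funcsetE intro: finite_PiE)
    show "finite (X U)" unfolding X_def using hed(1)[OF U] fP by auto
    have "card (X U) \<le> (\<Sum>K\<in>hedra k (r U). card ((\<lambda>\<kappa>. read_tree n (r U) \<kappa> K (Suc k)) ` (K \<rightarrow>\<^sub>E {..k})))"
      unfolding X_def by (rule card_UN_le[OF hed(1)[OF U]])
    also have "\<dots> \<le> (\<Sum>K\<in>hedra k (r U). Suc k ^ Suc k)"
    proof (rule sum_mono)
      fix K assume K: "K \<in> hedra k (r U)"
      show "card ((\<lambda>\<kappa>. read_tree n (r U) \<kappa> K (Suc k)) ` (K \<rightarrow>\<^sub>E {..k})) \<le> Suc k ^ Suc k"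
        using card_image_le[OF fP(1)[OF K]] fP(2)[OF K] by metis
    qed
    also have "\<dots> = n * Suc k ^ Suc k" using hed(2)[OF U] by simp
    finally show "card (X U) \<le> n * Suc k ^ Suc k" .
  qed
  ultimately have "card (root_trees k n) \<le> card (\<Union>U\<in>unlabelled_k_trees k n. X U)"
    using finite_unlabelled_k_trees by (intro card_mono) auto
  also have "\<dots> \<le> (\<Sum>U\<in>unlabelled_k_trees k n. card (X U))"
    by (rule card_UN_le[OF finite_unlabelled_k_trees])
  also have "\<dots> \<le> (\<Sum>U\<in>unlabelled_k_trees k n. n * Suc k ^ Suc k)"
    by (rule sum_mono) (rule cardX)
  finally show ?thesis by simp
qed

theorem theorem1p2:
  fixes k :: nat
  assumes "k \<ge> 1"
  shows "\<exists>C c :: real. C > 0 \<and> c > 0 \<and>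
    (\<forall>n\<ge>1. \<forall>x\<ge>0.
      measure_pmf.prob (random_unlabelled_k_tree k n) {U. unlabelled_diameter U \<ge> ereal x}
        \<le> C * exp (- c * x ^ 2 / real n))"
proof -
  obtain \<rho> c C :: real where \<rho>: "\<rho> > 0" and c: "c > 0" and C: "C > 0"
    and lower: "\<And>n. n \<ge> 1 \<Longrightarrow> c / (real n * sqrt (real n)) \<le> real (card (root_trees k n)) * \<rho> ^ n"
    and upper: "\<And>n H0. n \<ge> 1 \<Longrightarrow> H0 \<ge> 6 \<Longrightarrow> n \<le> H0 ^ 2 \<Longrightarrow>
      real (card (balanced_tall k n H0)) * \<rho> ^ n
        \<le> C / (real n ^ 2 * sqrt (real n)) * exp (- (real H0 ^ 2) / (784 * real n))"
    using tree_count_bounds[OF assms] by blast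
  define B where "B = real (Suc k ^ Suc k)"
  have B: "B > 0" by (simp add: B_def del: power_Suc)
  \<comment> \<open>\<open>50176 = 784 * 64\<close>, from the exponent in \<open>upper\<close> and
    \<open>H \<ge> x / 8\<close>.\<close>
  define a :: real where "a = 1 / 50176"
  define M where "M = C * B / c"
  have M: "M > 0" using C B c by (simp add: M_def)
  have "measure_pmf.prob (random_unlabelled_k_tree k n) {U. unlabelled_diameter U \<ge> ereal x}
      \<le> (M + exp (576 * a)) * exp (- a * x ^ 2 / real n)" if n: "n \<ge> 1" and x: "x \<ge> 0" for n :: nat and x :: real
  proof -
    define \<U> where "\<U> = unlabelled_k_trees k n"
    define S where "S = {U \<in> \<U>. unlabelled_diameter U \<ge> ereal x}"
    have fin: "finite \<U>" and ne: "\<U> \<noteq> {}"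
      unfolding \<U>_def by (rule finite_unlabelled_k_trees, rule unlabelled_k_trees_nonempty)
    have pos: "real (card \<U>) > 0" using fin ne by (simp add: card_gt_0_iff)
    have "measure_pmf.prob (random_unlabelled_k_tree k n) {U. unlabelled_diameter U \<ge> ereal x}
        = real (card S) / real (card \<U>)"
      unfolding random_unlabelled_k_tree_def S_def \<U>_def[symmetric] measure_pmf_of_set[OF ne fin]
      by (simp add: Int_def)
    also have "\<dots> \<le> (M + exp (576 * a)) * exp (- a * x ^ 2 / real n)"
    \<comment> \<open>In this case \<open>H\<close> between \<open>x / 8\<close> and
      \<open>x / 4\<close> satisfies \<open>H \<ge> 6\<close> and \<open>n \<le> H\<^sup>2\<close>,
      as \<open>upper\<close> requires. Otherwise \<open>x\<^sup>2 \<le> 576 n\<close> with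
      \<open>576 = 24\<^sup>2\<close>, and the summand \<open>exp (576 * a)\<close> lifts the bound
      to at least 1.\<close>
    proof (cases "24 \<le> x \<and> 64 * real n \<le> x ^ 2")
      case True
      define H where "H = nat \<lfloor>x / 4\<rfloor>"
      have H: "real H \<le> x / 4" "x / 4 < real H + 1" "H \<ge> 6" using True unfolding H_def by linarith+
      have xH: "x / 8 \<le> real H" using H True by linarith
      have x64: "(x / 8) ^ 2 \<le> real H ^ 2" using xH x by (intro power_mono) auto
      moreover have "(x / 8) ^ 2 = x ^ 2 / 64" by (simp add: power_divide)
      ultimately have "real n \<le> real H ^ 2" using True by linarith
      then have nH: "n \<le> H ^ 2" by (simp only: of_nat_power [symmetric] of_nat_le_iff)
      have "real (2 * H) - 1 < x" using H True by simp
      then have "card S \<le> card (balanced_tall k n H)"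
        unfolding S_def \<U>_def using H by (intro card_diameter_ge[OF assms n]) auto
      then have "real (card S) * \<rho> ^ n \<le> real (card (balanced_tall k n H)) * \<rho> ^ n"
        using \<rho> by (intro mult_right_mono) auto
      also have "\<dots> \<le> C / (real n ^ 2 * sqrt (real n)) * exp (- (real H ^ 2) / (784 * real n))"
        by (rule upper[OF n H(3) nH])
      also have "\<dots> \<le> C / (real n ^ 2 * sqrt (real n)) * exp (- a * x ^ 2 / real n)"
      proof (intro mult_left_mono)
        have "(x / 8) ^ 2 / (784 * real n) \<le> real H ^ 2 / (784 * real n)"
          using x64 by (rule divide_right_mono) simp
        then show "exp (- (real H ^ 2) / (784 * real n)) \<le> exp (- a * x ^ 2 / real n)"
          by (simp add: a_def power_divide)
      qed (use C in auto)
      finally have S_le: "real (card S) * \<rho> ^ n \<le> C / (real n ^ 2 * sqrt (real n)) * exp (- a * x ^ 2 / real n)" .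
      have "c / (real n * sqrt (real n)) \<le> real (card (root_trees k n)) * \<rho> ^ n" by (rule lower[OF n])
      also have "\<dots> \<le> real (card \<U> * (n * Suc k ^ Suc k)) * \<rho> ^ n"
        using card_root_trees_le_unlabelled[of k n] \<rho> unfolding \<U>_def
        by (intro mult_right_mono of_nat_mono) auto
      also have "\<dots> = real (card \<U>) * \<rho> ^ n * (real n * B)" by (simp add: B_def del: power_Suc)
      finally have U_ge: "c / (real n * sqrt (real n)) \<le> real (card \<U>) * \<rho> ^ n * (real n * B)" .
      have M_eq: "M * exp (- a * x ^ 2 / real n) * (c / (real n * sqrt (real n)) / (real n * B))
          = C / (real n ^ 2 * sqrt (real n)) * exp (- a * x ^ 2 / real n)"
        using B c n by (simp add: M_def power2_eq_square mult_ac)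
      have "real (card S) * \<rho> ^ n \<le> M * exp (- a * x ^ 2 / real n) * (c / (real n * sqrt (real n)) / (real n * B))"
        unfolding M_eq by (rule S_le)
      also have "\<dots> \<le> M * exp (- a * x ^ 2 / real n) * (real (card \<U>) * \<rho> ^ n)"
      proof (rule mult_left_mono)
        show "c / (real n * sqrt (real n)) / (real n * B) \<le> real (card \<U>) * \<rho> ^ n"
          using n B by (subst pos_divide_le_eq) (auto intro: U_ge)
      qed (use M in simp)
      finally have "real (card S) * \<rho> ^ n \<le> (M * exp (- a * x ^ 2 / real n) * real (card \<U>)) * \<rho> ^ n"
        by (simp only: mult.assoc)
      then have "real (card S) \<le> M * exp (- a * x ^ 2 / real n) * real (card \<U>)"
        using \<rho> by (rule mult_right_le_imp_le[OF _ zero_less_power])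
      then have "real (card S) / real (card \<U>) \<le> M * exp (- a * x ^ 2 / real n)"
        using pos by (simp add: pos_divide_le_eq)
      also have "\<dots> \<le> (M + exp (576 * a)) * exp (- a * x ^ 2 / real n)"
        by (intro mult_right_mono) auto
      finally show ?thesis .
    next
      case False
      have "x ^ 2 \<le> 576 * real n"
      proof (cases "24 \<le> x")
        case True
        then have "x ^ 2 < 64 * real n" using False by simp
        then show ?thesis using n by linarith
      next
        case False
        then have "x ^ 2 \<le> 24 ^ 2" using x by (intro power_mono) auto
        then show ?thesis using n by simp
      qed
      then have "a * x ^ 2 / real n \<le> 576 * a" using n by (simp add: a_def field_simps)
      then have "1 \<le> exp (576 * a + - a * x ^ 2 / real n)" by simp
      also have "\<dots> = exp (576 * a) * exp (- a * x ^ 2 / real n)" by (rule exp_add)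
      also have "\<dots> \<le> (M + exp (576 * a)) * exp (- a * x ^ 2 / real n)"
        using M by (intro mult_right_mono) auto
      finally have "1 \<le> (M + exp (576 * a)) * exp (- a * x ^ 2 / real n)" .
      moreover have "real (card S) / real (card \<U>) \<le> 1"
        using pos card_mono[OF fin, of S] by (simp add: S_def)
      ultimately show ?thesis by linarith
    qed
    finally show ?thesis .
  qed
  moreover have "M + exp (576 * a) > 0" "a > 0" using M by (simp_all add: a_def add_pos_pos)
  ultimately show ?thesis by blast
qed

end
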